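(* Let $I\subset\mathbb{R}$ be an open interval, let $\hat\eta:I\to\mathbb{R}$ be of class $C^{1,1}$, and let $\hat\Gamma=\{(x,\hat\eta(x)):x\in I\}$ be its graph with unit normal $\boldsymbol n=\frac{1}{\sqrt{1+\hat\eta_x^2}}(-\hat\eta_x,1)$. Let $\hat\phi\in H^3(\mathbb{R}^2)$ satisfy $\partial_{\boldsymbol n}\hat\phi=0$ on $\hat\Gamma$, i.e. $-\hat\eta_x\hat\phi_x+\hat\phi_y=0$ on $\hat\Gamma$. Then, (almost everywhere) on $\hat\Gamma$, $$\partial_{\boldsymbol n}\left(|\nabla\hat\phi|^2\right)=2\kappa\,|\nabla\hat\phi|^2,\qquad \kappa=\partial_x\left(\frac{\hat\eta_x}{\sqrt{1+\hat\eta_x^2}}\right).$$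
   Context: Coordinates in $\mathbb{R}^2$ are $(x,y)$; subscripts $x,y$ denote partial derivatives, and $\partial_{\boldsymbol n}(\cdot)=\boldsymbol n\cdot\nabla(\cdot)$. Functions and derivatives on $\hat\Gamma$ are understood in the sense of traces. *)

theory Defs
  imports "HOL-Analysis.Analysis"
begin

subsection \<open>Test functions and weak derivatives\<close>

text \<open>A multi-index of order k is encoded as a list of k coordinate directions.\<close>

fun partials :: "'a::euclidean_space list \<Rightarrow> ('a \<Rightarrow> real) \<Rightarrow> ('a \<Rightarrow> real)" where
  "partials [] f = f"
| "partials (b # bs) f = (\<lambda>z. frechet_derivative (partials bs f) (at z) b)"

definition smooth :: "('a::euclidean_space \<Rightarrow> real) \<Rightarrow> bool" where
  "smooth f \<longleftrightarrow> (\<forall>bs. set bs \<subseteq> Basis \<longrightarrow> (\<forall>z. partials bs f differentiable (at z)))"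

definition test_function :: "('a::euclidean_space \<Rightarrow> real) \<Rightarrow> bool" where
  "test_function f \<longleftrightarrow> smooth f \<and> compact (closure {z. f z \<noteq> 0})"

definition locally_integrable :: "('a::euclidean_space \<Rightarrow> real) \<Rightarrow> bool" where
  "locally_integrable u \<longleftrightarrow> (\<forall>K. compact K \<longrightarrow> u absolutely_integrable_on K)"

definition has_weak_deriv ::
    "'a::euclidean_space list \<Rightarrow> ('a \<Rightarrow> real) \<Rightarrow> ('a \<Rightarrow> real) \<Rightarrow> bool" where
  "has_weak_deriv bs u v \<longleftrightarrow>
     locally_integrable u \<and> locally_integrable v \<and>
     (\<forall>\<psi>. test_function \<psi> \<longrightarrow>
        (LINT z|lebesgue. u z * partials bs \<psi> z) =
        (-1) ^ length bs * (LINT z|lebesgue. v z * \<psi> z))"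

text \<open>Some representative of the weak derivative, which is unique up to null sets; the value is
  arbitrary if there is no weak derivative.\<close>

definition wderiv :: "'a::euclidean_space list \<Rightarrow> ('a \<Rightarrow> real) \<Rightarrow> ('a \<Rightarrow> real)" where
  "wderiv bs u = (SOME v. has_weak_deriv bs u v)"

subsection \<open>The Sobolev spaces of square integrable functions\<close>

definition L2_space :: "'a measure \<Rightarrow> ('a \<Rightarrow> real) set" where
  "L2_space M = {u \<in> borel_measurable M. integrable M (\<lambda>z. (u z)\<^sup>2)}"

definition L2_norm :: "'a measure \<Rightarrow> ('a \<Rightarrow> real) \<Rightarrow> real" where
  "L2_norm M u = sqrt (LINT z|M. (u z)\<^sup>2)"

definition sobolev_H :: "nat \<Rightarrow> ('a::euclidean_space \<Rightarrow> real) set" where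
  "sobolev_H k = {u \<in> L2_space lebesgue.
     \<forall>bs. set bs \<subseteq> Basis \<and> length bs \<le> k \<longrightarrow>
       (\<exists>v \<in> L2_space lebesgue. has_weak_deriv bs u v)}"

definition tends_in_H1 ::
    "(nat \<Rightarrow> 'a::euclidean_space \<Rightarrow> real) \<Rightarrow> ('a \<Rightarrow> real) \<Rightarrow> bool" where
  "tends_in_H1 \<psi> u \<longleftrightarrow>
     (\<lambda>k. L2_norm lebesgue (\<lambda>z. \<psi> k z - u z)) \<longlonglongrightarrow> 0 \<and>
     (\<forall>b\<in>Basis. (\<lambda>k. L2_norm lebesgue (\<lambda>z. partials [b] (\<psi> k) z - wderiv [b] u z)) \<longlonglongrightarrow> 0)"

subsection \<open>Traces on a graph\<close>

text \<open>Functions on the graph of \<open>\<eta>\<close> over \<open>I\<close> are written as functions of the abscissa. The trace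
  operator is the continuous extension, from \<open>H\<^sup>1\<close> of the plane to \<open>L\<^sup>2\<^sub>l\<^sub>o\<^sub>c\<close> of the graph, of the
  restriction of test functions. The slope of the graph is bounded over every compact subinterval
  of \<open>I\<close>, so there the abscissa and the arc length give the same null sets and the same \<open>L\<^sup>2\<close>
  convergence.\<close>

definition has_graph_trace ::
    "real set \<Rightarrow> (real \<Rightarrow> real) \<Rightarrow> (real \<times> real \<Rightarrow> real) \<Rightarrow> (real \<Rightarrow> real) \<Rightarrow> bool" where
  "has_graph_trace I \<eta> u g \<longleftrightarrow>
     u \<in> sobolev_H 1 \<and>
     (\<exists>\<psi>. (\<forall>k. test_function (\<psi> k)) \<and> tends_in_H1 \<psi> u \<and>
        (\<forall>a b. {a..b} \<subseteq> I \<longrightarrow>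
           g \<in> L2_space (lebesgue_on {a..b}) \<and>
           (\<lambda>k. L2_norm (lebesgue_on {a..b}) (\<lambda>x. \<psi> k (x, \<eta> x) - g x)) \<longlonglongrightarrow> 0))"

text \<open>As for \<open>wderiv\<close>, this is one representative.\<close>

definition graph_trace ::
    "real set \<Rightarrow> (real \<Rightarrow> real) \<Rightarrow> (real \<times> real \<Rightarrow> real) \<Rightarrow> (real \<Rightarrow> real)" where
  "graph_trace I \<eta> u = (SOME g. has_graph_trace I \<eta> u g)"

subsection \<open>Geometry of the graph\<close>

text \<open>The Lipschitz condition on the derivative is local, so that functions with a globally
  Lipschitz derivative on \<open>I\<close> are included.\<close>

definition C11_on :: "real set \<Rightarrow> (real \<Rightarrow> real) \<Rightarrow> bool" where
  "C11_on I \<eta> \<longleftrightarrow>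
     (\<forall>x\<in>I. \<eta> differentiable (at x)) \<and>
     (\<forall>x\<in>I. \<exists>e>0. \<exists>L. L-lipschitz_on (cball x e \<inter> I) (deriv \<eta>))"

definition unit_normal :: "(real \<Rightarrow> real) \<Rightarrow> real \<Rightarrow> real \<times> real" where
  "unit_normal \<eta> x = (1 / sqrt (1 + (deriv \<eta> x)\<^sup>2)) *\<^sub>R (- deriv \<eta> x, 1)"

definition curvature :: "(real \<Rightarrow> real) \<Rightarrow> real \<Rightarrow> real" where
  "curvature \<eta> = deriv (\<lambda>x. deriv \<eta> x / sqrt (1 + (deriv \<eta> x)\<^sup>2))"

definition normal_deriv ::
    "real set \<Rightarrow> (real \<Rightarrow> real) \<Rightarrow> (real \<times> real \<Rightarrow> real) \<Rightarrow> real \<Rightarrow> real" where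
  "normal_deriv I \<eta> u x =
     unit_normal \<eta> x \<bullet> (graph_trace I \<eta> (wderiv [(1, 0)] u) x, graph_trace I \<eta> (wderiv [(0, 1)] u) x)"

definition grad_sq :: "(real \<times> real \<Rightarrow> real) \<Rightarrow> (real \<times> real \<Rightarrow> real)" where
  "grad_sq u z = (norm (wderiv [(1, 0)] u z, wderiv [(0, 1)] u z))\<^sup>2"

end

theory Submission
  imports Defs
begin

text \<open>The idea is a computation on the curve. Write \<open>f\<close> and \<open>g\<close> for the traces of \<open>\<phi>\<^sub>x\<close> and \<open>\<phi>\<^sub>y\<close> as functions
of the abscissa, \<open>p\<close>, \<open>q\<close>, \<open>s\<close> for those of \<open>\<phi>\<^sub>x\<^sub>x\<close>, \<open>\<phi>\<^sub>x\<^sub>y\<close>, \<open>\<phi>\<^sub>y\<^sub>y\<close>, and \<open>m\<close> for the slope of the graph. The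
boundary condition says \<open>g = m f\<close>. The chain rule along the graph gives \<open>f' = p + m q\<close> and
\<open>g' = q + m s\<close>, so differentiating the boundary condition yields \<open>m' f = q + m s - m (p + m q)\<close>. The
right-hand side is, up to the factor \<open>2 f / sqrt (1 + m\<^sup>2)\<close>, the normal derivative of \<open>\<phi>\<^sub>x\<^sup>2 + \<phi>\<^sub>y\<^sup>2\<close>,
and \<open>m' / (1 + m\<^sup>2) powr (3/2)\<close> is the curvature. Where \<open>f = 0\<close> also \<open>g = 0\<close>, and both sides vanish;
where \<open>f \<noteq> 0\<close> the slope is \<open>g / f\<close> nearby, so it is differentiable wherever \<open>f\<close> and \<open>g\<close> are
(\<open>curvature_identity\<close>).

Everything else justifies these manipulations for traces. Test functions \<open>\<psi>\<^sub>n\<close> converge to \<open>\<phi>\<close> in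
\<open>H\<^sup>3\<close> (\<open>sobolev_dense\<close>), by mollification and cutoff. Integration along coordinate lines bounds,
for a plane test function \<open>u\<close>, the mean square of \<open>u\<close> on the graph by the \<open>H\<^sup>1\<close> energy
(\<open>trace_bound\<close>), the supremum by an energy with second derivatives (\<open>sup_bound\<close>), and the mean square of a product
\<open>u v\<close> by the product of the \<open>H\<^sup>1\<close> energies (\<open>product_bound_11\<close>). The first bound gives existence and
uniqueness of traces (\<open>graph_trace_L2tends\<close>). The other two show that the first and second derivatives
of \<open>|\<nabla>\<psi>\<^sub>n|\<^sup>2\<close> converge in the mean square, whence \<open>|\<nabla>\<phi>|\<^sup>2\<close> and its first derivatives belong to \<open>H\<^sup>1\<close> and have
traces, which are the limits of the restrictions of the smooth approximations. Along a subsequence all these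
restrictions converge almost everywhere, so polynomial identities between derivatives of \<open>\<psi>\<^sub>n\<close> pass to
the traces.

The chain rule passes to the limit in integrated form: \<open>f\<close> and \<open>g\<close> are indefinite integrals of square
integrable functions (\<open>absolutely_continuous_limit\<close>). Their pointwise derivatives, which the
definition of curvature as a classical derivative requires, come from the Lebesgue differentiation
theorem (\<open>Lebesgue_differentiation\<close>), proved with a Vitali covering.\<close>

section \<open>Smooth functions and test functions\<close>

text \<open>The one-step form of \<open>partials\<close>, folded into a constant so that rewriting does not expose the
Frechet derivative.\<close>

definition partial :: "'a::euclidean_space \<Rightarrow> ('a \<Rightarrow> real) \<Rightarrow> 'a \<Rightarrow> real" where
  "partial b f z = frechet_derivative f (at z) b"

lemma partials_Cons: "partials (b # bs) f = partial b (partials bs f)"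
  by (simp add: partial_def fun_eq_iff)

declare partials.simps(2) [simp del]
declare partials_Cons [simp]

lemma partials_append: "partials (as @ bs) f = partials as (partials bs f)"
  by (induction as) auto

lemma partial_eq: "(f has_derivative D) (at z) \<Longrightarrow> partial b f z = D b"
  unfolding partial_def using frechet_derivative_at by metis

lemma partial_eq_fun: "(\<And>z. (f has_derivative D z) (at z)) \<Longrightarrow> partial b f = (\<lambda>z. D z b)"
  using partial_eq by blast

lemma has_derivative_partial:
  "f differentiable (at z) \<Longrightarrow> (f has_derivative (\<lambda>h. \<Sum>b\<in>Basis. (h \<bullet> b) * partial b f z)) (at z)"
proof -
  assume "f differentiable (at z)"
  then have D: "(f has_derivative frechet_derivative f (at z)) (at z)"
    using frechet_derivative_works by blast
  have "frechet_derivative f (at z) h = (\<Sum>b\<in>Basis. (h \<bullet> b) * partial b f z)" for h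
  proof -
    have l: "linear (frechet_derivative f (at z))" using D has_derivative_linear by blast
    have "frechet_derivative f (at z) h = frechet_derivative f (at z) (\<Sum>b\<in>Basis. (h \<bullet> b) *\<^sub>R b)"
      by (simp add: euclidean_representation)
    also have "\<dots> = (\<Sum>b\<in>Basis. (h \<bullet> b) * partial b f z)"
      by (simp add: linear_sum[OF l] linear_scale[OF l] partial_def)
    finally show ?thesis .
  qed
  then have "frechet_derivative f (at z) = (\<lambda>h. \<Sum>b\<in>Basis. (h \<bullet> b) * partial b f z)" by blast
  then show ?thesis using D by simp
qed

text \<open>The directional derivatives are taken off at the inside here, whereas \<open>partials\<close> adds them at the outside. This
is the form in which closure under products and compositions follows by induction on the order.\<close>

primrec Ck :: "nat \<Rightarrow> ('a::euclidean_space \<Rightarrow> real) \<Rightarrow> bool" where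
  "Ck 0 f \<longleftrightarrow> True"
| "Ck (Suc n) f \<longleftrightarrow> (\<forall>z. f differentiable (at z)) \<and> (\<forall>b\<in>Basis. Ck n (partial b f))"

lemma smooth_differentiable: "smooth f \<Longrightarrow> f differentiable (at z)"
  unfolding smooth_def by (metis empty_set empty_subsetI partials.simps(1))

lemma smooth_partial: "smooth f \<Longrightarrow> b \<in> Basis \<Longrightarrow> smooth (partial b f)"
  unfolding smooth_def
proof (intro allI impI)
  fix bs :: "'a list" and z assume *: "\<forall>bs. set bs \<subseteq> Basis \<longrightarrow> (\<forall>z. partials bs f differentiable at z)" "b \<in> Basis"
    "set bs \<subseteq> Basis"
  then have "set (bs @ [b]) \<subseteq> Basis" by auto
  with * have "partials (bs @ [b]) f differentiable at z" by blast
  then show "partials bs (partial b f) differentiable at z" by (simp add: partials_append)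
qed

lemma smooth_partials: "smooth f \<Longrightarrow> set bs \<subseteq> Basis \<Longrightarrow> smooth (partials bs f)"
  by (induction bs) (auto simp: smooth_partial)

lemma Ck_partials:
  "Ck n f \<Longrightarrow> set bs \<subseteq> Basis \<Longrightarrow> length bs < n \<Longrightarrow> partials bs f differentiable (at z)"
proof (induction bs arbitrary: f n rule: rev_induct)
  case Nil
  then show ?case by (cases n) auto
next
  case (snoc b bs)
  then obtain m where m: "n = Suc m" by (cases n) auto
  then have "Ck m (partial b f)" using snoc.prems by auto
  from snoc.IH[OF this] snoc.prems m show ?case by (simp add: partials_append)
qed

lemma smooth_iff_Ck: "smooth f \<longleftrightarrow> (\<forall>n. Ck n f)"
proof
  have "smooth f \<Longrightarrow> Ck n f" for n
    by (induction n arbitrary: f) (auto simp: smooth_differentiable smooth_partial)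
  then show "smooth f \<Longrightarrow> \<forall>n. Ck n f" by blast
next
  show "\<forall>n. Ck n f \<Longrightarrow> smooth f"
    unfolding smooth_def using Ck_partials by blast
qed

lemma Ck_Suc: "Ck (Suc n) f \<Longrightarrow> Ck n f"
  by (induction n arbitrary: f) auto

lemma partial_add:
  assumes "f differentiable (at z)" "g differentiable (at z)"
  shows "partial b (\<lambda>z. f z + g z) z = partial b f z + partial b g z"
  using assms unfolding frechet_derivative_works partial_def[symmetric]
  by (subst partial_eq[OF has_derivative_add]) (auto simp: partial_def)

lemma partial_mult:
  assumes "f differentiable (at z)" "g differentiable (at z)"
  shows "partial b (\<lambda>z. f z * g z) z = f z * partial b g z + partial b f z * g z"
  using assms unfolding frechet_derivative_works partial_def[symmetric]
  by (subst partial_eq[OF has_derivative_mult]) (auto simp: partial_def)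

lemma Ck_const: "Ck n (\<lambda>z. c)"
proof (induction n arbitrary: c)
  case (Suc n)
  have "partial b (\<lambda>z::'a. c) = (\<lambda>z. 0)" for b
    by (rule partial_eq_fun) simp
  then show ?case using Suc by simp
qed simp

lemma Ck_add: "Ck n f \<Longrightarrow> Ck n g \<Longrightarrow> Ck n (\<lambda>z. f z + g z)"
proof (induction n arbitrary: f g)
  case (Suc n)
  have "partial b (\<lambda>z. f z + g z) = (\<lambda>z. partial b f z + partial b g z)" for b
    using Suc.prems by (auto simp: partial_add)
  then show ?case using Suc by simp
qed simp

lemma Ck_mult: "Ck n f \<Longrightarrow> Ck n g \<Longrightarrow> Ck n (\<lambda>z. f z * g z)"
proof (induction n arbitrary: f g)
  case (Suc n)
  have *: "partial b (\<lambda>z. f z * g z) = (\<lambda>z. f z * partial b g z + partial b f z * g z)" for b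
    using Suc.prems by (auto simp: partial_mult)
  show ?case using Suc.prems Suc.IH Ck_Suc[OF Suc.prems(1)] Ck_Suc[OF Suc.prems(2)]
    by (auto simp: * intro!: Ck_add)
qed simp

text \<open>A family of functions closed under differentiation stands for the iterated derivatives of the
outer function, so no formula for them is needed.\<close>

lemma Ck_comp:
  assumes F: "\<And>f. f \<in> F \<Longrightarrow> \<exists>f'\<in>F. \<forall>t. (f has_real_derivative f' t) (at t)"
    and "f \<in> F" and "Ck n q"
  shows "Ck n (\<lambda>z. f (q z))"
  using assms(2,3)
proof (induction n arbitrary: f)
  case (Suc n)
  obtain f' where f': "f' \<in> F" "\<And>t. (f has_real_derivative f' t) (at t)" using F Suc.prems(1) by blast
  have d: "((\<lambda>z. f (q z)) has_derivative (\<lambda>h. f' (q z) * frechet_derivative q (at z) h)) (at z)" for z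
  proof -
    have "(q has_derivative frechet_derivative q (at z)) (at z)"
      using Suc.prems(2) frechet_derivative_works by auto
    moreover have "(f has_derivative (\<lambda>h. f' (q z) * h)) (at (q z))"
      using f'(2) by (simp add: has_field_derivative_def)
    ultimately show ?thesis using has_derivative_compose by blast
  qed
  then have "partial b (\<lambda>z. f (q z)) = (\<lambda>z. f' (q z) * partial b q z)" for b
    using partial_eq_fun[OF d] by (simp add: partial_def)
  moreover have "Ck n (\<lambda>z. f' (q z))" by (rule Suc.IH[OF f'(1) Ck_Suc[OF Suc.prems(2)]])
  ultimately show ?case using d Suc.prems(2) by (auto intro: Ck_mult simp: differentiable_def)
qed simp

lemma smooth_const: "smooth (\<lambda>z. c)"
  and smooth_add: "smooth f \<Longrightarrow> smooth g \<Longrightarrow> smooth (\<lambda>z. f z + g z)"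
  and smooth_mult: "smooth f \<Longrightarrow> smooth g \<Longrightarrow> smooth (\<lambda>z. f z * g z)"
  by (auto simp: smooth_iff_Ck Ck_const Ck_add Ck_mult)

lemma smooth_inner: "smooth (\<lambda>z. z \<bullet> c)"
  unfolding smooth_iff_Ck
proof
  fix n show "Ck n (\<lambda>z. z \<bullet> c)"
  proof (cases n)
    case (Suc m)
    have d: "((\<lambda>z. z \<bullet> c) has_derivative (\<lambda>h. h \<bullet> c)) (at z)" for z
      by (auto intro!: derivative_eq_intros)
    then have "partial b (\<lambda>z. z \<bullet> c) = (\<lambda>z. b \<bullet> c)" for b
      using partial_eq_fun[OF d] by simp
    then show ?thesis using d Suc by (auto simp: Ck_const differentiable_def)
  qed simp
qed

lemma smooth_norm_sq: "smooth (\<lambda>z::'a::euclidean_space. z \<bullet> z)"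
proof -
  have d: "((\<lambda>z::'a. z \<bullet> z) has_derivative (\<lambda>h. 2 * (z \<bullet> h))) (at z)" for z
    by (auto intro!: derivative_eq_intros simp: inner_commute)
  have p: "partial b (\<lambda>z::'a. z \<bullet> z) = (\<lambda>z. 2 * (z \<bullet> b))" for b
    using partial_eq_fun[OF d] by simp
  have "Ck n (\<lambda>z::'a. z \<bullet> z)" for n
  proof (cases n)
    case (Suc m)
    have "smooth (\<lambda>z. 2 * (z \<bullet> b))" for b :: 'a by (intro smooth_mult smooth_const smooth_inner)
    then show ?thesis using d Suc p by (auto simp: differentiable_def smooth_iff_Ck)
  qed simp
  then show ?thesis by (simp add: smooth_iff_Ck)
qed

text \<open>The classical functions that vanish to infinite order at \<open>0\<close>. Allowing a polynomial factor in \<open>1 / t\<close>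
makes the family closed under differentiation.\<close>

definition flat :: "real poly \<Rightarrow> real \<Rightarrow> real" where
  "flat p t = (if t > 0 then poly p (1 / t) * exp (- (1 / t)) else 0)"

lemma poly_exp_tendsto: "((\<lambda>s::real. poly p s * exp (- s)) \<longlongrightarrow> 0) at_top"
proof -
  have "((\<lambda>s::real. \<Sum>i\<le>degree p. coeff p i * (s ^ i / exp s)) \<longlongrightarrow> (\<Sum>i\<le>degree p. coeff p i * 0)) at_top"
    by (intro tendsto_sum tendsto_mult tendsto_const tendsto_power_div_exp_0)
  then show ?thesis
    by (simp add: poly_altdef sum_distrib_right exp_minus divide_inverse mult.assoc)
qed

lemma flat_tendsto_0: "((\<lambda>t. flat p t / t) \<longlongrightarrow> 0) (at 0)"
proof -
  have "((\<lambda>t. poly (pCons 0 p) (1 / t) * exp (- (1 / t))) \<longlongrightarrow> 0) (at_right (0::real))"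
    using filterlim_compose[OF poly_exp_tendsto[of "pCons 0 p"] filterlim_inverse_at_top_right]
    by (simp add: inverse_eq_divide)
  then have R: "((\<lambda>t. flat p t / t) \<longlongrightarrow> 0) (at_right 0)"
    by (rule Lim_transform_eventually)
      (auto simp: eventually_at_filter flat_def)
  have L: "((\<lambda>t. flat p t / t) \<longlongrightarrow> 0) (at_left 0)"
    by (rule Lim_transform_eventually[OF tendsto_const])
      (auto simp: eventually_at_filter flat_def)
  show ?thesis using L R by (rule filterlim_split_at)
qed

lemma flat_deriv:
  "(flat p has_real_derivative flat (monom 1 2 * (p - pderiv p)) t) (at t)"
proof -
  consider "t > 0" | "t < 0" | "t = 0" by linarith
  then show ?thesis
  proof cases
    case 1
    have "((\<lambda>t. poly p (1 / t) * exp (- (1 / t))) has_real_derivative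
        poly (monom 1 2 * (p - pderiv p)) (1 / t) * exp (- (1 / t))) (at t)"
      using 1 by (auto intro!: derivative_eq_intros DERIV_chain2[OF poly_DERIV]
          simp: poly_monom field_simps power2_eq_square)
    then have "(flat p has_real_derivative poly (monom 1 2 * (p - pderiv p)) (1 / t) * exp (- (1 / t))) (at t)"
      by (rule has_field_derivative_transform_within_open[of _ _ _ "{0<..}"])
        (use 1 in \<open>auto simp: flat_def\<close>)
    then show ?thesis using 1 by (simp add: flat_def)
  next
    case 2
    have "((\<lambda>t. 0) has_real_derivative 0) (at t)" by simp
    then have "(flat p has_real_derivative 0) (at t)"
      by (rule has_field_derivative_transform_within_open[of _ _ _ "{..<0}"])
        (use 2 in \<open>auto simp: flat_def\<close>)
    then show ?thesis using 2 by (simp add: flat_def)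
  next
    case 3
    have "flat p 0 = 0" by (simp add: flat_def)
    then show ?thesis using 3 flat_tendsto_0[of p] by (simp add: DERIV_def flat_def)
  qed
qed

lemma smooth_flat:
  assumes "smooth q" shows "smooth (\<lambda>z. flat p (q z))"
proof -
  have "\<exists>f'\<in>range flat. \<forall>t. (f has_real_derivative f' t) (at t)" if "f \<in> range flat" for f
    using that flat_deriv by blast
  then show ?thesis using Ck_comp[of "range flat" "flat p"] assms
    unfolding smooth_iff_Ck by blast
qed

lemma test_function_iff:
  "test_function f \<longleftrightarrow> smooth f \<and> (\<exists>R. \<forall>z. norm z > R \<longrightarrow> f z = 0)"
proof -
  have "compact (closure {z. f z \<noteq> 0}) \<longleftrightarrow> bounded {z. f z \<noteq> 0}" by simp
  also have "\<dots> \<longleftrightarrow> (\<exists>R. \<forall>z. norm z > R \<longrightarrow> f z = 0)"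
    unfolding bounded_iff by (auto simp: not_le[symmetric])
  finally show ?thesis by (simp add: test_function_def)
qed

lemma test_smooth: "test_function f \<Longrightarrow> smooth f" by (simp add: test_function_def)

lemma test_mult_left: "smooth f \<Longrightarrow> test_function g \<Longrightarrow> test_function (\<lambda>z. f z * g z)"
  unfolding test_function_iff by (auto intro: smooth_mult)

lemma test_mult_right: "test_function f \<Longrightarrow> smooth g \<Longrightarrow> test_function (\<lambda>z. f z * g z)"
  unfolding test_function_iff by (auto intro: smooth_mult)

lemma test_add: "test_function f \<Longrightarrow> test_function g \<Longrightarrow> test_function (\<lambda>z. f z + g z)"
  unfolding test_function_iff
proof (elim conjE exE, intro conjI exI allI impI)
  fix R R' and z :: 'a assume *: "\<forall>z. R < norm z \<longrightarrow> f z = 0" "\<forall>z. R' < norm z \<longrightarrow> g z = 0" "max R R' < norm z"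
  then show "f z + g z = 0" by simp
qed (auto intro: smooth_add)

lemma test_scale: "test_function f \<Longrightarrow> test_function (\<lambda>z. c * f z)"
  using test_mult_left smooth_const by blast

lemma test_diff: "test_function f \<Longrightarrow> test_function g \<Longrightarrow> test_function (\<lambda>z. f z - g z)"
  using test_add[of f "\<lambda>z. -1 * g z"] test_scale[of g "-1"] by simp

lemma partial_zero_outside:
  assumes "\<forall>z. norm z > R \<longrightarrow> f z = 0" "norm z > R" shows "partial b f z = 0"
proof -
  have "((\<lambda>z. 0) has_derivative (\<lambda>h. 0)) (at z)" by simp
  then have "(f has_derivative (\<lambda>h. 0)) (at z)"
    by (rule has_derivative_transform_within_open[of _ _ _ _ "- cball 0 R"])
      (use assms in \<open>auto simp: not_le\<close>)
  then show ?thesis using partial_eq by blast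
qed

lemma test_partial: "test_function f \<Longrightarrow> b \<in> Basis \<Longrightarrow> test_function (partial b f)"
  unfolding test_function_iff using partial_zero_outside smooth_partial by blast

lemma test_partials: "test_function f \<Longrightarrow> set bs \<subseteq> Basis \<Longrightarrow> test_function (partials bs f)"
  by (induction bs) (auto simp: test_partial)

lemma smooth_continuous: "smooth f \<Longrightarrow> continuous_on S f"
  using smooth_differentiable
  by (meson continuous_at_imp_continuous_on differentiable_imp_continuous_within)

lemma smooth_borel [measurable_dest]: "smooth f \<Longrightarrow> f \<in> borel_measurable borel"
  by (simp add: borel_measurable_continuous_onI smooth_continuous)

lemma test_borel [measurable_dest]: "test_function f \<Longrightarrow> f \<in> borel_measurable borel"
  using smooth_borel test_smooth by blast

lemma test_bounded:
  assumes "test_function f" obtains B where "B > 0" "\<And>z. \<bar>f z\<bar> \<le> B"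
proof -
  obtain R where R: "\<And>z. norm z > R \<Longrightarrow> f z = 0" using assms by (auto simp: test_function_iff)
  have "compact (f ` cball 0 R)"
    using assms by (intro compact_continuous_image smooth_continuous) (auto simp: test_smooth)
  then obtain B where B: "B > 0" "\<forall>x\<in>f ` cball 0 R. norm x \<le> B"
    using compact_imp_bounded bounded_pos by blast
  have "\<bar>f z\<bar> \<le> B" for z
    using B R[of z] by (cases "norm z \<le> R") auto
  with B that show ?thesis by blast
qed

lemma test_integrable:
  assumes "test_function f" shows "integrable lborel f"
proof -
  obtain R where R: "\<And>z. norm z > R \<Longrightarrow> f z = 0" using assms by (auto simp: test_function_iff)
  have "set_integrable lborel (cball 0 R) f"
    unfolding set_integrable_def
    by (intro borel_integrable_compact smooth_continuous test_smooth assms) auto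
  moreover have "(\<lambda>x. indicat_real (cball 0 R) x *\<^sub>R f x) = f"
    using R by (auto simp: indicator_def fun_eq_iff)
  ultimately show ?thesis by (simp add: set_integrable_def)
qed

text \<open>On a ball slightly larger than the support this is the Heine-Cantor theorem; two points closer than \<open>1\<close>
that are not both in that ball both lie outside the support.\<close>

lemma test_uniformly_continuous:
  assumes "test_function f" shows "uniformly_continuous_on UNIV f"
proof -
  obtain R where R: "\<And>z. norm z > R \<Longrightarrow> f z = 0" using assms by (auto simp: test_function_iff)
  have u: "uniformly_continuous_on (cball 0 (R+1)) f"
    using assms by (intro compact_uniformly_continuous smooth_continuous) (auto simp: test_smooth)
  show ?thesis unfolding uniformly_continuous_on_def
  proof (intro allI impI)
    fix e :: real assume "e > 0"
    then obtain d where d: "d > 0" "\<And>x y. norm x \<le> R + 1 \<Longrightarrow> norm y \<le> R + 1 \<Longrightarrow> dist y x < d \<Longrightarrow> dist (f y) (f x) < e"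
      using u unfolding uniformly_continuous_on_def by (metis mem_cball_0)
    show "\<exists>d>0. \<forall>x\<in>UNIV. \<forall>x'\<in>UNIV. dist x' x < d \<longrightarrow> dist (f x') (f x) < e"
    proof (intro exI[of _ "min d 1"] conjI ballI impI)
      fix x x' :: 'a assume x: "dist x' x < min d 1"
      show "dist (f x') (f x) < e"
      proof (cases "norm x \<le> R + 1 \<and> norm x' \<le> R + 1")
        case True then show ?thesis using d x by simp
      next
        case False
        have "\<bar>norm x' - norm x\<bar> < 1" using x norm_triangle_ineq3[of x' x] by (simp add: dist_norm)
        then have "norm x > R" "norm x' > R" using False by auto
        then show ?thesis using R \<open>e > 0\<close> by simp
      qed
    qed (use d in simp)
  qed
qed

lemma bump_exists:
  fixes r :: real assumes "r > 0"
  obtains f :: "'a::euclidean_space \<Rightarrow> real"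
  where "test_function f" "\<And>z. f z \<ge> 0" "\<And>z. f z > 0 \<longleftrightarrow> norm z < r" 
proof
  define f where "f = (\<lambda>z::'a. flat 1 (r\<^sup>2 + (-1) * (z \<bullet> z)))"
  show pos: "f z \<ge> 0" for z by (simp add: f_def flat_def)
  have *: "z \<bullet> z < r\<^sup>2 \<longleftrightarrow> norm z < r" for z :: 'a
    using assms by (simp add: power2_norm_eq_inner[symmetric] power_mono_iff flip: not_le)
  show iff: "f z > 0 \<longleftrightarrow> norm z < r" for z by (simp add: f_def flat_def *)
  have "smooth f" unfolding f_def
    by (intro smooth_flat smooth_add smooth_mult smooth_const smooth_norm_sq)
  moreover have "\<forall>z. norm z > r \<longrightarrow> f z = 0" using iff pos by (metis less_le not_less)
  ultimately show "test_function f" unfolding test_function_iff by blast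
qed

section \<open>Convolution with test functions\<close>

definition conv :: "('a::euclidean_space \<Rightarrow> real) \<Rightarrow> ('a \<Rightarrow> real) \<Rightarrow> 'a \<Rightarrow> real" where
  "conv u f z = (LINT w|lebesgue. u w * f (z - w))"

lemma borel_affine:
  "f \<in> borel_measurable borel \<Longrightarrow> (\<lambda>w::'a::euclidean_space. f (z - w)) \<in> borel_measurable borel"
  by (rule measurable_compose[of "\<lambda>w. z - w"]) measurable

lemma lborel_reflect: "distr lborel borel (\<lambda>w::'a::euclidean_space. z - w) = lborel"
proof -
  have "lborel = density (distr lborel borel (\<lambda>x::'a. z + (-1) *\<^sub>R x)) (\<lambda>_. \<bar>-1 :: real\<bar> ^ DIM('a))"
    by (rule lborel_affine) simp
  then show ?thesis by (simp add: density_1)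
qed

lemma locally_integrable_bounded_mult:
  fixes u :: "'a::euclidean_space \<Rightarrow> real"
  assumes u: "locally_integrable u" and f: "f \<in> borel_measurable borel" "\<And>w. \<bar>f w\<bar> \<le> B"
    "\<And>w. w \<notin> K \<Longrightarrow> f w = 0" and K: "compact K"
  shows "integrable lebesgue (\<lambda>w. u w * f w)"
    and "\<bar>LINT w|lebesgue. u w * f w\<bar> \<le> B * (LINT w|lebesgue. indicator K w * \<bar>u w\<bar>)"
proof -
  have i: "integrable lebesgue (\<lambda>w. indicator K w * u w)"
    using u K by (auto simp: locally_integrable_def set_integrable_def)
  have fm: "f \<in> borel_measurable lebesgue"
    using f(1) by (simp add: measurable_completion)
  have B: "B \<ge> 0" using f(2)[of 0] by linarith
  have b: "\<bar>u w * f w\<bar> \<le> B * \<bar>indicator K w * u w\<bar>" for w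
    using f(2)[of w] f(3)[of w] B
    by (auto simp: indicator_def abs_mult mult.commute[of "\<bar>u w\<bar>"] intro!: mult_right_mono)
  have eq: "(\<lambda>w. u w * f w) = (\<lambda>w. (indicator K w * u w) * f w)"
    using f(3) by (fastforce simp: indicator_def)
  have m: "(\<lambda>w. u w * f w) \<in> borel_measurable lebesgue"
    unfolding eq by (intro borel_measurable_times[OF borel_measurable_integrable[OF i] fm])
  show int: "integrable lebesgue (\<lambda>w. u w * f w)"
    by (rule Bochner_Integration.integrable_bound[OF integrable_mult_right[OF integrable_abs[OF i], of B] m])
       (use b B in \<open>auto simp: abs_mult\<close>)
  have "\<bar>LINT w|lebesgue. u w * f w\<bar> \<le> (LINT w|lebesgue. \<bar>u w * f w\<bar>)"
    by (rule integral_abs_bound)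
  also have "\<dots> \<le> (LINT w|lebesgue. B * \<bar>indicator K w * u w\<bar>)"
    by (intro integral_mono b integrable_abs int integrable_mult_right i)
  finally show "\<bar>LINT w|lebesgue. u w * f w\<bar> \<le> B * (LINT w|lebesgue. indicator K w * \<bar>u w\<bar>)"
    by (simp add: abs_mult)
qed

lemma conv_integrable:
  assumes "locally_integrable u" "test_function f"
  shows "integrable lebesgue (\<lambda>w. u w * f (z - w))"
proof -
  obtain B where B: "\<And>z. \<bar>f z\<bar> \<le> B" using test_bounded[OF assms(2)] by metis
  obtain R where R: "\<And>z. norm z > R \<Longrightarrow> f z = 0" using assms by (auto simp: test_function_iff)
  show ?thesis
    by (rule locally_integrable_bounded_mult(1)[OF assms(1), of _ B "cball z R"])
      (use B R borel_affine[OF test_borel[OF assms(2)]] in \<open>auto simp: dist_norm\<close>)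
qed

text \<open>The first order Taylor estimate is uniform in the base point, because the partial derivatives are
uniformly continuous. The uniformity allows differentiation under the integral sign in a
convolution with a merely locally integrable function.\<close>

lemma test_remainder:
  fixes f :: "'a::euclidean_space \<Rightarrow> real"
  assumes f: "test_function f" and "d > 0"
  obtains r where "r > 0"
    "\<And>y h. norm h < r \<Longrightarrow> \<bar>f (y + h) - f y - (\<Sum>b\<in>Basis. (h \<bullet> b) * partial b f y)\<bar> \<le> d * norm h"
proof -
  define e where "e = d / DIM('a)"
  have e: "e > 0" using assms by (simp add: e_def)
  have "\<exists>r>0. \<forall>x y. dist x y < r \<longrightarrow> \<bar>partial b f x - partial b f y\<bar> < e" if "b \<in> Basis" for b
    using test_uniformly_continuous[OF test_partial[OF f that]] e
    unfolding uniformly_continuous_on_def by (fastforce simp: dist_real_def)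
  then obtain r where r: "\<And>b. b \<in> Basis \<Longrightarrow> r b > 0"
    "\<And>b x y. b \<in> Basis \<Longrightarrow> dist x y < r b \<Longrightarrow> \<bar>partial b f x - partial b f y\<bar> < e" by metis
  define r0 where "r0 = Min (r ` Basis)"
  have r0: "r0 > 0" "\<And>b. b \<in> Basis \<Longrightarrow> r0 \<le> r b"
    using r(1) by (auto simp: r0_def)
  show ?thesis
  proof (rule that[OF r0(1)])
    fix y h :: 'a assume h: "norm h < r0"
    define g where "g = (\<lambda>x. f x - (\<Sum>b\<in>Basis. ((x - y) \<bullet> b) * partial b f y))"
    have d: "(g has_derivative (\<lambda>h. \<Sum>b\<in>Basis. (h \<bullet> b) * (partial b f x - partial b f y))) (at x within ball y r0)" for x
    proof -
      have "(f has_derivative (\<lambda>h. \<Sum>b\<in>Basis. (h \<bullet> b) * partial b f x)) (at x within ball y r0)"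
        using has_derivative_partial[OF smooth_differentiable[OF test_smooth[OF f]]] has_derivative_at_withinI by blast
      then show ?thesis unfolding g_def
        by (auto intro!: derivative_eq_intros simp: fun_eq_iff right_diff_distrib sum_subtractf)
    qed
    have on: "onorm (\<lambda>h. \<Sum>b\<in>Basis. (h \<bullet> b) * (partial b f x - partial b f y)) \<le> d" if "x \<in> ball y r0" for x
    proof (rule onorm_le)
      fix h :: 'a
      have "norm (\<Sum>b\<in>Basis. (h \<bullet> b) * (partial b f x - partial b f y)) \<le> (\<Sum>b\<in>(Basis::'a set). norm h * e)"
      proof (rule sum_norm_le)
        fix b :: 'a assume b: "b \<in> Basis"
        have "dist x y < r b" using that r0(2)[OF b] by (simp add: dist_commute)
        then have "\<bar>partial b f x - partial b f y\<bar> \<le> e" using r(2)[OF b, of x y] by simp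
        then show "norm ((h \<bullet> b) * (partial b f x - partial b f y)) \<le> norm h * e"
          using Basis_le_norm[OF b, of h] by (simp add: abs_mult mult_mono)
      qed
      also have "\<dots> = d * norm h" by (simp add: e_def)
      finally show "norm (\<Sum>b\<in>Basis. (h \<bullet> b) * (partial b f x - partial b f y)) \<le> d * norm h" .
    qed
    have "norm (g (y + h) - g y) \<le> d * norm (y + h - y)"
      by (rule differentiable_bound[OF convex_ball d on]) (use h r0 in \<open>auto simp: dist_norm\<close>)
    then show "\<bar>f (y + h) - f y - (\<Sum>b\<in>Basis. (h \<bullet> b) * partial b f y)\<bar> \<le> d * norm h"
      by (simp add: g_def algebra_simps)
  qed
qed

lemma conv_has_derivative:
  assumes u: "locally_integrable u" and f: "test_function f"
  shows "(conv u f has_derivative (\<lambda>h. \<Sum>b\<in>Basis. (h \<bullet> b) * conv u (partial b f) z)) (at z)"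
  unfolding has_derivative_at_alt
proof (intro conjI allI impI)
  show "bounded_linear (\<lambda>h. \<Sum>b\<in>Basis. (h \<bullet> b) * conv u (partial b f) z)"
    by (intro bounded_linear_sum bounded_linear_mult_const bounded_linear_inner_left)
  fix e :: real assume "e > 0"
  obtain R where R: "\<And>z. norm z > R \<Longrightarrow> f z = 0" using f by (auto simp: test_function_iff)
  define K where "K = cball z (R + 1)"
  define A where "A = (LINT w|lebesgue. indicator K w * \<bar>u w\<bar>)"
  have A: "A \<ge> 0" unfolding A_def by (intro integral_nonneg_AE) auto
  have "e / (A + 1) > 0" using \<open>e > 0\<close> A by simp
  from test_remainder[OF f this] obtain r where r: "r > 0"
    "\<And>y h. norm h < r \<Longrightarrow> \<bar>f (y + h) - f y - (\<Sum>b\<in>Basis. (h \<bullet> b) * partial b f y)\<bar> \<le> e / (A + 1) * norm h"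
    by blast
  show "\<exists>d>0. \<forall>y. norm (y - z) < d \<longrightarrow>
      norm (conv u f y - conv u f z - (\<Sum>b\<in>Basis. ((y - z) \<bullet> b) * conv u (partial b f) z)) \<le> e * norm (y - z)"
  proof (intro exI[of _ "min r 1"] conjI allI impI)
    fix y assume y: "norm (y - z) < min r 1"
    define h where "h = y - z"
    define F where "F = (\<lambda>w. f (z - w + h) - f (z - w) - (\<Sum>b\<in>Basis. (h \<bullet> b) * partial b f (z - w)))"
    have Fm: "F \<in> borel_measurable borel" 
    proof -
      have "(\<lambda>x. f (x + h) - f x - (\<Sum>b\<in>Basis. (h \<bullet> b) * partial b f x)) \<in> borel_measurable borel"
        using test_borel[OF f] test_borel[OF test_partial[OF f]]
        by (intro borel_measurable_diff borel_measurable_sum borel_measurable_times)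
           (auto intro!: measurable_compose[of "\<lambda>x. x + h" borel borel f])
      then show ?thesis unfolding F_def by (rule borel_affine)
    qed
    have Fb: "\<bar>F w\<bar> \<le> e / (A + 1) * norm h" for w
      using r(2)[of h "z - w"] y by (simp add: F_def h_def)
    have F0: "F w = 0" if "w \<notin> K" for w
    proof -
      have n: "norm (z - w) > R + 1" using that by (simp add: K_def dist_norm)
      then have "norm (z - w + h) > R"
        using y norm_triangle_ineq2[of "z - w" "- h"] by (simp add: h_def norm_minus_commute)
      moreover have "partial b f (z - w) = 0" for b
        by (rule partial_zero_outside[of R]) (use R n in auto)
      ultimately show ?thesis using R n by (simp add: F_def)
    qed
    have "conv u f y - conv u f z - (\<Sum>b\<in>Basis. (h \<bullet> b) * conv u (partial b f) z)
        = (LINT w|lebesgue. u w * F w)"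
    proof -
      have i: "integrable lebesgue (\<lambda>w. u w * f (z - w + h))" "integrable lebesgue (\<lambda>w. u w * f (z - w))"
        using conv_integrable[OF u f, of z] conv_integrable[OF u f, of "z + h"] by (simp_all add: algebra_simps)
      have j: "integrable lebesgue (\<lambda>w. (h \<bullet> b) * (u w * partial b f (z - w)))" if "b \<in> Basis" for b
        by (intro integrable_mult_right conv_integrable u test_partial f that)
      have "(\<lambda>w. u w * F w) = (\<lambda>w. u w * f (z - w + h) - u w * f (z - w) - (\<Sum>b\<in>Basis. (h \<bullet> b) * (u w * partial b f (z - w))))"
        by (simp add: F_def algebra_simps sum_distrib_left)
      moreover have "conv u f y = (LINT w|lebesgue. u w * f (z - w + h))"
        by (simp add: conv_def h_def algebra_simps)
      ultimately show ?thesis using i j by (simp add: conv_def)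
    qed
    also have "\<bar>\<dots>\<bar> \<le> e / (A + 1) * norm h * A"
      unfolding A_def by (rule locally_integrable_bounded_mult(2)[OF u Fm])
        (use Fb F0 in \<open>auto simp: A_def K_def\<close>)
    also have "\<dots> \<le> e * norm h"
    proof -
      have "A / (A + 1) \<le> 1" using A by simp
      then have "e * norm h * (A / (A + 1)) \<le> e * norm h * 1" using \<open>e > 0\<close> by (intro mult_left_mono) auto
      then show ?thesis by (simp add: field_simps)
    qed
    finally show "norm (conv u f y - conv u f z - (\<Sum>b\<in>Basis. ((y - z) \<bullet> b) * conv u (partial b f) z)) \<le> e * norm (y - z)"
      by (simp add: h_def)
  qed (use r in auto)
qed

lemma sum_Basis_delta: "b \<in> Basis \<Longrightarrow> (\<Sum>c\<in>Basis. (b \<bullet> c) * (g c :: real)) = g b"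
proof -
  assume b: "b \<in> Basis"
  have "(\<Sum>c\<in>Basis. (b \<bullet> c) * g c) = (\<Sum>c\<in>Basis. if c = b then g c else 0)"
    by (intro sum.cong refl) (auto simp: inner_Basis b)
  then show ?thesis using b by simp
qed

lemma partial_conv:
  assumes "locally_integrable u" "test_function f" "b \<in> Basis"
  shows "partial b (conv u f) = conv u (partial b f)"
  using partial_eq_fun[OF conv_has_derivative[OF assms(1,2)]] sum_Basis_delta[OF assms(3)] by simp

lemma partials_conv:
  assumes "locally_integrable u" "test_function f" "set bs \<subseteq> Basis"
  shows "partials bs (conv u f) = conv u (partials bs f)"
  using assms(3) by (induction bs) (auto simp: assms partial_conv test_partials)

lemma smooth_conv:
  assumes "locally_integrable u" "test_function f" shows "smooth (conv u f)"
  unfolding smooth_def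
proof (intro allI impI)
  fix bs :: "'a list" and z assume bs: "set bs \<subseteq> Basis"
  show "partials bs (conv u f) differentiable at z"
    unfolding partials_conv[OF assms bs] differentiable_def
    using conv_has_derivative[OF assms(1) test_partials[OF assms(2) bs]] by blast
qed

lemma affine_has_derivative:
  assumes "smooth f"
  shows "((\<lambda>w. f (a + c *\<^sub>R w)) has_derivative
    (\<lambda>h. frechet_derivative f (at (a + c *\<^sub>R w)) (c *\<^sub>R h))) (at w)"
proof -
  have D: "(f has_derivative frechet_derivative f (at (a + c *\<^sub>R w))) (at (a + c *\<^sub>R w))"
    using smooth_differentiable[OF assms] frechet_derivative_works by blast
  have "((\<lambda>w. a + c *\<^sub>R w) has_derivative (\<lambda>h. c *\<^sub>R h)) (at w)"
    by (auto intro!: derivative_eq_intros)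
  from has_derivative_compose[OF this D] show ?thesis .
qed

lemma partial_affine:
  assumes "smooth f"
  shows "partial b (\<lambda>w. f (a + c *\<^sub>R w)) = (\<lambda>w. c * partial b f (a + c *\<^sub>R w))"
proof
  fix w
  have "linear (frechet_derivative f (at (a + c *\<^sub>R w)))"
    using smooth_differentiable[OF assms] frechet_derivative_works has_derivative_linear by blast
  then show "partial b (\<lambda>w. f (a + c *\<^sub>R w)) w = c * partial b f (a + c *\<^sub>R w)"
    unfolding partial_eq[OF affine_has_derivative[OF assms]] by (simp add: partial_def linear_cmul)
qed

lemma partial_cmult: "f differentiable (at z) \<Longrightarrow> partial b (\<lambda>z. c * f z) z = c * partial b f z"
  using partial_mult[of "\<lambda>_. c" z f b] by (simp add: partial_eq[OF has_derivative_const])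

lemma smooth_affine:
  assumes "smooth f" shows "smooth (\<lambda>w. f (a + c *\<^sub>R w))"
proof -
  have "smooth f \<Longrightarrow> Ck m (\<lambda>w. f (a + c *\<^sub>R w))" for m
  proof (induction m arbitrary: f)
    case (Suc m)
    have "Ck m (\<lambda>w. c * partial b f (a + c *\<^sub>R w))" if "b \<in> Basis" for b
      by (intro Ck_mult Ck_const Suc.IH smooth_partial that Suc.prems)
    moreover have "(\<lambda>w. f (a + c *\<^sub>R w)) differentiable (at w)" for w
      using affine_has_derivative[OF Suc.prems] differentiable_def by blast
    ultimately show ?case by (simp add: partial_affine[OF Suc.prems])
  qed simp
  then show ?thesis using assms by (simp add: smooth_iff_Ck)
qed

lemma partials_affine:
  assumes "smooth f" "set bs \<subseteq> Basis"
  shows "partials bs (\<lambda>w. f (a + c *\<^sub>R w)) = (\<lambda>w. c ^ length bs * partials bs f (a + c *\<^sub>R w))"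
  using assms(2)
proof (induction bs)
  case (Cons b bs)
  then have s: "smooth (partials bs f)" using assms(1) by (auto intro: smooth_partials)
  have E: "partials bs (\<lambda>w. f (a + c *\<^sub>R w)) = (\<lambda>w. c ^ length bs * partials bs f (a + c *\<^sub>R w))"
    using Cons by simp
  show ?case unfolding partials_Cons E
    by (simp add: fun_eq_iff partial_cmult[OF smooth_differentiable[OF smooth_affine[OF s]]] partial_affine[OF s])
qed simp

lemma test_affine:
  assumes "test_function f" "c \<noteq> 0" shows "test_function (\<lambda>w. f (a + c *\<^sub>R w))"
proof -
  obtain R where R: "\<And>z. norm z > R \<Longrightarrow> f z = 0" using assms by (auto simp: test_function_iff)
  have "f (a + c *\<^sub>R w) = 0" if "norm w > (R + norm a) / \<bar>c\<bar>" for w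
  proof (rule R)
    have "norm (c *\<^sub>R w) > R + norm a" using that assms(2) by (simp add: field_simps)
    then show "norm (a + c *\<^sub>R w) > R" using norm_triangle_ineq2[of "c *\<^sub>R w" "- a"] by (simp add: add.commute)
  qed
  then show ?thesis using smooth_affine[OF test_smooth[OF assms(1)]] unfolding test_function_iff by blast
qed

text \<open>The reflected function \<open>w \<mapsto> f (z - w)\<close> is a test function for the weak derivative, and the sign from the
reflection cancels the sign from the integration by parts.\<close>

lemma conv_weak_deriv:
  assumes "has_weak_deriv bs u v" "test_function f" "set bs \<subseteq> Basis"
  shows "partials bs (conv u f) = conv v f"
proof
  fix z
  have u: "locally_integrable u" using assms(1) by (simp add: has_weak_deriv_def)
  have "(LINT w|lebesgue. u w * partials bs (\<lambda>w. f (z - w)) w) =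
        (-1) ^ length bs * (LINT w|lebesgue. v w * f (z - w))"
    using assms(1) test_affine[OF assms(2), of "-1" z] unfolding has_weak_deriv_def by simp
  moreover have "(LINT w|lebesgue. u w * partials bs (\<lambda>w. f (z - w)) w)
     = (-1) ^ length bs * (LINT w|lebesgue. u w * partials bs f (z - w))"
    unfolding partials_affine[OF test_smooth[OF assms(2)] assms(3), of z "-1", simplified]
    by (simp only: mult.left_commute[of "u _"] integral_mult_right_zero)
  ultimately have "conv u (partials bs f) z = conv v f z"
    by (simp add: conv_def)
  then show "partials bs (conv u f) z = conv v f z"
    by (simp add: partials_conv[OF u assms(2,3)])
qed

lemma locally_integrable_const: "locally_integrable (\<lambda>z. c)"
  unfolding locally_integrable_def
proof (intro allI impI)
  fix K :: "'a set" assume "compact K"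
  then have "integrable lebesgue (indicator K :: 'a \<Rightarrow> real)"
    using lmeasurable_compact lmeasurable_iff_integrable by blast
  then show "(\<lambda>z. c) absolutely_integrable_on K"
    unfolding set_integrable_def by simp
qed

text \<open>The convolution of \<open>f\<close> with the constant \<open>1\<close> is constant by translation invariance, so its derivative,
which is the integral of the derivative of \<open>f\<close>, vanishes. This replaces an iterated integration.\<close>

lemma integral_test_partial:
  assumes "test_function f" "b \<in> Basis" shows "(LINT z|lebesgue. partial b f z) = 0"
proof -
  have r: "(LINT w|lebesgue. g (z - w)) = (LINT w|lebesgue. g w)" if g: "g \<in> borel_measurable borel"
    for g :: "'a \<Rightarrow> real" and z
  proof -
    have "(LINT w|lebesgue. g w) = (LINT w|lborel. g w)"
      using g by (simp add: integral_completion)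
    also have "\<dots> = (LINT w|distr lborel borel (\<lambda>w. z - w). g w)" by (simp only: lborel_reflect)
    also have "\<dots> = (LINT w|lborel. g (z - w))"
      by (rule integral_distr) (use g in auto)
    also have "\<dots> = (LINT w|lebesgue. g (z - w))"
      using borel_affine[OF g] by (simp add: integral_completion)
    finally show ?thesis ..
  qed
  have "conv (\<lambda>_. 1) f = (\<lambda>z. LINT w|lebesgue. f w)"
    using r[OF test_borel[OF assms(1)]] by (simp add: conv_def fun_eq_iff)
  then have "partial b (conv (\<lambda>_. 1) f) 0 = 0" by (simp add: partial_eq[OF has_derivative_const])
  moreover have "partial b (conv (\<lambda>_. 1) f) 0 = (LINT w|lebesgue. partial b f w)"
    using r[OF test_borel[OF test_partial[OF assms]], of 0]
    by (simp add: partial_conv[OF locally_integrable_const assms] conv_def)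
  ultimately show ?thesis by simp
qed

section \<open>Convergence in the mean square\<close>

abbreviation sq_norm :: "'a measure \<Rightarrow> ('a \<Rightarrow> real) \<Rightarrow> real" where
  "sq_norm M u \<equiv> LINT x|M. (u x) ^ 2"

abbreviation sq_dist :: "'a measure \<Rightarrow> ('a \<Rightarrow> real) \<Rightarrow> ('a \<Rightarrow> real) \<Rightarrow> real" where
  "sq_dist M u v \<equiv> LINT x|M. (u x - v x) ^ 2"

definition L2tends :: "'a measure \<Rightarrow> (nat \<Rightarrow> 'a \<Rightarrow> real) \<Rightarrow> ('a \<Rightarrow> real) \<Rightarrow> bool" where
  "L2tends M s l \<longleftrightarrow> (\<forall>k. s k \<in> L2_space M) \<and> l \<in> L2_space M \<and>
     (\<lambda>k. sq_dist M (s k) l) \<longlonglongrightarrow> 0"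

definition L2Cauchy :: "'a measure \<Rightarrow> (nat \<Rightarrow> 'a \<Rightarrow> real) \<Rightarrow> bool" where
  "L2Cauchy M s \<longleftrightarrow> (\<forall>k. s k \<in> L2_space M) \<and>
     (\<forall>e>0. \<exists>N. \<forall>m\<ge>N. \<forall>n\<ge>N. sq_dist M (s m) (s n) < e)"

lemma L2_measurable [measurable_dest]: "u \<in> L2_space M \<Longrightarrow> u \<in> borel_measurable M"
  by (simp add: L2_space_def)

lemma L2_integrable_sq: "u \<in> L2_space M \<Longrightarrow> integrable M (\<lambda>x. (u x)\<^sup>2)"
  by (simp add: L2_space_def)

lemma sq_add_le: "(a + b)\<^sup>2 \<le> 2 * a\<^sup>2 + 2 * (b::real)\<^sup>2"
  using zero_le_power2[of "a - b"] by (simp add: power2_sum power2_diff)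

lemma L2_bound:
  assumes "u \<in> borel_measurable M" "integrable M g" "\<And>x. (u x)\<^sup>2 \<le> g x"
  shows "u \<in> L2_space M"
proof -
  have "integrable M (\<lambda>x. (u x)\<^sup>2)"
    by (rule Bochner_Integration.integrable_bound[OF assms(2)])
       (use assms(1) in measurable, use assms(3) in \<open>auto intro: order_trans[OF _ abs_ge_self]\<close>)
  then show ?thesis using assms(1) by (simp add: L2_space_def)
qed

lemma L2_add:
  assumes "u \<in> L2_space M" "v \<in> L2_space M"
  shows "(\<lambda>x. u x + v x) \<in> L2_space M"
    and "(LINT x|M. (u x + v x)\<^sup>2) \<le> 2 * sq_norm M u + 2 * sq_norm M v"
proof -
  have [measurable]: "u \<in> borel_measurable M" "v \<in> borel_measurable M"
    using assms L2_measurable by auto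
  have i: "integrable M (\<lambda>x. 2 * (u x)\<^sup>2 + 2 * (v x)\<^sup>2)"
    using assms by (intro Bochner_Integration.integrable_add integrable_mult_right L2_integrable_sq)
  show *: "(\<lambda>x. u x + v x) \<in> L2_space M"
    by (rule L2_bound[OF _ i]) (auto simp: sq_add_le)
  have "(LINT x|M. (u x + v x)\<^sup>2) \<le> (LINT x|M. 2 * (u x)\<^sup>2 + 2 * (v x)\<^sup>2)"
    by (intro integral_mono L2_integrable_sq * i sq_add_le)
  also have "\<dots> = 2 * sq_norm M u + 2 * sq_norm M v"
    using assms by (simp add: L2_integrable_sq)
  finally show "(LINT x|M. (u x + v x)\<^sup>2) \<le> 2 * sq_norm M u + 2 * sq_norm M v" .
qed

lemma L2_scale: "u \<in> L2_space M \<Longrightarrow> (\<lambda>x. c * u x) \<in> L2_space M"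
  by (auto simp: L2_space_def power_mult_distrib)

lemma L2_diff:
  assumes "u \<in> L2_space M" "v \<in> L2_space M"
  shows "(\<lambda>x. u x - v x) \<in> L2_space M"
    and "sq_dist M u v \<le> 2 * sq_norm M u + 2 * sq_norm M v"
  using L2_add[OF assms(1) L2_scale[OF assms(2), of "-1"]] by (auto simp: power2_eq_square)

lemma L2_dist_triangle:
  assumes "u \<in> L2_space M" "v \<in> L2_space M" "w \<in> L2_space M"
  shows "sq_dist M u w \<le> 2 * sq_dist M u v + 2 * sq_dist M v w"
  using L2_add(2)[OF L2_diff(1)[OF assms(1,2)] L2_diff(1)[OF assms(2,3)]] by simp

lemma L2_dist_commute: "sq_dist M u w = sq_dist M w u"
  by (simp add: power2_commute)

lemma L2_mult_integrable:
  assumes "u \<in> L2_space M" "v \<in> L2_space M"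
  shows "integrable M (\<lambda>x. u x * v x)"
proof -
  have [measurable]: "u \<in> borel_measurable M" "v \<in> borel_measurable M"
    using assms L2_measurable by auto
  have i: "integrable M (\<lambda>x. (u x)\<^sup>2 + (v x)\<^sup>2)"
    using assms by (intro Bochner_Integration.integrable_add L2_integrable_sq)
  have "\<bar>a * b\<bar> \<le> a\<^sup>2 + b\<^sup>2" for a b :: real
  proof -
    have "2 * (\<bar>a\<bar> * \<bar>b\<bar>) \<le> a\<^sup>2 + b\<^sup>2"
      using zero_le_power2[of "\<bar>a\<bar> - \<bar>b\<bar>"] by (simp add: power2_diff)
    moreover have "0 \<le> \<bar>a\<bar> * \<bar>b\<bar>" by simp
    ultimately show ?thesis unfolding abs_mult by linarith
  qed
  then show ?thesis
    by (intro Bochner_Integration.integrable_bound[OF i]) auto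
qed

lemma L2_Cauchy_Schwarz:
  assumes "u \<in> L2_space M" "v \<in> L2_space M"
  shows "(LINT x|M. u x * v x)\<^sup>2 \<le> sq_norm M u * sq_norm M v"
proof -
  define A where "A = sq_norm M u"
  define B where "B = (LINT x|M. u x * v x)"
  define C where "C = sq_norm M v"
  have q: "A + 2 * t * B + t\<^sup>2 * C \<ge> 0" for t
  proof -
    have "0 \<le> (LINT x|M. (u x + t * v x)\<^sup>2)" by (intro integral_nonneg_AE) auto
    also have "\<dots> = (LINT x|M. (u x)\<^sup>2 + 2 * t * (u x * v x) + t\<^sup>2 * (v x)\<^sup>2)"
      by (simp add: power2_eq_square algebra_simps)
    also have "\<dots> = A + 2 * t * B + t\<^sup>2 * C"
      using assms by (simp add: A_def B_def C_def L2_integrable_sq L2_mult_integrable)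
    finally show ?thesis .
  qed
  have "C \<ge> 0" unfolding C_def by (intro integral_nonneg_AE) auto
  have "B\<^sup>2 \<le> A * C"
  proof (cases "C = 0")
    case True
    have "B = 0"
    proof (rule ccontr)
      assume "B \<noteq> 0"
      then show False using q[of "- (A + 1) / (2 * B)"] True by (simp add: field_simps)
    qed
    then show ?thesis using True by simp
  next
    case False
    then have "0 \<le> C * (A + 2 * (- B / C) * B + (- B / C)\<^sup>2 * C)" 
      using q[of "- B / C"] \<open>C \<ge> 0\<close> by (intro mult_nonneg_nonneg)
    also have "\<dots> = A * C - B\<^sup>2" using False by (simp add: field_simps power2_eq_square)
    finally show ?thesis by simp
  qed
  then show ?thesis by (simp add: A_def B_def C_def)
qed

lemma L2tends_D:
  assumes "L2tends M s l"
  shows "s k \<in> L2_space M" "l \<in> L2_space M" "(\<lambda>k. sq_dist M (s k) l) \<longlonglongrightarrow> 0"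
  using assms by (auto simp: L2tends_def)

lemma tendsto_0_nonneg_le:
  fixes f :: "nat \<Rightarrow> real"
  assumes "g \<longlonglongrightarrow> 0" "\<And>k. 0 \<le> f k" "\<And>k. f k \<le> g k"
  shows "f \<longlonglongrightarrow> 0"
  by (rule tendsto_sandwich[OF _ _ tendsto_const assms(1)]) (auto simp: assms)

lemma L2tends_subseq:
  assumes "L2tends M s l" "strict_mono r" shows "L2tends M (\<lambda>k. s (r k)) l"
  using assms LIMSEQ_subseq_LIMSEQ[OF L2tends_D(3)[OF assms(1)] assms(2)]
  by (auto simp: L2tends_def o_def)

lemma L2tends_add:
  assumes "L2tends M s l" "L2tends M s' l'"
  shows "L2tends M (\<lambda>k x. s k x + s' k x) (\<lambda>x. l x + l' x)"
proof -
  note D = L2tends_D[OF assms(1)] L2tends_D[OF assms(2)]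
  have t: "(\<lambda>k. 2 * sq_dist M (s k) l + 2 * sq_dist M (s' k) l') \<longlonglongrightarrow> 0"
    using tendsto_add[OF tendsto_mult[OF tendsto_const D(3)] tendsto_mult[OF tendsto_const D(6)], of 2 2] by simp
  have "(LINT x|M. (s k x + s' k x - (l x + l' x))\<^sup>2) \<le> 2 * sq_dist M (s k) l + 2 * sq_dist M (s' k) l'" for k
    using L2_add(2)[OF L2_diff(1)[OF D(1,2)] L2_diff(1)[OF D(4,5)], of k k] by (simp add: algebra_simps)
  then have "(\<lambda>k. LINT x|M. (s k x + s' k x - (l x + l' x))\<^sup>2) \<longlonglongrightarrow> 0"
    by (intro tendsto_0_nonneg_le[OF t]) (auto intro: integral_nonneg_AE)
  then show ?thesis using D by (auto simp: L2tends_def intro: L2_add(1))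
qed

lemma L2tends_scale:
  assumes "L2tends M s l"
  shows "L2tends M (\<lambda>k x. c * s k x) (\<lambda>x. c * l x)"
proof -
  note D = L2tends_D[OF assms]
  have "(\<lambda>k. c\<^sup>2 * sq_dist M (s k) l) \<longlonglongrightarrow> 0"
    using tendsto_mult[OF tendsto_const D(3)] by simp
  moreover have "(LINT x|M. (c * s k x - c * l x)\<^sup>2) = c\<^sup>2 * sq_dist M (s k) l" for k
    by (simp add: right_diff_distrib[symmetric] power_mult_distrib)
  ultimately show ?thesis using D by (auto simp: L2tends_def L2_scale)
qed

lemma L2tends_cong_AE:
  assumes "L2tends M s l" "\<And>k. s' k \<in> borel_measurable M" "l' \<in> borel_measurable M"
    "\<And>k. AE x in M. s k x = s' k x" "AE x in M. l x = l' x"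
  shows "L2tends M s' l'"
proof -
  note D = L2tends_D[OF assms(1)]
  have c: "f' \<in> L2_space M" if "f \<in> L2_space M" "AE x in M. f x = f' x" "f' \<in> borel_measurable M" for f f'
  proof -
    have "integrable M (\<lambda>x. (f x)\<^sup>2) \<longleftrightarrow> integrable M (\<lambda>x. (f' x)\<^sup>2)"
    proof (rule integrable_cong_AE)
      show "AE x in M. (f x)\<^sup>2 = (f' x)\<^sup>2" using that(2) by eventually_elim simp
    qed (use that in \<open>auto intro: borel_measurable_power L2_measurable\<close>)
    then show ?thesis using that by (simp add: L2_space_def)
  qed
  have "sq_dist M (s k) l = sq_dist M (s' k) l'" for k
  proof (rule integral_cong_AE)
    show "AE x in M. (s k x - l x)\<^sup>2 = (s' k x - l' x)\<^sup>2"
      using assms(4)[of k] assms(5) by eventually_elim simp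
  qed (use L2_measurable[OF D(1)] L2_measurable[OF D(2)] assms(2,3) in measurable)
  moreover have "s' k \<in> L2_space M" for k using c[OF D(1) assms(4) assms(2)] .
  moreover have "l' \<in> L2_space M" using c[OF D(2) assms(5) assms(3)] .
  ultimately show ?thesis using D(3) by (simp add: L2tends_def)
qed

lemma L2tends_imp_Cauchy:
  assumes "L2tends M s l" shows "L2Cauchy M s"
  unfolding L2Cauchy_def
proof (intro conjI allI impI)
  note D = L2tends_D[OF assms]
  show "s k \<in> L2_space M" for k by (rule D(1))
  fix e :: real assume "e > 0"
  then have "eventually (\<lambda>k. sq_dist M (s k) l < e / 4) sequentially"
    using order_tendstoD(2)[OF D(3), of "e / 4"] by simp
  then obtain N where N: "\<And>k. k \<ge> N \<Longrightarrow> sq_dist M (s k) l < e / 4"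
    by (auto simp: eventually_sequentially)
  show "\<exists>N. \<forall>m\<ge>N. \<forall>n\<ge>N. sq_dist M (s m) (s n) < e"
  proof (intro exI[of _ N] allI impI)
    fix m n assume "m \<ge> N" "n \<ge> N"
    then have *: "sq_dist M (s m) l < e / 4" "sq_dist M l (s n) < e / 4"
      using N[of m] N[of n] L2_dist_commute[of M l "s n"] by auto
    show "sq_dist M (s m) (s n) < e"
      using L2_dist_triangle[OF D(1) D(2) D(1), of m n] * by linarith
  qed
qed

lemma L2tends_AE_subseq:
  assumes "L2tends M s l"
  obtains r :: "nat \<Rightarrow> nat" where "strict_mono r" "AE x in M. (\<lambda>n. s (r n) x) \<longlonglongrightarrow> l x"
proof -
  note D = L2tends_D[OF assms]
  have "integrable M (\<lambda>x. (s k x - l x)\<^sup>2)" for k by (intro L2_integrable_sq L2_diff D)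
  then obtain r where r: "strict_mono r" "AE x in M. (\<lambda>n. (s (r n) x - l x)\<^sup>2) \<longlonglongrightarrow> 0"
    using tendsto_L1_AE_subseq[of M "\<lambda>k x. (s k x - l x)\<^sup>2"] D(3) by auto
  from r(2) have "AE x in M. (\<lambda>n. s (r n) x) \<longlonglongrightarrow> l x"
  proof eventually_elim
    case (elim x)
    then have "(\<lambda>n. sqrt ((s (r n) x - l x)\<^sup>2)) \<longlonglongrightarrow> sqrt 0" by (rule tendsto_real_sqrt)
    then have "(\<lambda>n. s (r n) x - l x) \<longlonglongrightarrow> 0" by (simp add: tendsto_rabs_zero_iff)
    then show ?case using LIM_zero_iff by blast
  qed
  with r that show ?thesis by blast
qed

text \<open>Identifies the limit of a Cauchy sequence from convergence almost everywhere along one subsequence. It is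
applied to products, whose factors have known limits.\<close>

lemma L2_Fatou:
  assumes C: "L2Cauchy M s" and l: "l \<in> borel_measurable M"
    and r: "strict_mono r" "AE x in M. (\<lambda>n. s (r n) x) \<longlonglongrightarrow> l x"
  shows "L2tends M s l"
proof -
  have s: "s k \<in> L2_space M" for k using C by (simp add: L2Cauchy_def)
  note [measurable] = L2_measurable[OF s] l
  have key: "(\<integral>\<^sup>+x. (s m x - l x)\<^sup>2 \<partial>M) \<le> ennreal e"
    if N: "\<forall>m\<ge>N. \<forall>n\<ge>N. sq_dist M (s m) (s n) < e" "m \<ge> N" for m N e
  proof -
    have "(\<integral>\<^sup>+x. (s m x - l x)\<^sup>2 \<partial>M) = (\<integral>\<^sup>+x. liminf (\<lambda>n. ennreal ((s m x - s (r n) x)\<^sup>2)) \<partial>M)"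
    proof (rule nn_integral_cong_AE)
      show "AE x in M. ennreal ((s m x - l x)\<^sup>2) = liminf (\<lambda>n. ennreal ((s m x - s (r n) x)\<^sup>2))"
        using r(2)
      proof eventually_elim
        case (elim x)
        have "(\<lambda>n. ennreal ((s m x - s (r n) x)\<^sup>2)) \<longlonglongrightarrow> ennreal ((s m x - l x)\<^sup>2)"
          by (intro tendsto_intros elim)
        then show ?case using lim_imp_Liminf[OF sequentially_bot] by metis
      qed
    qed
    also have "\<dots> \<le> liminf (\<lambda>n. \<integral>\<^sup>+x. ennreal ((s m x - s (r n) x)\<^sup>2) \<partial>M)"
      by (rule nn_integral_liminf) measurable
    also have "\<dots> \<le> ennreal e"
    proof -
      have "eventually (\<lambda>n. (\<integral>\<^sup>+x. ennreal ((s m x - s (r n) x)\<^sup>2) \<partial>M) \<le> ennreal e) sequentially"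
        unfolding eventually_sequentially
      proof (intro exI[of _ N] allI impI)
        fix n assume "n \<ge> N"
        then have "r n \<ge> N" using seq_suble[OF r(1), of n] by simp
        then have "sq_dist M (s m) (s (r n)) \<le> e" using N by (simp add: less_imp_le)
        moreover have "(\<integral>\<^sup>+x. ennreal ((s m x - s (r n) x)\<^sup>2) \<partial>M) = ennreal (sq_dist M (s m) (s (r n)))"
          by (rule nn_integral_eq_integral) (auto intro!: L2_integrable_sq L2_diff s)
        ultimately show "(\<integral>\<^sup>+x. ennreal ((s m x - s (r n) x)\<^sup>2) \<partial>M) \<le> ennreal e"
          by (simp add: ennreal_leI)
      qed
      then show ?thesis
        by (intro Liminf_le) auto
    qed
    finally show ?thesis .
  qed
  have ex: "\<exists>N. \<forall>m\<ge>N. (\<lambda>x. s m x - l x) \<in> L2_space M \<and> sq_dist M (s m) l \<le> e" if e: "e > 0" for e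
  proof -
    obtain N where N: "\<forall>m\<ge>N. \<forall>n\<ge>N. sq_dist M (s m) (s n) < e"
      using C e unfolding L2Cauchy_def by blast
    show ?thesis
    proof (intro exI[of _ N] allI impI conjI)
      fix m assume m: "m \<ge> N"
      have "(\<integral>\<^sup>+x. norm ((s m x - l x)\<^sup>2) \<partial>M) < \<infinity>"
        using key[OF N m] by (simp add: order_le_less_trans)
      then have i: "integrable M (\<lambda>x. (s m x - l x)\<^sup>2)"
        by (intro integrableI_bounded) auto
      then show "(\<lambda>x. s m x - l x) \<in> L2_space M" by (simp add: L2_space_def)
      have "ennreal (sq_dist M (s m) l) \<le> ennreal e"
        using key[OF N m] nn_integral_eq_integral[OF i] by simp
      then show "sq_dist M (s m) l \<le> e" using e by simp
    qed
  qed
  obtain m where "(\<lambda>x. s m x - l x) \<in> L2_space M" using ex[of 1] by auto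
  from L2_diff(1)[OF s[of m] this] have "l \<in> L2_space M" by simp
  moreover have "(\<lambda>k. sq_dist M (s k) l) \<longlonglongrightarrow> 0"
  proof (rule LIMSEQ_I)
    fix e :: real assume "e > 0"
    then obtain N where "\<forall>m\<ge>N. sq_dist M (s m) l \<le> e / 2" using ex[of "e / 2"] by auto
    then show "\<exists>no. \<forall>n\<ge>no. norm ((sq_dist M (s n) l) - 0) < e"
      using \<open>e > 0\<close> by (intro exI[of _ N]) (fastforce simp: abs_of_nonneg integral_nonneg_AE)
  qed
  ultimately show ?thesis using s by (simp add: L2tends_def)
qed

text \<open>The Riesz-Fischer theorem. Along a subsequence with squared increments at most \<open>4\<^sup>-\<^sup>k\<close> in the mean, the
series of the squared increments weighted by \<open>2\<^sup>k\<close> converges almost everywhere, so the increments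
are dominated pointwise by a geometric series.\<close>

lemma L2_complete:
  assumes C: "L2Cauchy M s" obtains l where "L2tends M s l"
proof -
  have s: "s k \<in> L2_space M" for k using C by (simp add: L2Cauchy_def)
  note [measurable] = L2_measurable[OF s]
  have "\<exists>N. \<forall>m\<ge>N. \<forall>n\<ge>N. sq_dist M (s m) (s n) < (1/4)^k" for k :: nat
    using C unfolding L2Cauchy_def by auto
  then obtain N where N: "\<And>k m n. m \<ge> N k \<Longrightarrow> n \<ge> N k \<Longrightarrow> sq_dist M (s m) (s n) < (1/4)^k"
    by metis
  define r where "r = rec_nat (N 0) (\<lambda>k p. max (Suc p) (N (Suc k)))"
  have r: "strict_mono r" by (auto simp: strict_mono_Suc_iff r_def)
  have rN: "r k \<ge> N k" for k by (cases k) (auto simp: r_def)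
  define d where "d = (\<lambda>k x. s (r (Suc k)) x - s (r k) x)"
  have d2: "sq_norm M (d k) \<le> (1/4)^k" for k
    using N[of k "r (Suc k)" "r k"] rN[of k] strict_monoD[OF r, of k "Suc k"] by (simp add: d_def)
  have di: "integrable M (\<lambda>x. (d k x)\<^sup>2)" for k
    unfolding d_def by (intro L2_integrable_sq L2_diff s)
  have [measurable]: "d k \<in> borel_measurable M" for k unfolding d_def by measurable
  have "(\<integral>\<^sup>+x. (\<Sum>k. ennreal (2^k * (d k x)\<^sup>2)) \<partial>M) = (\<Sum>k. \<integral>\<^sup>+x. ennreal (2^k * (d k x)\<^sup>2) \<partial>M)"
    by (rule nn_integral_suminf) measurable
  also have "\<dots> \<le> (\<Sum>k. ennreal ((1/2)^k))"
  proof (rule suminf_le)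
    fix k
    have "(\<integral>\<^sup>+x. ennreal (2^k * (d k x)\<^sup>2) \<partial>M) = ennreal (LINT x|M. 2^k * (d k x)\<^sup>2)"
      by (rule nn_integral_eq_integral) (use di in auto)
    also have "\<dots> \<le> ennreal (2^k * (1/4)^k)"
      using d2[of k] by (intro ennreal_leI) simp
    also have "2^k * (1/4::real)^k = (1/2)^k" by (simp add: power_mult_distrib[symmetric])
    finally show "(\<integral>\<^sup>+x. ennreal (2^k * (d k x)\<^sup>2) \<partial>M) \<le> ennreal ((1/2)^k)" .
  qed auto
  also have "\<dots> < \<infinity>"
    by (subst suminf_ennreal2) (auto simp: summable_geometric)
  finally have "AE x in M. (\<Sum>k. ennreal (2^k * (d k x)\<^sup>2)) \<noteq> \<infinity>"
    by (intro nn_integral_PInf_AE) auto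
  then have conv: "AE x in M. convergent (\<lambda>k. s (r k) x)"
  proof eventually_elim
    case (elim x)
    have sm: "summable (\<lambda>k. 2^k * (d k x)\<^sup>2)"
      by (rule summable_suminf_not_top) (use elim in auto)
    define C where "C = (\<Sum>k. 2^k * (d k x)\<^sup>2)"
    have b: "2^k * (d k x)\<^sup>2 \<le> C" for k
    proof -
      have "2^k * (d k x)\<^sup>2 = (\<Sum>j\<in>{k}. 2^j * (d j x)\<^sup>2)" by simp
      also have "\<dots> \<le> C" unfolding C_def using sm by (intro sum_le_suminf) auto
      finally show ?thesis .
    qed
    have "\<bar>d k x\<bar> \<le> sqrt C * (1 / sqrt 2)^k" for k
    proof -
      have "(d k x)\<^sup>2 \<le> C * (1/2)^k" using b[of k] by (simp add: field_simps)
      then have "sqrt ((d k x)\<^sup>2) \<le> sqrt (C * (1/2)^k)" by (rule real_sqrt_le_mono)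
      moreover have "sqrt (C * (1/2)^k) = sqrt C * (1 / sqrt 2)^k"
        by (simp only: real_sqrt_mult real_sqrt_power real_sqrt_divide real_sqrt_one)
      ultimately show ?thesis by (simp only: real_sqrt_abs)
    qed
    moreover have "summable (\<lambda>k. sqrt C * (1 / sqrt 2)^k)"
      by (intro summable_mult summable_geometric) simp
    ultimately have "summable (\<lambda>k. d k x)"
      using summable_comparison_test'[of "\<lambda>k. sqrt C * (1 / sqrt 2)^k" 0 "\<lambda>k. d k x"] by simp
    then have "convergent (\<lambda>n. \<Sum>k<n. d k x)" by (simp add: summable_iff_convergent)
    moreover have "(\<Sum>k<n. d k x) = s (r n) x - s (r 0) x" for n
      unfolding d_def by (rule sum_lessThan_telescope)
    ultimately have "convergent (\<lambda>n. s (r n) x - s (r 0) x)" by simp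
    from convergent_add[OF this convergent_const[of "s (r 0) x"]] show ?case by simp
  qed
  define l where "l = (\<lambda>x. lim (\<lambda>k. s (r k) x))"
  have l: "l \<in> borel_measurable M" unfolding l_def by measurable
  have "AE x in M. (\<lambda>k. s (r k) x) \<longlonglongrightarrow> l x"
    using conv by eventually_elim (simp add: l_def convergent_LIMSEQ_iff)
  from L2_Fatou[OF C l r this] that show ?thesis by blast
qed

lemma L2tends_unique:
  assumes "L2tends M s l" "L2tends M s l'" shows "AE x in M. l x = l' x"
proof -
  obtain r where r: "strict_mono r" "AE x in M. (\<lambda>n. s (r n) x) \<longlonglongrightarrow> l x"
    using L2tends_AE_subseq[OF assms(1)] .
  obtain q where q: "AE x in M. (\<lambda>n. s (r (q n)) x) \<longlonglongrightarrow> l' x" "strict_mono q"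
    using L2tends_AE_subseq[OF L2tends_subseq[OF assms(2) r(1)]] by blast
  from r(2) q(1) show ?thesis
  proof eventually_elim
    case (elim x)
    from LIMSEQ_subseq_LIMSEQ[OF elim(1) q(2)] elim(2) show ?case
      by (simp add: o_def LIMSEQ_unique)
  qed
qed

lemma L2tends_finite_subseq:
  assumes "finite A" "\<And>s l. (s, l) \<in> A \<Longrightarrow> L2tends M s l"
  obtains r :: "nat \<Rightarrow> nat" where "strict_mono r" "AE x in M. \<forall>(s, l)\<in>A. (\<lambda>n. s (r n) x) \<longlonglongrightarrow> l x"
proof -
  have "\<exists>r::nat \<Rightarrow> nat. strict_mono r \<and> (AE x in M. \<forall>(s, l)\<in>A. (\<lambda>n. s (r n) x) \<longlonglongrightarrow> l x)"
    using assms
  proof (induction A rule: finite_induct)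
    case empty
    show ?case by (intro exI[of _ "\<lambda>n. n"]) (auto simp: strict_mono_def)
  next
    case (insert p A)
    obtain s l where p: "p = (s, l)" by (cases p)
    obtain r where r: "strict_mono r" "AE x in M. \<forall>(s, l)\<in>A. (\<lambda>n. s (r n) x) \<longlonglongrightarrow> l x"
      using insert.IH insert.prems by blast
    have L: "L2tends M s l" using insert.prems p by blast
    obtain q where q: "strict_mono q" "AE x in M. (\<lambda>n. s (r (q n)) x) \<longlonglongrightarrow> l x"
      using L2tends_AE_subseq[OF L2tends_subseq[OF L r(1)]] .
    have "AE x in M. \<forall>(s, l)\<in>insert p A. (\<lambda>n. s (r (q n)) x) \<longlonglongrightarrow> l x"
      using r(2) q(2)
    proof eventually_elim
      case (elim x)
      have "(\<lambda>n. s' (r (q n)) x) \<longlonglongrightarrow> l' x" if "(s', l') \<in> A" for s' l'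
        using LIMSEQ_subseq_LIMSEQ[OF _ q(1), of "\<lambda>n. s' (r n) x"] elim(1) that by (auto simp: o_def)
      then show ?case using elim(2) p by auto
    qed
    moreover have "strict_mono (\<lambda>n. r (q n))" using r(1) q(1) by (simp add: strict_mono_def)
    ultimately show ?case by blast
  qed
  with that show ?thesis by blast
qed

text \<open>Products of mean square limits are not controlled in general; the hypothesis that the products
form a Cauchy sequence is supplied by \<open>product_Cauchy\<close>.\<close>

lemma L2tends_mult:
  assumes "L2tends M a \<alpha>" "L2tends M b \<beta>" "L2Cauchy M (\<lambda>k x. a k x * b k x)"
  shows "L2tends M (\<lambda>k x. a k x * b k x) (\<lambda>x. \<alpha> x * \<beta> x)"
proof -
  obtain r where r: "strict_mono r"
    "AE x in M. \<forall>(s, l)\<in>{(a, \<alpha>), (b, \<beta>)}. (\<lambda>n. s (r n) x) \<longlonglongrightarrow> l x"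
    by (rule L2tends_finite_subseq[of "{(a, \<alpha>), (b, \<beta>)}" M]) (use assms(1,2) in auto)
  have "AE x in M. (\<lambda>n. a (r n) x * b (r n) x) \<longlonglongrightarrow> \<alpha> x * \<beta> x"
    using r(2) by eventually_elim (auto intro: tendsto_mult)
  moreover have "(\<lambda>x. \<alpha> x * \<beta> x) \<in> borel_measurable M"
    using assms by (intro borel_measurable_times L2_measurable) (auto simp: L2tends_def)
  ultimately show ?thesis using L2_Fatou[OF assms(3) _ r(1)] by blast
qed

lemma L2tends_integral_mult:
  assumes "L2tends M s l" "g \<in> L2_space M"
  shows "(\<lambda>k. LINT x|M. s k x * g x) \<longlonglongrightarrow> (LINT x|M. l x * g x)"
proof -
  note D = L2tends_D[OF assms(1)]
  have t: "(\<lambda>k. sq_dist M (s k) l * sq_norm M g) \<longlonglongrightarrow> 0"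
    using tendsto_mult[OF D(3) tendsto_const] by simp
  have eq: "(LINT x|M. (s k x - l x) * g x) = (LINT x|M. s k x * g x) - (LINT x|M. l x * g x)" for k
    using D assms by (simp add: left_diff_distrib L2_mult_integrable)
  have "(\<lambda>k. (LINT x|M. (s k x - l x) * g x)\<^sup>2) \<longlonglongrightarrow> 0"
    by (rule tendsto_0_nonneg_le[OF t]) (auto intro!: L2_Cauchy_Schwarz L2_diff D assms)
  then have "(\<lambda>k. (LINT x|M. (s k x - l x) * g x)) \<longlonglongrightarrow> 0"
    using tendsto_real_sqrt[of "\<lambda>k. (LINT x|M. (s k x - l x) * g x)\<^sup>2" 0 sequentially]
    by (simp add: tendsto_rabs_zero_iff)
  then show ?thesis unfolding eq by (simp add: LIM_zero_iff)
qed

lemma L2_norm_tendsto_iff: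
  "(\<lambda>k. L2_norm M (\<lambda>x. s k x - l x)) \<longlonglongrightarrow> 0 \<longleftrightarrow> (\<lambda>k. sq_dist M (s k) l) \<longlonglongrightarrow> 0"
proof
  assume "(\<lambda>k. L2_norm M (\<lambda>x. s k x - l x)) \<longlonglongrightarrow> 0"
  then have "(\<lambda>k. (L2_norm M (\<lambda>x. s k x - l x))\<^sup>2) \<longlonglongrightarrow> 0\<^sup>2" by (rule tendsto_power)
  then show "(\<lambda>k. sq_dist M (s k) l) \<longlonglongrightarrow> 0"
    by (simp add: L2_norm_def integral_nonneg_AE)
next
  assume "(\<lambda>k. sq_dist M (s k) l) \<longlonglongrightarrow> 0"
  from tendsto_real_sqrt[OF this] show "(\<lambda>k. L2_norm M (\<lambda>x. s k x - l x)) \<longlonglongrightarrow> 0"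
    by (simp add: L2_norm_def)
qed

section \<open>Mollification of square integrable functions\<close>

lemma lborel_shift: "distr lborel borel (\<lambda>z::'a::euclidean_space. z - h) = lborel"
proof -
  have "(\<lambda>z. z - h) = (+) (- h)" by auto
  then show ?thesis using lborel_distr_plus[of "- h"] by simp
qed

lemma measurable_shift: "u \<in> borel_measurable borel \<Longrightarrow> (\<lambda>z::'a::euclidean_space. u (z - h)) \<in> borel_measurable borel"
  by (rule measurable_compose[of "\<lambda>z. z - h"]) measurable

lemma integral_shift:
  assumes "u \<in> borel_measurable borel"
  shows "(LINT z|lborel. u (z - h)) = (LINT z::'a::euclidean_space|lborel. (u z :: real))"
proof -
  have "(LINT z|lborel. u z) = (LINT z|distr lborel borel (\<lambda>z. z - h). u z)" by (simp only: lborel_shift)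
  also have "\<dots> = (LINT z|lborel. u (z - h))" by (rule integral_distr) (use assms in auto)
  finally show ?thesis ..
qed

lemma integrable_shift:
  assumes "integrable lborel u"
  shows "integrable lborel (\<lambda>z::'a::euclidean_space. u (z - h) :: real)"
proof -
  have "integrable (distr lborel borel (\<lambda>z. z - h)) u" using assms by (simp only: lborel_shift)
  then show ?thesis by (rule integrable_distr[rotated]) auto
qed

lemma L2_shift: "u \<in> L2_space lborel \<Longrightarrow> (\<lambda>z::'a::euclidean_space. u (z - h)) \<in> L2_space lborel"
  using integrable_shift[of "\<lambda>z. (u z)\<^sup>2"] measurable_shift[of u] by (auto simp: L2_space_def)

definition translation_continuous :: "('a::euclidean_space \<Rightarrow> real) \<Rightarrow> bool" where
  "translation_continuous u \<longleftrightarrow> u \<in> L2_space lborel \<and>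
     (\<forall>e>0. \<exists>d>0. \<forall>h. norm h < d \<longrightarrow> (LINT z|lborel. (u (z - h) - u z)\<^sup>2) < e)"

lemma translation_continuous_approx:
  assumes u: "u \<in> L2_space lborel"
    and ap: "\<And>e. e > 0 \<Longrightarrow> \<exists>v. translation_continuous v \<and> sq_dist lborel u v < e"
  shows "translation_continuous u"
  unfolding translation_continuous_def
proof (intro conjI allI impI u)
  fix e :: real assume "e > 0"
  then obtain v where v: "translation_continuous v" "sq_dist lborel u v < e / 8"
    using ap[of "e / 8"] by auto
  then obtain d where d: "d > 0" "\<And>h. norm h < d \<Longrightarrow> (LINT z|lborel. (v (z - h) - v z)\<^sup>2) < e / 16"
    using \<open>e > 0\<close> unfolding translation_continuous_def by (metis zero_less_divide_iff zero_less_numeral)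
  have vL: "v \<in> L2_space lborel" using v by (simp add: translation_continuous_def)
  show "\<exists>d>0. \<forall>h. norm h < d \<longrightarrow> (LINT z|lborel. (u (z - h) - u z)\<^sup>2) < e"
  proof (intro exI[of _ d] conjI allI impI)
    fix h :: 'a assume h: "norm h < d"
    have s: "(LINT z|lborel. (u (z - h) - v (z - h))\<^sup>2) = sq_dist lborel u v"
    proof (rule integral_shift[of "\<lambda>z. (u z - v z)\<^sup>2"])
      show "(\<lambda>z. (u z - v z)\<^sup>2) \<in> borel_measurable borel"
        using L2_measurable[OF u] L2_measurable[OF vL] by measurable
    qed
    have 1: "(LINT z|lborel. (u (z - h) - u z)\<^sup>2) \<le> 2 * (LINT z|lborel. (u (z - h) - v (z - h))\<^sup>2) + 2 * (LINT z|lborel. (v (z - h) - u z)\<^sup>2)"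
      using L2_dist_triangle[OF L2_shift[OF u] L2_shift[OF vL] u] .
    have 2: "(LINT z|lborel. (v (z - h) - u z)\<^sup>2) \<le> 2 * (LINT z|lborel. (v (z - h) - v z)\<^sup>2) + 2 * sq_dist lborel v u"
      using L2_dist_triangle[OF L2_shift[OF vL] vL u] .
    show "(LINT z|lborel. (u (z - h) - u z)\<^sup>2) < e"
      using 1 2 s v(2) d(2)[OF h] L2_dist_commute[of lborel v u] by linarith
  qed (rule d(1))
qed

lemma translation_continuous_scale: assumes "translation_continuous u" shows "translation_continuous (\<lambda>z. c * u z)"
  unfolding translation_continuous_def
proof (intro conjI allI impI)
  show "(\<lambda>z. c * u z) \<in> L2_space lborel"
    using assms L2_scale unfolding translation_continuous_def by blast
  fix e :: real assume e: "e > 0"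
  have c: "c\<^sup>2 + 1 > 0" by (simp add: add_nonneg_pos)
  then obtain d where d: "d > 0" "\<And>h. norm h < d \<Longrightarrow> (LINT z|lborel. (u (z - h) - u z)\<^sup>2) < e / (c\<^sup>2 + 1)"
    using assms e unfolding translation_continuous_def by (meson divide_pos_pos)
  show "\<exists>d>0. \<forall>h. norm h < d \<longrightarrow> (LINT z|lborel. (c * u (z - h) - c * u z)\<^sup>2) < e"
  proof (intro exI[of _ d] conjI allI impI)
    fix h :: 'a assume h: "norm h < d"
    have "(LINT z|lborel. (c * u (z - h) - c * u z)\<^sup>2) = c\<^sup>2 * (LINT z|lborel. (u (z - h) - u z)\<^sup>2)"
      by (simp add: right_diff_distrib[symmetric] power_mult_distrib)
    also have "\<dots> \<le> (c\<^sup>2 + 1) * (LINT z|lborel. (u (z - h) - u z)\<^sup>2)"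
      by (intro mult_right_mono integral_nonneg_AE) auto
    also have "\<dots> < (c\<^sup>2 + 1) * (e / (c\<^sup>2 + 1))"
      using d(2)[OF h] c by (intro mult_strict_left_mono)
    also have "\<dots> = e" using c by simp
    finally show "(LINT z|lborel. (c * u (z - h) - c * u z)\<^sup>2) < e" .
  qed (rule d(1))
qed

lemma translation_continuous_add:
  assumes "translation_continuous u" "translation_continuous v"
  shows "translation_continuous (\<lambda>z. u z + v z)"
  unfolding translation_continuous_def
proof (intro conjI allI impI)
  have L: "u \<in> L2_space lborel" "v \<in> L2_space lborel"
    using assms by (auto simp: translation_continuous_def)
  show "(\<lambda>z. u z + v z) \<in> L2_space lborel" using L2_add(1)[OF L] .
  fix e :: real assume e: "e > 0"
  then have e4: "e / 4 > 0" by simp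
  obtain d where d: "d > 0" "\<And>h. norm h < d \<Longrightarrow> (LINT z|lborel. (u (z - h) - u z)\<^sup>2) < e / 4"
    using assms(1) e4 unfolding translation_continuous_def by meson
  obtain d' where d': "d' > 0" "\<And>h. norm h < d' \<Longrightarrow> (LINT z|lborel. (v (z - h) - v z)\<^sup>2) < e / 4"
    using assms(2) e4 unfolding translation_continuous_def by meson
  show "\<exists>d>0. \<forall>h. norm h < d \<longrightarrow> (LINT z|lborel. (u (z - h) + v (z - h) - (u z + v z))\<^sup>2) < e"
  proof (intro exI[of _ "min d d'"] conjI allI impI)
    fix h :: 'a assume h: "norm h < min d d'"
    have "(LINT z|lborel. (u (z - h) + v (z - h) - (u z + v z))\<^sup>2)
        \<le> 2 * (LINT z|lborel. (u (z - h) - u z)\<^sup>2) + 2 * (LINT z|lborel. (v (z - h) - v z)\<^sup>2)"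
      using L2_add(2)[OF L2_diff(1)[OF L2_shift[OF L(1)] L(1)] L2_diff(1)[OF L2_shift[OF L(2)] L(2)], of h h]
      by (simp add: algebra_simps)
    then show "(LINT z|lborel. (u (z - h) + v (z - h) - (u z + v z))\<^sup>2) < e"
      using d(2)[of h] d'(2)[of h] h by simp
  qed (use d d' in simp)
qed

lemma translation_continuous_zero: "translation_continuous (\<lambda>z. 0)"
  by (auto simp: translation_continuous_def L2_space_def intro: exI[of _ 1])

lemma translation_continuous_sum: "finite S \<Longrightarrow> (\<And>y. y \<in> S \<Longrightarrow> translation_continuous (f y)) \<Longrightarrow> translation_continuous (\<lambda>z. \<Sum>y\<in>S. f y z)"
  by (induction S rule: finite_induct) (auto simp: translation_continuous_zero translation_continuous_add)

text \<open>Enclose \<open>A\<close> in an open set \<open>U\<close> of nearly the same measure. The points of \<open>A\<close> whose ball of radius \<open>1 / (n + 1)\<close> stays in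
\<open>U\<close> exhaust \<open>A\<close>; a shift shorter than this radius moves them inside \<open>U\<close>. So, up to the two small
sets \<open>A - K n\<close> and \<open>U - A\<close> and their translates, the shift leaves \<open>A\<close> unchanged.\<close>

lemma translation_continuous_indicator:
  fixes A :: "'a::euclidean_space set"
  assumes A: "A \<in> sets borel" "emeasure lborel A < \<infinity>"
  shows "translation_continuous (indicator A)"
  unfolding translation_continuous_def
proof (intro conjI allI impI)
  have sq: "(indicator A z)\<^sup>2 = indicat_real A z" for z by (simp add: indicator_def)
  show "indicator A \<in> L2_space lborel"
    using A by (auto simp: L2_space_def sq integrable_indicator_iff)
  fix e :: real assume e: "e > 0"
  obtain U where U: "open U" "A \<subseteq> U" "emeasure lborel (U - A) < ennreal (e / 8)"
    using outer_regular_lborel[OF A(1), of "e / 8"] e by auto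
  define K where "K = (\<lambda>n::nat. {z. ball z (1 / Suc n) \<subseteq> U})"
  have Kc: "closed (K n)" for n
  proof -
    have "K n = (\<Inter>w\<in>-U. {z. dist z w \<ge> 1 / Suc n})"
      unfolding K_def by (auto simp: subset_eq) (meson ComplI linorder_not_less)
    moreover have "closed {z. dist z w \<ge> 1 / Suc n}" for w :: 'a
      by (intro closed_Collect_le continuous_intros)
    ultimately show ?thesis by auto
  qed
  have Km: "A - K n \<in> sets lborel" for n using A(1) borel_closed[OF Kc] by auto
  have dec: "decseq (\<lambda>n. A - K n)"
    unfolding decseq_Suc_iff
  proof (intro allI Diff_mono subset_refl)
    fix n
    have "ball z (1 / Suc (Suc n)) \<subseteq> ball z (1 / Suc n)" for z :: 'a
      by (intro subset_ball divide_left_mono) auto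
    then show "K n \<subseteq> K (Suc n)" unfolding K_def by blast
  qed
  have empty: "(\<Inter>n. A - K n) = {}"
  proof -
    have "\<exists>n. z \<in> K n" if "z \<in> A" for z
    proof -
      have "\<exists>r>0. ball z r \<subseteq> U" using U(1) U(2) that open_contains_ball[of U] by auto
      then obtain r where r: "r > 0" "ball z r \<subseteq> U" by blast
      obtain n :: nat where n: "1 / real (Suc n) < r" using nat_approx_posE[OF r(1)] .
      have "ball z (1 / real (Suc n)) \<subseteq> ball z r" using n by (intro subset_ball) simp
      then have "z \<in> K n" unfolding K_def using r(2) by blast
      then show ?thesis ..
    qed
    then show ?thesis by auto
  qed
  have fin: "emeasure lborel (A - K n) \<noteq> \<infinity>" for n
  proof -
    have "emeasure lborel (A - K n) \<le> emeasure lborel A" by (rule emeasure_mono) (use A in auto)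
    then show ?thesis using A(2) by auto
  qed
  have "(\<lambda>n. measure lborel (A - K n)) \<longlonglongrightarrow> measure lborel (\<Inter>n. A - K n)"
    using Km fin by (intro Lim_measure_decseq dec) auto
  then have "(\<lambda>n. measure lborel (A - K n)) \<longlonglongrightarrow> 0" unfolding empty by simp
  then have "eventually (\<lambda>n. measure lborel (A - K n) < e / 8) sequentially"
    using e by (intro order_tendstoD(2)) auto
  then obtain n where n: "measure lborel (A - K n) < e / 8" using eventually_happens by force
  define V where "V = A - K n"
  define W where "W = U - A"
  have VW: "V \<in> sets borel" "W \<in> sets borel" using Km[of n] U(1) A(1) by (auto simp: V_def W_def)
  have mW: "measure lborel W < e / 8" "emeasure lborel W < \<infinity>"
  proof -
    show f: "emeasure lborel W < \<infinity>" using U(3) unfolding W_def by (simp add: order_less_trans)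
    then have "ennreal (measure lborel W) < ennreal (e / 8)"
      using U(3) unfolding W_def by (simp add: emeasure_eq_ennreal_measure)
    then show "measure lborel W < e / 8" by (simp add: ennreal_less_iff)
  qed
  have iV: "integrable lborel (indicat_real V)" "integrable lborel (indicat_real W)"
    using VW fin[of n] mW(2) by (auto simp: integrable_indicator_iff V_def top.not_eq_extremum)
  show "\<exists>d>0. \<forall>h. norm h < d \<longrightarrow> (LINT z|lborel. (indicat_real A (z - h) - indicator A z)\<^sup>2) < e"
  proof (intro exI[of _ "1 / Suc n"] conjI allI impI)
    fix h :: 'a assume h: "norm h < 1 / Suc n"
    have in_U: "z + h \<in> U" "z - h \<in> U" if "z \<in> K n" for z
      using that h unfolding K_def by (auto simp: subset_eq dist_norm)
    let ?g = "\<lambda>z. (indicat_real V (z - h) + indicat_real W z) + (indicat_real V z + indicat_real W (z - h))"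
    have pt: "(indicat_real A (z - h) - indicator A z)\<^sup>2 \<le> ?g z" for z
    proof -
      consider "z - h \<in> A" "z \<notin> A" | "z - h \<notin> A" "z \<in> A" | "z - h \<in> A \<longleftrightarrow> z \<in> A" by blast
      then show ?thesis
      proof cases
        case 1
        then have "z - h \<in> V \<or> z \<in> W" using in_U(1)[of "z - h"] by (auto simp: V_def W_def)
        then show ?thesis using 1 by (auto simp: indicator_def)
      next
        case 2
        then have "z \<in> V \<or> z - h \<in> W" using in_U(2)[of z] by (auto simp: V_def W_def)
        then show ?thesis using 2 by (auto simp: indicator_def)
      qed (auto simp: indicator_def)
    qed
    have gi: "integrable lborel ?g"
      by (intro Bochner_Integration.integrable_add integrable_shift iV)
    have "(LINT z|lborel. (indicat_real A (z - h) - indicator A z)\<^sup>2) \<le> (LINT z|lborel. ?g z)"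
    proof (intro integral_mono gi pt)
      have "(\<lambda>z. (indicat_real A (z - h) - indicator A z)) \<in> L2_space lborel"
        using A by (intro L2_diff L2_shift) (auto simp: L2_space_def sq integrable_indicator_iff)
      then show "integrable lborel (\<lambda>z. (indicat_real A (z - h) - indicator A z)\<^sup>2)" by (rule L2_integrable_sq)
    qed
    also have "\<dots> = 2 * measure lborel V + 2 * measure lborel W"
    proof -
      have "(LINT z|lborel. ?g z) = ((LINT z|lborel. indicat_real V (z - h)) + (LINT z|lborel. indicat_real W z))
         + ((LINT z|lborel. indicat_real V z) + (LINT z|lborel. indicat_real W (z - h)))"
        by (simp add: iV integrable_shift)
      also have "\<dots> = 2 * measure lborel V + 2 * measure lborel W"
        using VW by (simp add: integral_shift)
      finally show ?thesis .
    qed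
    also have "\<dots> < e" using n mW e by (simp add: V_def)
    finally show "(LINT z|lborel. (indicat_real A (z - h) - indicator A z)\<^sup>2) < e" .
  qed simp
qed

lemma L2_translation_continuous:
  fixes u :: "'a::euclidean_space \<Rightarrow> real"
  assumes u: "u \<in> L2_space lborel"
  shows "translation_continuous u"
proof -
  have um: "u \<in> borel_measurable lborel" using u by (rule L2_measurable)
  obtain F where F0: "(\<forall>i. simple_function lborel (F i)) \<and> (\<forall>x\<in>space lborel. (\<lambda>i. F i x) \<longlonglongrightarrow> u x)
      \<and> (\<forall>i. \<forall>x\<in>space lborel. dist (F i x) 0 \<le> 2 * dist (u x) 0)"
    using borel_measurable_implies_sequence_metric[OF um, of 0] by (elim exE) rule
  have F: "simple_function lborel (F i)" "(\<lambda>i. F i x) \<longlonglongrightarrow> u x" "\<bar>F i x\<bar> \<le> 2 * \<bar>u x\<bar>" for i x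
    using F0 by simp_all
  have Fm[measurable]: "F i \<in> borel_measurable borel" for i
    using borel_measurable_simple_function[OF F(1)] by simp
  have F2: "(F i x)\<^sup>2 \<le> 4 * (u x)\<^sup>2" for i x
    using power_mono[OF F(3)[of i x], of 2] by (simp add: power_mult_distrib)
  have i4: "integrable lborel (\<lambda>x. 4 * (u x)\<^sup>2)" using u by (simp add: L2_integrable_sq)
  have FL: "F i \<in> L2_space lborel" for i
    by (rule L2_bound[OF _ i4 F2]) simp
  have tcF: "translation_continuous (F i)" for i
  proof -
    have fin: "finite (range (F i))" using simple_functionD(1)[OF F(1)] by simp
    have rep: "F i = (\<lambda>x. \<Sum>y\<in>range (F i). y * indicator (F i -` {y}) x)"
    proof
      fix x
      have "F i x = (\<Sum>y\<in>F i ` space lborel. indicator (F i -` {y} \<inter> space lborel) x *\<^sub>R y)"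
        by (rule simple_function_indicator_representation_banach[OF F(1)]) simp
      also have "\<dots> = (\<Sum>y\<in>range (F i). y * indicator (F i -` {y}) x)"
        by (simp add: mult.commute)
      finally show "F i x = (\<Sum>y\<in>range (F i). y * indicator (F i -` {y}) x)" .
    qed
    have "translation_continuous (\<lambda>x. y * indicator (F i -` {y}) x)" for y
    proof (cases "y = 0")
      case True then show ?thesis by (simp add: translation_continuous_zero)
    next
      case False
      have S: "F i -` {y} \<in> sets borel" using measurable_sets[OF Fm, of "{y}"] by simp
      have "integrable lborel (\<lambda>x. indicat_real (F i -` {y}) x)"
      proof (rule Bochner_Integration.integrable_bound[OF integrable_divide[OF L2_integrable_sq[OF FL[of i]], of "y\<^sup>2"]])
        show "(\<lambda>x. indicat_real (F i -` {y}) x) \<in> borel_measurable lborel" using S by simp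
      qed (use False in \<open>auto simp: indicator_def\<close>)
      then have "emeasure lborel (F i -` {y}) < \<infinity>" using S by (simp add: integrable_indicator_iff)
      from translation_continuous_scale[OF translation_continuous_indicator[OF S this]] show ?thesis .
    qed
    then show ?thesis by (subst rep) (rule translation_continuous_sum[OF fin])
  qed
  have lim: "(\<lambda>i. sq_dist lborel u (F i)) \<longlonglongrightarrow> (LINT z::'a|lborel. 0)"
  proof (rule integral_dominated_convergence[where w = "\<lambda>z. 10 * (u z)\<^sup>2"])
    show "AE x in lborel. (\<lambda>i. (u x - F i x)\<^sup>2) \<longlonglongrightarrow> 0"
    proof (rule AE_I2)
      fix x
      have "(\<lambda>i. (u x - F i x)\<^sup>2) \<longlonglongrightarrow> (u x - u x)\<^sup>2" by (intro tendsto_intros F(2))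
      then show "(\<lambda>i. (u x - F i x)\<^sup>2) \<longlonglongrightarrow> 0" by simp
    qed
    show "AE x in lborel. norm ((u x - F i x)\<^sup>2) \<le> 10 * (u x)\<^sup>2" for i
    proof (rule AE_I2)
      fix x
      have "(u x - F i x)\<^sup>2 \<le> 2 * (u x)\<^sup>2 + 2 * (F i x)\<^sup>2"
        using sq_add_le[of "u x" "- F i x"] by simp
      then show "norm ((u x - F i x)\<^sup>2) \<le> 10 * (u x)\<^sup>2" using F2[of i x] by simp
    qed
  qed (use u um in \<open>auto simp: L2_integrable_sq\<close>)
  show ?thesis
  proof (rule translation_continuous_approx[OF u])
    fix e :: real assume "e > 0"
    then have "eventually (\<lambda>i. sq_dist lborel u (F i) < e) sequentially"
      using lim by (intro order_tendstoD(2)) auto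
    then obtain i where "sq_dist lborel u (F i) < e" using eventually_happens by force
    with tcF show "\<exists>v. translation_continuous v \<and> sq_dist lborel u v < e" by blast
  qed
qed

definition mollifier :: "real \<Rightarrow> ('a::euclidean_space \<Rightarrow> real) \<Rightarrow> bool" where
  "mollifier d f \<longleftrightarrow> test_function f \<and> (\<forall>z. f z \<ge> 0) \<and> (LINT z|lborel. f z) = 1 \<and> (\<forall>z. norm z \<ge> d \<longrightarrow> f z = 0)"

lemma mollifier_exists:
  assumes "d > 0" obtains f :: "'a::euclidean_space \<Rightarrow> real" where "mollifier d f"
proof -
  obtain g :: "'a \<Rightarrow> real" where g: "test_function g" "\<And>z. g z \<ge> 0" "\<And>z. g z > 0 \<longleftrightarrow> norm z < d"
    using bump_exists[OF assms] by blast
  define c where "c = (LINT z|lborel. g z)"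
  have "c \<noteq> 0"
  proof
    assume "c = 0"
    then have "AE z in lborel. g z = 0"
      unfolding c_def using integral_nonneg_eq_0_iff_AE[OF test_integrable[OF g(1)]] g(2) by auto
    then have "AE z in lborel. z \<notin> ball (0::'a) d"
    proof eventually_elim
      case (elim z) then show ?case using g(3)[of z] by simp
    qed
    then have "ball (0::'a) d \<in> null_sets lborel"
      by (subst AE_iff_null_sets) auto
    then have "negligible (ball (0::'a) d)" 
      using null_sets_completionI negligible_iff_null_sets by blast
    then show False using open_not_negligible[of "ball (0::'a) d"] assms by auto
  qed
  moreover have "c \<ge> 0" unfolding c_def by (intro integral_nonneg_AE) (auto simp: g)
  ultimately have c: "c > 0" by simp
  have "mollifier d (\<lambda>z. (1 / c) * g z)"
    unfolding mollifier_def
  proof (intro conjI allI impI)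
    show "test_function (\<lambda>z. (1 / c) * g z)" using g(1) by (rule test_scale)
    show "(LINT z|lborel. (1 / c) * g z) = 1" using c by (simp add: c_def[symmetric])
    show "(1 / c) * g z = 0" if "d \<le> norm z" for z using g(2,3)[of z] that by simp
  qed (use g c in auto)
  with that show ?thesis by blast
qed

lemma L2_locally_integrable:
  assumes "u \<in> L2_space lebesgue" shows "locally_integrable u"
  unfolding locally_integrable_def
proof (intro allI impI)
  fix K :: "'a set" assume "compact K"
  then have K: "integrable lebesgue (indicator K :: 'a \<Rightarrow> real)" "K \<in> sets lebesgue"
    using lmeasurable_compact lmeasurable_iff_integrable by (blast, simp add: fmeasurableD lmeasurable_compact)
  have "(\<lambda>x. (indicat_real K x)\<^sup>2) = indicat_real K" by (auto simp: indicator_def)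
  then have "indicat_real K \<in> L2_space lebesgue" using K by (simp add: L2_space_def)
  then have "integrable lebesgue (\<lambda>x. indicat_real K x * u x)"
    by (intro L2_mult_integrable assms)
  then show "u absolutely_integrable_on K" by (simp add: set_integrable_def)
qed

lemma L2_completion: "u \<in> borel_measurable borel \<Longrightarrow> u \<in> L2_space lebesgue \<longleftrightarrow> u \<in> L2_space lborel"
  by (auto simp: L2_space_def integrable_completion measurable_completion)

lemma Jensen_sq:
  assumes r: "integrable M r" "\<And>x. r x \<ge> 0" "(LINT x|M. r x) = 1"
    and i: "integrable M (\<lambda>x. r x * g x)" "integrable M (\<lambda>x. r x * (g x)\<^sup>2)"
  shows "(LINT x|M. r x * g x)\<^sup>2 \<le> (LINT x|M. r x * (g x :: real)\<^sup>2)"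
proof -
  define m where "m = (LINT x|M. r x * g x)"
  have "0 \<le> (LINT x|M. r x * (g x - m)\<^sup>2)" by (intro integral_nonneg_AE) (auto simp: r)
  also have "\<dots> = (LINT x|M. r x * (g x)\<^sup>2 - 2 * m * (r x * g x) + m\<^sup>2 * r x)"
    by (intro Bochner_Integration.integral_cong) (auto simp: power2_eq_square algebra_simps)
  also have "\<dots> = (LINT x|M. r x * (g x)\<^sup>2) - m\<^sup>2"
    using r i by (simp add: m_def power2_eq_square)
  finally show ?thesis by (simp add: m_def)
qed

text \<open>The convolution is an average of translates of \<open>u\<close>, so by Jensen's inequality its distance from \<open>u\<close> is at
most the average, hence at most the supremum, of the distances of these translates from \<open>u\<close>.\<close>

lemma mollify_lborel:
  fixes u :: "'a::euclidean_space \<Rightarrow> real"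
  assumes u: "u \<in> L2_space lborel" and f: "mollifier d f"
    and e: "\<And>h. norm h < d \<Longrightarrow> (LINT z|lborel. (u (z - h) - u z)\<^sup>2) \<le> e"
  shows "conv u f \<in> L2_space lborel" "sq_dist lborel (conv u f) u \<le> e"
proof -
  have um[measurable]: "u \<in> borel_measurable borel" using L2_measurable[OF u] by simp
  have ul: "u \<in> L2_space lebesgue" using u L2_completion[OF um] by simp
  have f': "test_function f" "\<And>z. f z \<ge> 0" "(LINT z|lborel. f z) = 1" "\<And>z. norm z \<ge> d \<Longrightarrow> f z = 0"
    using f by (auto simp: mollifier_def)
  have fm[measurable]: "f \<in> borel_measurable borel" using f'(1) test_borel by blast
  have fi: "integrable lborel f" using f'(1) by (rule test_integrable)
  obtain B where B: "\<And>z. \<bar>f z\<bar> \<le> B" using test_bounded[OF f'(1)] by metis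
  have cm[measurable]: "conv u f \<in> borel_measurable borel"
    using smooth_conv[OF L2_locally_integrable[OF ul] f'(1)] by (rule smooth_borel)
  have mz[measurable]: "(\<lambda>h. u (z - h)) \<in> borel_measurable borel" for z by (rule borel_affine[OF um])
  have uL: "(\<lambda>h. u (z - h)) \<in> L2_space lborel" for z
  proof -
    have "integrable (distr lborel borel (\<lambda>h. z - h)) (\<lambda>h. (u h)\<^sup>2)"
      unfolding lborel_reflect using u by (rule L2_integrable_sq)
    then have "integrable lborel (\<lambda>h. (u (z - h))\<^sup>2)" by (rule integrable_distr[rotated]) auto
    then show ?thesis by (simp add: L2_space_def)
  qed
  have fL: "f \<in> L2_space lborel"
  proof -
    have "integrable lborel (\<lambda>z. f z * f z)"
      using test_mult_left[OF test_smooth[OF f'(1)] f'(1)] by (rule test_integrable)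
    then show ?thesis by (simp add: L2_space_def power2_eq_square)
  qed
  have c: "conv u f z = (LINT h|lborel. f h * u (z - h))" for z
  proof -
    have "conv u f z = (LINT w|lborel. u w * f (z - w))"
      unfolding conv_def by (rule integral_completion) (use borel_affine[OF fm] in simp)
    also have "\<dots> = (LINT w|distr lborel borel (\<lambda>w. z - w). u w * f (z - w))"
      by (simp only: lborel_reflect)
    also have "\<dots> = (LINT h|lborel. u (z - h) * f (z - (z - h)))"
      by (rule integral_distr) (use borel_affine[OF fm] in simp_all)
    finally show ?thesis by (simp add: mult.commute)
  qed
  have i1: "integrable lborel (\<lambda>h. f h * (u (z - h) - u z))" for z
    using L2_mult_integrable[OF fL uL] fi by (simp add: right_diff_distrib)
  have i2: "integrable lborel (\<lambda>h. f h * (u (z - h) - u z)\<^sup>2)" for z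
  proof -
    have "integrable lborel (\<lambda>h. f h * (u (z - h))\<^sup>2)"
      by (rule Bochner_Integration.integrable_bound[OF integrable_mult_right[OF L2_integrable_sq[OF uL[of z]], of "\<bar>B\<bar>"]])
        (use order_trans[OF B abs_ge_self] in \<open>auto simp: abs_mult intro!: mult_right_mono\<close>)
    moreover have "(\<lambda>h. f h * (u (z - h) - u z)\<^sup>2) = (\<lambda>h. f h * (u (z - h))\<^sup>2 - 2 * u z * (f h * u (z - h)) + (u z)\<^sup>2 * f h)"
      by (auto simp: power2_eq_square algebra_simps)
    ultimately show ?thesis using L2_mult_integrable[OF fL uL] fi by simp
  qed
  have pt: "(conv u f z - u z)\<^sup>2 \<le> (LINT h|lborel. f h * (u (z - h) - u z)\<^sup>2)" for z
  proof -
    have "conv u f z - u z = (LINT h|lborel. f h * (u (z - h) - u z))"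
      using L2_mult_integrable[OF fL uL] fi by (simp add: right_diff_distrib c f'(3))
    then show ?thesis using Jensen_sq[OF fi f'(2,3) i1 i2] by simp
  qed
  have le: "ennreal (f h) * (\<integral>\<^sup>+z. ennreal ((u (z - h) - u z)\<^sup>2) \<partial>lborel) \<le> ennreal (f h * e)" for h
  proof (cases "norm h < d")
    case True
    have "(\<integral>\<^sup>+z. ennreal ((u (z - h) - u z)\<^sup>2) \<partial>lborel) = ennreal (LINT z|lborel. (u (z - h) - u z)\<^sup>2)"
      by (rule nn_integral_eq_integral) (auto intro!: L2_integrable_sq L2_diff L2_shift u)
    also have "\<dots> \<le> ennreal e" using e[OF True] by (rule ennreal_leI)
    finally show ?thesis using f'(2)[of h] by (simp add: ennreal_mult' mult_left_mono)
  next
    case False then show ?thesis using f'(4)[of h] by simp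
  qed
  have sw: "(\<lambda>(z, h). ennreal (f h * (u (z - h) - u z)\<^sup>2)) \<in> borel_measurable (lborel \<Otimes>\<^sub>M lborel)"
  proof -
    have "(\<lambda>p::'a\<times>'a. u (fst p - snd p)) \<in> borel_measurable (lborel \<Otimes>\<^sub>M lborel)"
      by (rule measurable_compose[OF _ um]) measurable
    then show ?thesis unfolding case_prod_beta by measurable
  qed
  have "(\<integral>\<^sup>+z. ennreal ((conv u f z - u z)\<^sup>2) \<partial>lborel) \<le> (\<integral>\<^sup>+z. (\<integral>\<^sup>+h. ennreal (f h * (u (z - h) - u z)\<^sup>2) \<partial>lborel) \<partial>lborel)"
  proof (rule nn_integral_mono)
    fix z
    have "(\<integral>\<^sup>+h. ennreal (f h * (u (z - h) - u z)\<^sup>2) \<partial>lborel) = ennreal (LINT h|lborel. f h * (u (z - h) - u z)\<^sup>2)"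
      by (rule nn_integral_eq_integral[OF i2]) (auto simp: f')
    then show "ennreal ((conv u f z - u z)\<^sup>2) \<le> (\<integral>\<^sup>+h. ennreal (f h * (u (z - h) - u z)\<^sup>2) \<partial>lborel)"
      using pt[of z] by (simp add: ennreal_leI)
  qed
  also have "\<dots> = (\<integral>\<^sup>+h. (\<integral>\<^sup>+z. ennreal (f h * (u (z - h) - u z)\<^sup>2) \<partial>lborel) \<partial>lborel)"
    using lborel_pair.Fubini'[OF sw] by simp
  also have "\<dots> \<le> (\<integral>\<^sup>+h. ennreal (f h * e) \<partial>lborel)"
  proof (rule nn_integral_mono)
    fix h
    have "(\<integral>\<^sup>+z. ennreal (f h * (u (z - h) - u z)\<^sup>2) \<partial>lborel) = ennreal (f h) * (\<integral>\<^sup>+z. ennreal ((u (z - h) - u z)\<^sup>2) \<partial>lborel)"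
      using measurable_shift[OF um] f'(2)[of h] by (simp add: ennreal_mult' nn_integral_cmult)
    then show "(\<integral>\<^sup>+z. ennreal (f h * (u (z - h) - u z)\<^sup>2) \<partial>lborel) \<le> ennreal (f h * e)" using le by simp
  qed
  also have "\<dots> = ennreal e"
  proof (cases "e \<ge> 0")
    case True
    have "(\<integral>\<^sup>+h. ennreal (f h * e) \<partial>lborel) = ennreal (LINT h|lborel. f h * e)"
      by (rule nn_integral_eq_integral) (use fi f'(2) True in auto)
    then show ?thesis using f'(3) by simp
  next
    case False
    then have "f h * e \<le> 0" for h using f'(2)[of h] by (simp add: mult_nonneg_nonpos)
    then show ?thesis using False by (simp add: ennreal_neg)
  qed
  finally have fin: "(\<integral>\<^sup>+z. ennreal ((conv u f z - u z)\<^sup>2) \<partial>lborel) \<le> ennreal e" .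
  have i: "integrable lborel (\<lambda>z. (conv u f z - u z)\<^sup>2)"
    by (rule integrableI_bounded) (use fin in \<open>auto intro: order_le_less_trans\<close>)
  have "(\<lambda>z. conv u f z - u z) \<in> L2_space lborel" using i by (simp add: L2_space_def)
  from L2_add(1)[OF this u] show "conv u f \<in> L2_space lborel" by simp
  have nn: "0 \<le> e"
  proof -
    have "d > 0"
    proof (rule ccontr)
      assume "\<not> d > 0"
      then have "f = (\<lambda>_. 0)" using f'(4) by (auto simp: fun_eq_iff) (meson le_less_trans norm_ge_zero not_le order_trans)
      then show False using f'(3) by simp
    qed
    then show ?thesis using e[of 0] by simp
  qed
  have "ennreal (sq_dist lborel (conv u f) u) \<le> ennreal e"
    using fin nn_integral_eq_integral[OF i] by simp
  then show "sq_dist lborel (conv u f) u \<le> e" using nn by simp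
qed

lemma conv_cong_AE:
  assumes "AE z in lebesgue. u z = u' z" "u \<in> borel_measurable lebesgue" "u' \<in> borel_measurable lebesgue"
    "f \<in> borel_measurable borel"
  shows "conv u f = conv u' f"
proof
  fix z
  have "(\<lambda>w. f (z - w)) \<in> borel_measurable lebesgue"
    using borel_affine[OF assms(4)] by (simp add: measurable_completion)
  then show "conv u f z = conv u' f z"
    unfolding conv_def using assms by (intro integral_cong_AE) auto
qed

text \<open>The Lebesgue measurable \<open>u\<close> is replaced by a Borel representative, since the exchange of integrals in
\<open>mollify_lborel\<close> takes place on the product of Borel measures.\<close>

lemma mollify:
  fixes u :: "'a::euclidean_space \<Rightarrow> real"
  assumes u: "u \<in> L2_space lebesgue" and "e > 0"
  obtains d where "d > 0"
    "\<And>f. mollifier d f \<Longrightarrow> conv u f \<in> L2_space lebesgue \<and> sq_dist lebesgue (conv u f) u \<le> e"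
proof -
  have um: "u \<in> borel_measurable lebesgue" using u by (rule L2_measurable)
  then obtain v where v: "v \<in> borel_measurable lborel" "AE z in lborel. u z = v z"
    using completion_ex_borel_measurable_real by blast
  have vb: "v \<in> borel_measurable borel" using v(1) by simp
  have vl: "v \<in> borel_measurable lebesgue" using v(1) by (simp add: measurable_completion)
  have ae: "AE z in lebesgue. u z = v z" using v(2) by (rule AE_completion)
  have "integrable lebesgue (\<lambda>z. (v z)\<^sup>2)"
  proof -
    have "integrable lebesgue (\<lambda>z. (u z)\<^sup>2) \<longleftrightarrow> integrable lebesgue (\<lambda>z. (v z)\<^sup>2)"
    proof (rule integrable_cong_AE)
      show "AE z in lebesgue. (u z)\<^sup>2 = (v z)\<^sup>2" using ae by eventually_elim simp
    qed (use um vl in auto)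
    then show ?thesis using L2_integrable_sq[OF u] by simp
  qed
  then have vL: "v \<in> L2_space lborel" using L2_completion[OF vb] vl by (simp add: L2_space_def)
  obtain d where d: "d > 0" "\<And>h. norm h < d \<Longrightarrow> (LINT z|lborel. (v (z - h) - v z)\<^sup>2) < e"
    using L2_translation_continuous[OF vL] \<open>e > 0\<close> unfolding translation_continuous_def by meson
  show ?thesis
  proof (rule that[OF d(1)])
    fix f :: "'a \<Rightarrow> real" assume f: "mollifier d f"
    have ft: "test_function f" using f by (simp add: mollifier_def)
    have c: "conv u f = conv v f" by (rule conv_cong_AE[OF ae um vl test_borel[OF ft]])
    have cb: "conv v f \<in> borel_measurable borel"
      using vL by (intro smooth_borel smooth_conv L2_locally_integrable ft) (simp add: L2_completion[OF vb])
    have m: "conv v f \<in> L2_space lborel" "sq_dist lborel (conv v f) v \<le> e"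
      using mollify_lborel[OF vL f less_imp_le[OF d(2)]] by auto
    have "sq_dist lebesgue (conv u f) u = sq_dist lebesgue (conv v f) v"
    proof (rule integral_cong_AE)
      show "AE z in lebesgue. (conv u f z - u z)\<^sup>2 = (conv v f z - v z)\<^sup>2"
        using ae by eventually_elim (simp add: c)
    next
      have "conv v f \<in> borel_measurable lebesgue" using cb by (simp add: measurable_completion)
      then show "(\<lambda>z. (conv u f z - u z)\<^sup>2) \<in> borel_measurable lebesgue"
        "(\<lambda>z. (conv v f z - v z)\<^sup>2) \<in> borel_measurable lebesgue"
        unfolding c using um vl by (intro borel_measurable_power borel_measurable_diff; simp)+
    qed
    also have "\<dots> = sq_dist lborel (conv v f) v"
      by (rule integral_completion) (use cb vb in measurable)
    finally show "conv u f \<in> L2_space lebesgue \<and> sq_dist lebesgue (conv u f) u \<le> e"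
      using m c L2_completion[OF cb] by simp
  qed
qed

section \<open>Uniqueness and limits of weak derivatives\<close>

lemma locally_integrable_measurable:
  assumes "locally_integrable (u :: 'a::euclidean_space \<Rightarrow> real)" shows "u \<in> borel_measurable lebesgue"
proof (rule borel_measurable_LIMSEQ_metric)
  fix n :: nat
  have "integrable lebesgue (\<lambda>z. indicator (cball 0 (real n)) z * u z)"
    using assms unfolding locally_integrable_def set_integrable_def by auto
  then show "(\<lambda>z. indicator (cball 0 (real n)) z * u z) \<in> borel_measurable lebesgue" by simp
next
  fix z :: 'a
  obtain N :: nat where N: "norm z \<le> real N" using real_arch_simple by blast
  have "eventually (\<lambda>n. indicator (cball 0 (real n)) z * u z = u z) sequentially"
    unfolding eventually_sequentially using N by (intro exI[of _ N]) (auto simp: indicator_def)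
  then show "(\<lambda>n. indicator (cball 0 (real n)) z * u z) \<longlonglongrightarrow> u z" by (rule tendsto_eventually)
qed

lemma locally_integrable_test_mult:
  assumes "locally_integrable u" "test_function f"
  shows "integrable lebesgue (\<lambda>w. u w * f w)"
proof -
  obtain B where B: "\<And>z. \<bar>f z\<bar> \<le> B" using test_bounded[OF assms(2)] by metis
  obtain R where R: "\<And>z. norm z > R \<Longrightarrow> f z = 0" using assms by (auto simp: test_function_iff)
  show ?thesis
    by (rule locally_integrable_bounded_mult(1)[OF assms(1), of _ B "cball 0 R"])
      (use B R test_borel[OF assms(2)] in auto)
qed

lemma test_L2: assumes "test_function f" shows "f \<in> L2_space lebesgue"
proof -
  have "integrable lborel (\<lambda>z. f z * f z)"
    using test_mult_left[OF test_smooth[OF assms] assms] by (rule test_integrable)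
  then have "f \<in> L2_space lborel" using test_borel[OF assms] by (simp add: L2_space_def power2_eq_square)
  then show ?thesis using L2_completion[OF test_borel[OF assms]] by simp
qed

lemma integral_parts_test:
  assumes "test_function f" "test_function g" "b \<in> Basis"
  shows "(LINT z|lebesgue. f z * partial b g z) = - (LINT z|lebesgue. partial b f z * g z)"
proof -
  have t: "test_function (\<lambda>z. f z * g z)" using test_mult_left[OF test_smooth[OF assms(1)] assms(2)] .
  have "0 = (LINT z|lebesgue. partial b (\<lambda>z. f z * g z) z)" using integral_test_partial[OF t assms(3)] by simp
  also have "\<dots> = (LINT z|lebesgue. f z * partial b g z + partial b f z * g z)"
    using assms by (simp add: partial_mult smooth_differentiable test_smooth)
  also have "\<dots> = (LINT z|lebesgue. f z * partial b g z) + (LINT z|lebesgue. partial b f z * g z)"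
    using assms by (intro Bochner_Integration.integral_add L2_mult_integrable test_L2 test_partial)
  finally show ?thesis by simp
qed

text \<open>The fundamental lemma of the calculus of variations. The bounded function \<open>s\<close>, the sign of \<open>w\<close> cut off to a ball, is the
limit almost everywhere of test functions bounded by \<open>1\<close> and supported in a common ball. Testing
\<open>w\<close> against them shows that the integral of \<open>|w|\<close> over the ball vanishes. Only local
integrability of \<open>w\<close> is available, because weak derivatives are chosen in that class.\<close>

lemma weak_zero:
  fixes w :: "'a::euclidean_space \<Rightarrow> real"
  assumes w: "locally_integrable w" and z: "\<And>f. test_function f \<Longrightarrow> (LINT z|lebesgue. w z * f z) = 0"
  shows "AE z in lebesgue. w z = 0"
proof -
  have wm[measurable]: "w \<in> borel_measurable lebesgue" using locally_integrable_measurable[OF w] .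
  have "AE z in lebesgue. indicator (cball 0 (real n)) z * w z = 0" for n :: nat
  proof -
    define K where "K = cball (0::'a) (real n)"
    define s where "s = (\<lambda>z. indicat_real K z * sgn (w z))"
    have Km: "K \<in> sets lebesgue" by (simp add: K_def)
    have sm[measurable]: "s \<in> borel_measurable lebesgue" unfolding s_def using Km by measurable
    have s1: "\<bar>s z\<bar> \<le> 1" for z by (simp add: s_def indicator_def sgn_if)
    have Ki: "integrable lebesgue (indicat_real K)"
      using lmeasurable_iff_integrable[of K] by (simp add: K_def)
    have sL: "s \<in> L2_space lebesgue"
      by (rule L2_bound[OF sm Ki]) (auto simp: s_def indicator_def sgn_if)
    have "\<exists>f. mollifier (min 1 (inverse (Suc k))) f \<and> sq_dist lebesgue (conv s f) s \<le> inverse (Suc k)"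
      for k
    proof -
      obtain d where d: "d > 0" "\<And>f. mollifier d f \<Longrightarrow>
          conv s f \<in> L2_space lebesgue \<and> sq_dist lebesgue (conv s f) s \<le> inverse (Suc k)"
        using mollify[OF sL, of "inverse (Suc k)"] by auto
      have p: "min d (min 1 (inverse (Suc k))) > 0" using d by simp
      obtain f :: "'a \<Rightarrow> real" where f: "mollifier (min d (min 1 (inverse (Suc k)))) f"
        using mollifier_exists[OF p] .
      then have "mollifier d f" "mollifier (min 1 (inverse (Suc k))) f"
        by (auto simp: mollifier_def)
      with d show ?thesis by blast
    qed
    then obtain f where f: "\<And>k. mollifier (min 1 (inverse (Suc k))) (f k)"
      "\<And>k. sq_dist lebesgue (conv s (f k)) s \<le> inverse (Suc k)" by metis
    have ft: "test_function (f k)" "\<And>z. f k z \<ge> 0" "(LINT z|lborel. f k z) = 1" "\<And>z. norm z \<ge> 1 \<Longrightarrow> f k z = 0" for k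
      using f(1)[of k] unfolding mollifier_def by auto
    have zero: "conv s (f k) z = 0" if "norm z > real n + 1" for k z
    proof -
      have "s w * f k (z - w) = 0" for w
      proof (cases "norm w \<le> real n")
        case True
        then have "norm (z - w) \<ge> 1" using that norm_triangle_ineq2[of z w] by simp
        then show ?thesis using ft(4) by simp
      qed (simp add: s_def K_def)
      then show ?thesis unfolding conv_def by (simp only: Bochner_Integration.integral_zero)
    qed
    have ct: "test_function (conv s (f k))" for k
      unfolding test_function_iff using zero smooth_conv[OF L2_locally_integrable[OF sL] ft(1)] by blast
    have cb: "\<bar>conv s (f k) z\<bar> \<le> 1" for k z
    proof -
      have "\<bar>conv s (f k) z\<bar> \<le> (LINT w|lebesgue. \<bar>s w * f k (z - w)\<bar>)"
        unfolding conv_def by (rule integral_abs_bound)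
      also have "\<dots> \<le> (LINT w|lebesgue. f k (z - w))"
      proof (rule integral_mono)
        show "integrable lebesgue (\<lambda>w. \<bar>s w * f k (z - w)\<bar>)"
          using conv_integrable[OF L2_locally_integrable[OF sL] ft(1)] by (rule integrable_abs)
        show "integrable lebesgue (\<lambda>w. f k (z - w))"
          using conv_integrable[OF locally_integrable_const[of 1] ft(1)] by simp
        show "\<bar>s w * f k (z - w)\<bar> \<le> f k (z - w)" for w
          using mult_right_mono[OF s1 ft(2), of w k "z - w"] ft(2) by (simp add: abs_mult)
      qed
      also have "\<dots> = 1"
      proof -
        have m: "f k \<in> borel_measurable borel" using test_borel[OF ft(1)] .
        have "(LINT w|lebesgue. f k (z - w)) = (LINT w|lborel. f k (z - w))"
          by (rule integral_completion) (use borel_affine[OF m] in simp)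
        also have "\<dots> = (LINT w|distr lborel borel (\<lambda>w. z - w). f k w)"
          by (rule integral_distr[symmetric]) (use m in auto)
        finally show ?thesis by (simp add: lborel_reflect ft(3))
      qed
      finally show ?thesis .
    qed
    have L: "L2tends lebesgue (\<lambda>k. conv s (f k)) s"
      unfolding L2tends_def
    proof (intro conjI allI sL test_L2 ct)
      show "(\<lambda>k. sq_dist lebesgue (conv s (f k)) s) \<longlonglongrightarrow> 0"
        by (rule tendsto_0_nonneg_le[OF LIMSEQ_inverse_real_of_nat _ f(2)]) (auto intro: integral_nonneg_AE)
    qed
    obtain r where r: "strict_mono r" "AE z in lebesgue. (\<lambda>k. conv s (f (r k)) z) \<longlonglongrightarrow> s z"
      using L2tends_AE_subseq[OF L] .
    have lim: "(\<lambda>k. LINT z|lebesgue. w z * conv s (f (r k)) z) \<longlonglongrightarrow> (LINT z|lebesgue. w z * s z)"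
    proof (rule integral_dominated_convergence[where w = "\<lambda>z. \<bar>indicator (cball 0 (real n + 1)) z * w z\<bar>"])
      show "integrable lebesgue (\<lambda>z. \<bar>indicator (cball 0 (real n + 1)) z * w z\<bar>)"
        using w unfolding locally_integrable_def set_integrable_def by (intro integrable_abs) auto
      show "AE z in lebesgue. (\<lambda>k. w z * conv s (f (r k)) z) \<longlonglongrightarrow> w z * s z"
        using r(2) by eventually_elim (intro tendsto_intros)
      show "AE z in lebesgue. norm (w z * conv s (f (r k)) z) \<le> \<bar>indicator (cball 0 (real n + 1)) z * w z\<bar>" for k
      proof (rule AE_I2)
        fix z show "norm (w z * conv s (f (r k)) z) \<le> \<bar>indicator (cball 0 (real n + 1)) z * w z\<bar>"
          using mult_left_mono[OF cb[of "r k" z], of "\<bar>w z\<bar>"] zero[of z "r k"]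
          by (cases "norm z \<le> real n + 1") (auto simp: abs_mult)
      qed
      show "(\<lambda>z. w z * conv s (f (r k)) z) \<in> borel_measurable lebesgue" for k
        using L2_measurable[OF test_L2[OF ct]] by measurable
    qed measurable
    then have "(\<lambda>k::nat. 0) \<longlonglongrightarrow> (LINT z|lebesgue. w z * s z)" by (simp only: z[OF ct])
    then have "(LINT z|lebesgue. w z * s z) = 0" by (simp only: LIMSEQ_const_iff)
    moreover have ws: "w z * s z = \<bar>indicator K z * w z\<bar>" for z
      by (simp add: s_def indicator_def abs_sgn)
    moreover have "integrable lebesgue (\<lambda>z. \<bar>indicator K z * w z\<bar>)"
      using w unfolding locally_integrable_def set_integrable_def K_def by (intro integrable_abs) auto
    ultimately have "AE z in lebesgue. \<bar>indicator K z * w z\<bar> = 0"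
      using integral_nonneg_eq_0_iff_AE[of lebesgue "\<lambda>z. \<bar>indicator K z * w z\<bar>"] by simp
    then show ?thesis by (simp add: K_def)
  qed
  then have "AE z in lebesgue. \<forall>n::nat. indicator (cball 0 (real n)) z * w z = 0"
    unfolding AE_all_countable by blast
  then show ?thesis
  proof eventually_elim
    case (elim z)
    obtain N :: nat where "norm z \<le> real N" using real_arch_simple by blast
    then show ?case using elim[rule_format, of N] by simp
  qed
qed

lemma locally_integrable_diff:
  assumes "locally_integrable u" "locally_integrable v" shows "locally_integrable (\<lambda>z. u z - v z)"
  using assms unfolding locally_integrable_def by (auto intro: set_integral_diff(1))

lemma weak_deriv_unique:
  assumes "has_weak_deriv bs u v" "has_weak_deriv bs u v'"
  shows "AE z in lebesgue. v z = v' z"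
proof -
  have l: "locally_integrable v" "locally_integrable v'" using assms by (auto simp: has_weak_deriv_def)
  have "AE z in lebesgue. v z - v' z = 0"
  proof (rule weak_zero[OF locally_integrable_diff[OF l]])
    fix f :: "'a \<Rightarrow> real" assume f: "test_function f"
    have "(-1) ^ length bs * (LINT z|lebesgue. v z * f z) = (-1) ^ length bs * (LINT z|lebesgue. v' z * f z)"
      using assms f unfolding has_weak_deriv_def by metis
    then have "(LINT z|lebesgue. v z * f z) = (LINT z|lebesgue. v' z * f z)" by simp
    then show "(LINT z|lebesgue. (v z - v' z) * f z) = 0"
      using locally_integrable_test_mult[OF l(1) f] locally_integrable_test_mult[OF l(2) f]
      by (simp add: left_diff_distrib)
  qed
  then show ?thesis by eventually_elim simp
qed

lemma wderiv_works: "has_weak_deriv bs u v \<Longrightarrow> has_weak_deriv bs u (wderiv bs u)"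
  unfolding wderiv_def using someI_ex[of "has_weak_deriv bs u"] by blast

lemma wderiv_AE:
  assumes "has_weak_deriv bs u v" shows "AE z in lebesgue. wderiv bs u z = v z"
  using weak_deriv_unique[OF wderiv_works[OF assms] assms] .

lemma wderiv_measurable:
  assumes "has_weak_deriv bs u v" shows "wderiv bs u \<in> borel_measurable lebesgue"
  using wderiv_works[OF assms] locally_integrable_measurable by (auto simp: has_weak_deriv_def)

lemma L2_cong_AE:
  assumes "u \<in> L2_space M" "AE x in M. u x = v x" "v \<in> borel_measurable M"
  shows "v \<in> L2_space M"
proof -
  have "integrable M (\<lambda>x. (u x)\<^sup>2) \<longleftrightarrow> integrable M (\<lambda>x. (v x)\<^sup>2)"
  proof (rule integrable_cong_AE)
    show "AE x in M. (u x)\<^sup>2 = (v x)\<^sup>2" using assms(2) by eventually_elim simp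
  qed (use assms in \<open>auto intro: borel_measurable_power L2_measurable\<close>)
  then show ?thesis using assms by (simp add: L2_space_def)
qed

lemma sobolev_wderiv:
  assumes "u \<in> sobolev_H k" "set bs \<subseteq> Basis" "length bs \<le> k"
  shows "has_weak_deriv bs u (wderiv bs u)" "wderiv bs u \<in> L2_space lebesgue"
proof -
  obtain v where v: "v \<in> L2_space lebesgue" "has_weak_deriv bs u v"
    using assms unfolding sobolev_H_def by blast
  show "has_weak_deriv bs u (wderiv bs u)" using wderiv_works[OF v(2)] .
  have "AE z in lebesgue. v z = wderiv bs u z" using wderiv_AE[OF v(2)] by eventually_elim simp
  then show "wderiv bs u \<in> L2_space lebesgue"
    using L2_cong_AE[OF v(1) _ wderiv_measurable[OF v(2)]] by blast
qed

lemma has_weak_deriv_Nil: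
  assumes "locally_integrable u" shows "has_weak_deriv [] u u"
  using assms by (simp add: has_weak_deriv_def)

lemma limit_weak_deriv:
  assumes t: "\<And>k. test_function (X k)" and u: "L2tends lebesgue X u"
    and v: "L2tends lebesgue (\<lambda>k. partial b (X k)) v" and b: "b \<in> Basis"
  shows "has_weak_deriv [b] u v"
  unfolding has_weak_deriv_def
proof (intro conjI allI impI)
  show "locally_integrable u" "locally_integrable v"
    by (rule L2_locally_integrable[OF L2tends_D(2)[OF u]], rule L2_locally_integrable[OF L2tends_D(2)[OF v]])
  fix f :: "'a \<Rightarrow> real" assume f: "test_function f"
  have "(\<lambda>k. LINT z|lebesgue. X k z * partial b f z) \<longlonglongrightarrow> (LINT z|lebesgue. u z * partial b f z)"
    by (rule L2tends_integral_mult[OF u test_L2[OF test_partial[OF f b]]])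
  moreover have "(\<lambda>k. LINT z|lebesgue. partial b (X k) z * f z) \<longlonglongrightarrow> (LINT z|lebesgue. v z * f z)"
    by (rule L2tends_integral_mult[OF v test_L2[OF f]])
  then have "(\<lambda>k. LINT z|lebesgue. X k z * partial b f z) \<longlonglongrightarrow> - (LINT z|lebesgue. v z * f z)"
    unfolding integral_parts_test[OF t f b] by (rule tendsto_minus)
  ultimately have "(LINT z|lebesgue. u z * partial b f z) = - (LINT z|lebesgue. v z * f z)"
    by (rule LIMSEQ_unique)
  then show "(LINT z|lebesgue. u z * partials [b] f z) = (-1) ^ length [b] * (LINT z|lebesgue. v z * f z)"
    by simp
qed

text \<open>The gateway to \<open>H\<^sup>1\<close>: mean square convergence of test functions and of their first derivatives
identifies the limit, its weak derivatives, and an approximating sequence for the trace at once.\<close>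

lemma limit_H1:
  assumes t: "\<And>k. test_function (X k)" and u: "L2tends lebesgue X u"
    and v: "\<And>b. b \<in> Basis \<Longrightarrow> L2tends lebesgue (\<lambda>k. partial b (X k)) (v b)"
  shows "u \<in> sobolev_H 1" "tends_in_H1 X u" "\<And>b. b \<in> Basis \<Longrightarrow> AE z in lebesgue. wderiv [b] u z = v b z"
proof -
  have w: "has_weak_deriv [b] u (v b)" if "b \<in> Basis" for b
    using limit_weak_deriv[OF t u v[OF that] that] .
  show ae: "AE z in lebesgue. wderiv [b] u z = v b z" if "b \<in> Basis" for b
    using wderiv_AE[OF w[OF that]] .
  show "u \<in> sobolev_H 1"
    unfolding sobolev_H_def
  proof (intro CollectI conjI allI impI)
    show uL: "u \<in> L2_space lebesgue" using u by (simp add: L2tends_def)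
    fix bs :: "'a list" assume bs: "set bs \<subseteq> Basis \<and> length bs \<le> 1"
    show "\<exists>v\<in>L2_space lebesgue. has_weak_deriv bs u v"
    proof (cases bs)
      case Nil then show ?thesis using uL has_weak_deriv_Nil L2_locally_integrable by blast
    next
      case (Cons b cs)
      then have "bs = [b]" "b \<in> Basis" using bs by auto
      then show ?thesis using w L2tends_D(2)[OF v] by blast
    qed
  qed
  have "(\<lambda>k. sq_dist lebesgue (partial b (X k)) (wderiv [b] u)) \<longlonglongrightarrow> 0" if b: "b \<in> Basis" for b
  proof -
    have "AE z in lebesgue. v b z = wderiv [b] u z" using ae[OF b] by eventually_elim simp
    then have "L2tends lebesgue (\<lambda>k. partial b (X k)) (wderiv [b] u)"
      by (intro L2tends_cong_AE[OF v[OF b]] wderiv_measurable[OF w[OF b]])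
         (auto intro!: L2_measurable test_L2 test_partial t b)
    then show ?thesis by (rule L2tends_D)
  qed
  then show "tends_in_H1 X u"
    unfolding tends_in_H1_def using L2tends_D(3)[OF u] by (simp add: L2_norm_tendsto_iff)
qed

section \<open>Density of test functions in Sobolev spaces\<close>

lemma L2tends_null_scale:
  assumes "L2tends M s l" "c \<longlonglongrightarrow> 0"
  shows "L2tends M (\<lambda>n x. c n * s n x) (\<lambda>x. 0)"
proof -
  note D = L2tends_D[OF assms(1)]
  have b: "(LINT x|M. (c n * s n x - 0)\<^sup>2) \<le> (c n)\<^sup>2 * (2 * sq_dist M (s n) l + 2 * sq_norm M l)" for n
  proof -
    have "(LINT x|M. (c n * s n x - 0)\<^sup>2) = (c n)\<^sup>2 * sq_norm M (s n)" by (simp add: power_mult_distrib)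
    also have "\<dots> \<le> (c n)\<^sup>2 * (2 * sq_dist M (s n) l + 2 * sq_norm M l)"
      using L2_add(2)[OF L2_diff(1)[OF D(1,2)] D(2), of n] by (intro mult_left_mono) auto
    finally show ?thesis .
  qed
  have "(\<lambda>n. (c n)\<^sup>2 * (2 * sq_dist M (s n) l + 2 * sq_norm M l)) \<longlonglongrightarrow> 0\<^sup>2 * (2 * 0 + 2 * sq_norm M l)"
    by (intro tendsto_intros assms D(3))
  then have "(\<lambda>n. (c n)\<^sup>2 * (2 * sq_dist M (s n) l + 2 * sq_norm M l)) \<longlonglongrightarrow> 0" by simp
  from tendsto_0_nonneg_le[OF this _ b] have "(\<lambda>n. LINT x|M. (c n * s n x - 0)\<^sup>2) \<longlonglongrightarrow> 0"
    by (auto intro: integral_nonneg_AE)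
  then show ?thesis using D by (auto simp: L2tends_def L2_scale) (auto simp: L2_space_def)
qed

text \<open>Dilating a fixed test function with value \<open>1\<close> at the origin produces the cutoff functions; each derivative gains a
factor \<open>1 / (n + 1)\<close>.\<close>

definition dilate :: "('a::euclidean_space \<Rightarrow> real) \<Rightarrow> nat \<Rightarrow> 'a \<Rightarrow> real" where
  "dilate f n z = f ((1 / real (Suc n)) *\<^sub>R z)"

lemma partial_dilate:
  assumes "smooth f" shows "partial b (dilate f n) = (\<lambda>z. (1 / real (Suc n)) * dilate (partial b f) n z)"
  using partial_affine[OF assms, of b 0 "1 / real (Suc n)"] by (simp only: dilate_def[abs_def] add_0)

lemma smooth_dilate: "smooth f \<Longrightarrow> smooth (dilate f n)"
  using smooth_affine[of f 0 "1 / real (Suc n)"] by (simp only: dilate_def[abs_def] add_0)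

lemma test_dilate: "test_function f \<Longrightarrow> test_function (dilate f n)"
  using test_affine[of f "1 / real (Suc n)" 0] by (simp only: dilate_def[abs_def] add_0) simp

lemma partials_add:
  assumes "smooth f" "smooth g" "set bs \<subseteq> Basis"
  shows "partials bs (\<lambda>z. f z + g z) = (\<lambda>z. partials bs f z + partials bs g z)"
  using assms(3)
proof (induction bs)
  case (Cons b bs)
  then have "smooth (partials bs f)" "smooth (partials bs g)" using assms by (auto intro: smooth_partials)
  moreover have "partials bs (\<lambda>z. f z + g z) = (\<lambda>z. partials bs f z + partials bs g z)"
    using Cons by simp
  ultimately show ?case unfolding partials_Cons by (simp only:) (simp add: fun_eq_iff partial_add smooth_differentiable)
qed simp

lemma partials_scale:
  assumes "smooth f" "set bs \<subseteq> Basis"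
  shows "partials bs (\<lambda>z. c * f z) = (\<lambda>z. c * partials bs f z)"
  using assms(2)
proof (induction bs)
  case (Cons b bs)
  then have "smooth (partials bs f)" using assms by (auto intro: smooth_partials)
  moreover have "partials bs (\<lambda>z. c * f z) = (\<lambda>z. c * partials bs f z)"
    using Cons by simp
  ultimately show ?case unfolding partials_Cons by (simp only:) (simp add: fun_eq_iff partial_cmult smooth_differentiable)
qed simp

lemma dilate_L2tends:
  assumes f: "test_function f" and g: "g \<in> L2_space lebesgue"
  shows "L2tends lebesgue (\<lambda>n z. dilate f n z * g z) (\<lambda>z. f 0 * g z)"
proof -
  obtain B where B: "\<And>z. \<bar>f z\<bar> \<le> B" using test_bounded[OF f] by metis
  have gm[measurable]: "g \<in> borel_measurable lebesgue" using g by (rule L2_measurable)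
  have dm[measurable]: "dilate f n \<in> borel_measurable lebesgue" for n
    using test_borel[OF test_dilate[OF f]] by (simp add: measurable_completion)
  have b: "(c * g z)\<^sup>2 \<le> B\<^sup>2 * (g z)\<^sup>2" if "\<bar>c\<bar> \<le> B" for c z
    unfolding power_mult_distrib using that by (intro mult_right_mono) (auto simp: abs_le_square_iff[symmetric])
  have gi: "integrable lebesgue (\<lambda>z. B\<^sup>2 * (g z)\<^sup>2)" "integrable lebesgue (\<lambda>z. 4 * B\<^sup>2 * (g z)\<^sup>2)"
    using g by (simp_all add: L2_integrable_sq)
  have 1: "(\<lambda>z. dilate f n z * g z) \<in> L2_space lebesgue" for n
  proof (rule L2_bound[OF _ gi(1)])
    show "(dilate f n z * g z)\<^sup>2 \<le> B\<^sup>2 * (g z)\<^sup>2" for z using B by (intro b) (simp add: dilate_def)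
  qed measurable
  have "(\<lambda>n. LINT z|lebesgue. (dilate f n z * g z - f 0 * g z)\<^sup>2) \<longlonglongrightarrow> (LINT z::'a|lebesgue. 0)"
  proof (rule integral_dominated_convergence[OF _ _ gi(2)])
    show "AE z in lebesgue. (\<lambda>n. (dilate f n z * g z - f 0 * g z)\<^sup>2) \<longlonglongrightarrow> 0"
    proof (rule AE_I2)
      fix z :: 'a
      have "(\<lambda>n. (1 / real (Suc n)) *\<^sub>R z) \<longlonglongrightarrow> 0 *\<^sub>R z"
        unfolding inverse_eq_divide[symmetric] by (rule tendsto_scaleR[OF LIMSEQ_inverse_real_of_nat tendsto_const])
      moreover have "isCont f 0" using smooth_differentiable[OF test_smooth[OF f]] differentiable_imp_continuous_within by blast
      ultimately have "(\<lambda>n. dilate f n z) \<longlonglongrightarrow> f 0"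
        unfolding dilate_def using isCont_tendsto_compose by fastforce
      then have "(\<lambda>n. (dilate f n z * g z - f 0 * g z)\<^sup>2) \<longlonglongrightarrow> (f 0 * g z - f 0 * g z)\<^sup>2" by (intro tendsto_intros)
      then show "(\<lambda>n. (dilate f n z * g z - f 0 * g z)\<^sup>2) \<longlonglongrightarrow> 0" by simp
    qed
    show "AE z in lebesgue. norm ((dilate f n z * g z - f 0 * g z)\<^sup>2) \<le> 4 * B\<^sup>2 * (g z)\<^sup>2" for n
    proof (rule AE_I2)
      fix z
      have "(dilate f n z * g z - f 0 * g z)\<^sup>2 \<le> 2 * (dilate f n z * g z)\<^sup>2 + 2 * (f 0 * g z)\<^sup>2"
        using sq_add_le[of "dilate f n z * g z" "- (f 0 * g z)"] by simp
      then show "norm ((dilate f n z * g z - f 0 * g z)\<^sup>2) \<le> 4 * B\<^sup>2 * (g z)\<^sup>2"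
        using b[of "dilate f n z" z] b[of "f 0" z] B by (simp add: dilate_def)
    qed
  qed auto
  then show ?thesis using 1 L2_scale[OF g] by (simp add: L2tends_def)
qed

text \<open>By induction, removing the innermost derivative: the product rule yields the same claim for the
derivative of \<open>g\<close>, and a term with the derivative of \<open>f\<close>, which converges by the induction hypothesis
and carries the factor \<open>1 / (n + 1)\<close>.\<close>

lemma cutoff_L2tends:
  assumes "smooth g" "test_function f" "set bs \<subseteq> Basis"
    "\<And>cs. set cs \<subseteq> Basis \<Longrightarrow> length cs \<le> length bs \<Longrightarrow> partials cs g \<in> L2_space lebesgue"
  shows "L2tends lebesgue (\<lambda>n. partials bs (\<lambda>z. dilate f n z * g z)) (\<lambda>z. f 0 * partials bs g z)"
  using assms
proof (induction bs arbitrary: f g rule: rev_induct)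
  case Nil
  then have "g \<in> L2_space lebesgue" using Nil(4)[of "[]"] by simp
  then show ?case using dilate_L2tends[OF Nil(2)] by simp
next
  case (snoc b bs)
  have b: "b \<in> Basis" "set bs \<subseteq> Basis" using snoc.prems by auto
  have sf: "smooth f" using snoc.prems(2) test_smooth by blast
  have g': "smooth (partial b g)" using smooth_partial[OF snoc.prems(1) b(1)] .
  have p: "partials (bs @ [b]) (\<lambda>z. dilate f n z * g z) =
     (\<lambda>z. partials bs (\<lambda>z. dilate f n z * partial b g z) z + (1 / real (Suc n)) * partials bs (\<lambda>z. dilate (partial b f) n z * g z) z)" for n
  proof -
    have "partial b (\<lambda>z. dilate f n z * g z) = (\<lambda>z. dilate f n z * partial b g z + (1 / real (Suc n)) * (dilate (partial b f) n z * g z))"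
      using snoc.prems(1) sf
      by (simp add: fun_eq_iff partial_mult smooth_differentiable smooth_dilate partial_dilate)
    moreover have s: "smooth (\<lambda>z. dilate f n z * partial b g z)" "smooth (\<lambda>z. dilate (partial b f) n z * g z)"
      by (rule smooth_mult[OF smooth_dilate[OF sf] g'], rule smooth_mult[OF smooth_dilate[OF smooth_partial[OF sf b(1)]] snoc.prems(1)])
    ultimately show ?thesis
      using partials_add[OF s(1) smooth_mult[OF smooth_const s(2)] b(2)] partials_scale[OF s(2) b(2)]
      by (simp only: partials_append partials.simps(1) partials_Cons)
  qed
  have 1: "L2tends lebesgue (\<lambda>n. partials bs (\<lambda>z. dilate f n z * partial b g z)) (\<lambda>z. f 0 * partials bs (partial b g) z)"
  proof (rule snoc.IH[OF g' snoc.prems(2) b(2)])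
    fix cs :: "'a list" assume "set cs \<subseteq> Basis" "length cs \<le> length bs"
    then show "partials cs (partial b g) \<in> L2_space lebesgue"
      using snoc.prems(4)[of "cs @ [b]"] b by (simp add: partials_append)
  qed
  have "L2tends lebesgue (\<lambda>n. partials bs (\<lambda>z. dilate (partial b f) n z * g z)) (\<lambda>z. partial b f 0 * partials bs g z)"
    by (rule snoc.IH[OF snoc.prems(1) test_partial[OF snoc.prems(2) b(1)] b(2)]) (use snoc.prems(4) in auto)
  from L2tends_null_scale[OF this, of "\<lambda>n. 1 / real (Suc n)"]
  have "L2tends lebesgue (\<lambda>n z. (1 / real (Suc n)) * partials bs (\<lambda>z. dilate (partial b f) n z * g z) z) (\<lambda>z. 0)"
    using LIMSEQ_inverse_real_of_nat by (simp add: inverse_eq_divide)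
  from L2tends_add[OF 1 this] show ?case unfolding p by (simp add: partials_append)
qed

text \<open>A mollification of \<open>u\<close> is smooth with derivatives close to the weak derivatives of \<open>u\<close>. A cutoff then makes
the support compact at the price of another small error. There are only finitely many
derivatives up to the given order, so one mollifier and one cutoff serve all of them.\<close>

lemma sobolev_dense:
  fixes u :: "'a::euclidean_space \<Rightarrow> real"
  assumes u: "u \<in> sobolev_H K"
  obtains \<psi> where "\<And>n. test_function (\<psi> n)"
    "\<And>bs. set bs \<subseteq> Basis \<Longrightarrow> length bs \<le> K \<Longrightarrow> L2tends lebesgue (\<lambda>n. partials bs (\<psi> n)) (wderiv bs u)"
proof -
  define S where "S = {bs. set bs \<subseteq> (Basis :: 'a set) \<and> length bs \<le> K}"
  have S: "finite S" unfolding S_def using finite_lists_length_le[OF finite_Basis] .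
  have uL: "locally_integrable u" using u L2_locally_integrable by (auto simp: sobolev_H_def)
  have w: "has_weak_deriv bs u (wderiv bs u)" "wderiv bs u \<in> L2_space lebesgue" if "bs \<in> S" for bs
    using sobolev_wderiv[OF u] that by (auto simp: S_def)
  obtain f0 :: "'a \<Rightarrow> real" where f0: "test_function f0" "f0 0 > 0"
  proof -
    obtain f :: "'a \<Rightarrow> real" where f: "test_function f" "\<And>z. f z > 0 \<longleftrightarrow> norm z < 1"
      using bump_exists[of 1, where ?'a='a] by (metis zero_less_one)
    then have "f 0 > 0" by simp
    with f that show ?thesis by blast
  qed
  define h where "h = (\<lambda>z. (1 / f0 0) * f0 z)"
  have h: "test_function h" "h 0 = 1"
    unfolding h_def by (rule test_scale[OF f0(1)], use f0(2) in simp)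
  have "\<exists>g. test_function g \<and> (\<forall>bs\<in>S. sq_dist lebesgue (partials bs g) (wderiv bs u) \<le> e)" if e: "e > 0" for e
  proof -
    have e4: "e / 4 > 0" using e by simp
    have "\<exists>d>0. \<forall>f. mollifier d f \<longrightarrow> conv (wderiv bs u) f \<in> L2_space lebesgue \<and>
        (sq_dist lebesgue (conv (wderiv bs u) f) (wderiv bs u)) \<le> e / 4" if "bs \<in> S" for bs
      using mollify[OF w(2)[OF that] e4] by blast
    then obtain d where d: "\<And>bs. bs \<in> S \<Longrightarrow> d bs > 0"
      "\<And>bs f. bs \<in> S \<Longrightarrow> mollifier (d bs) f \<Longrightarrow> conv (wderiv bs u) f \<in> L2_space lebesgue \<and>
        (sq_dist lebesgue (conv (wderiv bs u) f) (wderiv bs u)) \<le> e / 4" by metis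
    define d0 where "d0 = Min (insert 1 (d ` S))"
    have d0: "d0 > 0" "\<And>bs. bs \<in> S \<Longrightarrow> d0 \<le> d bs" using S d(1) by (auto simp: d0_def)
    obtain f :: "'a \<Rightarrow> real" where f: "mollifier d0 f" using mollifier_exists[OF d0(1)] .
    have f': "mollifier (d bs) f" if "bs \<in> S" for bs
      using f d0(2)[OF that] unfolding mollifier_def by auto
    have ft: "test_function f" using f by (simp add: mollifier_def)
    define v where "v = conv u f"
    have sv: "smooth v" unfolding v_def by (rule smooth_conv[OF uL ft])
    have pv: "partials bs v = conv (wderiv bs u) f" if "bs \<in> S" for bs
      unfolding v_def by (rule conv_weak_deriv[OF w(1)[OF that] ft]) (use that in \<open>auto simp: S_def\<close>)
    have vL: "partials bs v \<in> L2_space lebesgue" if "bs \<in> S" for bs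
      using d(2)[OF that f'[OF that]] pv[OF that] by simp
    have "\<forall>bs\<in>S. eventually (\<lambda>n. (LINT z|lebesgue. (partials bs (\<lambda>z. dilate h n z * v z) z - partials bs v z)\<^sup>2) < e / 4) sequentially"
    proof
      fix bs assume bs: "bs \<in> S"
      have "L2tends lebesgue (\<lambda>n. partials bs (\<lambda>z. dilate h n z * v z)) (\<lambda>z. h 0 * partials bs v z)"
        by (rule cutoff_L2tends[OF sv h(1)]) (use bs vL in \<open>auto simp: S_def\<close>)
      then have "(\<lambda>n. LINT z|lebesgue. (partials bs (\<lambda>z. dilate h n z * v z) z - partials bs v z)\<^sup>2) \<longlonglongrightarrow> 0"
        using L2tends_D(3) h(2) by fastforce
      then show "eventually (\<lambda>n. (LINT z|lebesgue. (partials bs (\<lambda>z. dilate h n z * v z) z - partials bs v z)\<^sup>2) < e / 4) sequentially"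
        using e4 by (rule order_tendstoD(2))
    qed
    then have "eventually (\<lambda>n. \<forall>bs\<in>S. (LINT z|lebesgue. (partials bs (\<lambda>z. dilate h n z * v z) z - partials bs v z)\<^sup>2) < e / 4) sequentially"
      using S by (simp add: eventually_ball_finite_distrib)
    from eventually_happens'[OF sequentially_bot this]
    obtain n where n: "\<And>bs. bs \<in> S \<Longrightarrow> (LINT z|lebesgue. (partials bs (\<lambda>z. dilate h n z * v z) z - partials bs v z)\<^sup>2) < e / 4"
      by blast
    show ?thesis
    proof (intro exI[of _ "\<lambda>z. dilate h n z * v z"] conjI ballI)
      show t: "test_function (\<lambda>z. dilate h n z * v z)" by (rule test_mult_right[OF test_dilate[OF h(1)] sv])
      fix bs assume bs: "bs \<in> S"
      have "partials bs (\<lambda>z. dilate h n z * v z) \<in> L2_space lebesgue"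
        using test_L2 test_partials[OF t] bs by (auto simp: S_def)
      from L2_dist_triangle[OF this vL[OF bs] w(2)[OF bs]]
      show "(LINT z|lebesgue. (partials bs (\<lambda>z. dilate h n z * v z) z - wderiv bs u z)\<^sup>2) \<le> e"
        using n[OF bs] d(2)[OF bs f'[OF bs]] pv[OF bs] by simp
    qed
  qed
  then have "\<exists>g. test_function g \<and> (\<forall>bs\<in>S. sq_dist lebesgue (partials bs g) (wderiv bs u) \<le> inverse (Suc n))" for n
    by simp
  then obtain \<psi> where \<psi>: "\<And>n. test_function (\<psi> n)"
    "\<And>n bs. bs \<in> S \<Longrightarrow> sq_dist lebesgue (partials bs (\<psi> n)) (wderiv bs u) \<le> inverse (Suc n)" by metis
  show ?thesis
  proof (rule that[OF \<psi>(1)])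
    fix bs :: "'a list" assume "set bs \<subseteq> Basis" "length bs \<le> K"
    then have bs: "bs \<in> S" "set bs \<subseteq> Basis" by (auto simp: S_def)
    have "(\<lambda>n. sq_dist lebesgue (partials bs (\<psi> n)) (wderiv bs u)) \<longlonglongrightarrow> 0"
      by (rule tendsto_0_nonneg_le[OF LIMSEQ_inverse_real_of_nat _ \<psi>(2)[OF bs(1)]]) (auto intro: integral_nonneg_AE)
    then show "L2tends lebesgue (\<lambda>n. partials bs (\<psi> n)) (wderiv bs u)"
      using test_L2 test_partials[OF \<psi>(1) bs(2)] w(2)[OF bs(1)] by (auto simp: L2tends_def)
  qed
qed

section \<open>Mixed partial derivatives in the plane\<close>

text \<open>Two applications of the mean value theorem to the second difference over a square. Exchanging the
variables does not change the difference, which yields the symmetry of mixed derivatives.\<close>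

lemma mixed_difference:
  fixes F F1 F12 :: "real \<Rightarrow> real \<Rightarrow> real"
  assumes "\<And>s t. ((\<lambda>s. F s t) has_real_derivative F1 s t) (at s)"
    and "\<And>s t. (F1 s has_real_derivative F12 s t) (at t)" and "h > 0"
  obtains \<xi> \<zeta> where "x \<le> \<xi>" "\<xi> \<le> x + h" "y \<le> \<zeta>" "\<zeta> \<le> y + h"
    "F (x + h) (y + h) - F (x + h) y - F x (y + h) + F x y = h * h * F12 \<xi> \<zeta>"
proof -
  have d: "((\<lambda>s. F s (y + h) - F s y) has_real_derivative F1 s (y + h) - F1 s y) (at s)" for s
    by (intro DERIV_diff assms(1))
  obtain \<xi> where \<xi>: "\<xi> > x" "\<xi> < x + h"
    "(F (x + h) (y + h) - F (x + h) y) - (F x (y + h) - F x y) = (x + h - x) * (F1 \<xi> (y + h) - F1 \<xi> y)"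
    using MVT2[of x "x + h" "\<lambda>s. F s (y + h) - F s y" "\<lambda>s. F1 s (y + h) - F1 s y"] d assms(3) by auto
  obtain \<zeta> where \<zeta>: "\<zeta> > y" "\<zeta> < y + h" "F1 \<xi> (y + h) - F1 \<xi> y = (y + h - y) * F12 \<xi> \<zeta>"
    using MVT2[of y "y + h" "F1 \<xi>" "F12 \<xi>"] assms(2,3) by auto
  show ?thesis by (rule that[of \<xi> \<zeta>]) (use \<xi> \<zeta> in auto)
qed

lemma DERIV_line:
  fixes f :: "'a::euclidean_space \<Rightarrow> real"
  assumes "smooth f" "b \<in> Basis"
  shows "((\<lambda>t. f (p + t *\<^sub>R b)) has_real_derivative partial b f (p + t *\<^sub>R b)) (at t)"
proof -
  have D: "(f has_derivative (\<lambda>h. \<Sum>c\<in>Basis. (h \<bullet> c) * partial c f (p + t *\<^sub>R b))) (at (p + t *\<^sub>R b))"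
    by (rule has_derivative_partial[OF smooth_differentiable[OF assms(1)]])
  have "((\<lambda>t. p + t *\<^sub>R b) has_derivative (\<lambda>h. h *\<^sub>R b)) (at t)"
    by (auto intro!: derivative_eq_intros)
  from has_derivative_compose[OF this D] show ?thesis
    by (simp add: has_field_derivative_def mult.assoc sum_distrib_left[symmetric]
        sum_Basis_delta[OF assms(2)] mult_commute_abs)
qed

lemma Basis_plane: "(1, 0) \<in> (Basis :: (real \<times> real) set)" "(0, 1) \<in> (Basis :: (real \<times> real) set)"
  by (auto simp: Basis_prod_def)

lemma Basis_plane_eq: "(Basis :: (real \<times> real) set) = {(1, 0), (0, 1)}"
  by (auto simp: Basis_prod_def)

lemma DERIV_line_x: "smooth f \<Longrightarrow> ((\<lambda>s. f (s, t)) has_real_derivative partial (1, 0) f (s, t)) (at s)"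
  and DERIV_line_y: "smooth f \<Longrightarrow> ((\<lambda>t. f (s, t)) has_real_derivative partial (0, 1) f (s, t)) (at t)"
  for f :: "real \<times> real \<Rightarrow> real"
  using DERIV_line[of f "(1, 0)" "(0, t)" s] DERIV_line[of f "(0, 1)" "(s, 0)" t] by (simp_all add: Basis_plane)

lemma partial_commute:
  assumes f: "smooth (f :: real \<times> real \<Rightarrow> real)"
  shows "partial (0, 1) (partial (1, 0) f) = partial (1, 0) (partial (0, 1) f)"
proof
  fix z :: "real \<times> real"
  obtain x y where z: "z = (x, y)" by (cases z)
  have s: "smooth (partial (1, 0) f)" "smooth (partial (0, 1) f)" using f smooth_partial Basis_plane by blast+
  define r where "r = (\<lambda>n. inverse (real (Suc n)))"
  have r: "r n > 0" "r \<longlonglongrightarrow> 0" for n using LIMSEQ_inverse_real_of_nat by (auto simp: r_def)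
  have "\<exists>p q. x \<le> fst p \<and> fst p \<le> x + r n \<and> y \<le> snd p \<and> snd p \<le> y + r n \<and>
      x \<le> fst q \<and> fst q \<le> x + r n \<and> y \<le> snd q \<and> snd q \<le> y + r n \<and>
      partial (0, 1) (partial (1, 0) f) p = partial (1, 0) (partial (0, 1) f) q" for n
  proof -
    obtain a b where 1: "x \<le> a" "a \<le> x + r n" "y \<le> b" "b \<le> y + r n"
      "f (x + r n, y + r n) - f (x + r n, y) - f (x, y + r n) + f (x, y) = r n * r n * partial (0, 1) (partial (1, 0) f) (a, b)"
      by (rule mixed_difference[where F = "\<lambda>s t. f (s, t)" and ?F1.0 = "\<lambda>s t. partial (1, 0) f (s, t)" and
            ?F12.0 = "\<lambda>s t. partial (0, 1) (partial (1, 0) f) (s, t)" and h = "r n" and x = x and y = y])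
         (use DERIV_line_x[OF f] DERIV_line_y[OF s(1)] r in auto)
    obtain c d where 2: "y \<le> c" "c \<le> y + r n" "x \<le> d" "d \<le> x + r n"
      "f (x + r n, y + r n) - f (x, y + r n) - f (x + r n, y) + f (x, y) = r n * r n * partial (1, 0) (partial (0, 1) f) (d, c)"
      by (rule mixed_difference[where F = "\<lambda>s t. f (t, s)" and ?F1.0 = "\<lambda>s t. partial (0, 1) f (t, s)" and
            ?F12.0 = "\<lambda>s t. partial (1, 0) (partial (0, 1) f) (t, s)" and h = "r n" and x = y and y = x])
         (use DERIV_line_y[OF f] DERIV_line_x[OF s(2)] r in auto)
    have "r n * r n * partial (0, 1) (partial (1, 0) f) (a, b) = r n * r n * partial (1, 0) (partial (0, 1) f) (d, c)"
      using 1(5) 2(5) by linarith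
    then have "partial (0, 1) (partial (1, 0) f) (a, b) = partial (1, 0) (partial (0, 1) f) (d, c)" using r(1)[of n] by simp
    with 1 2 show ?thesis by (intro exI[of _ "(a, b)"] exI[of _ "(d, c)"]) auto
  qed
  then obtain p q where pq: "\<And>n. x \<le> fst (p n) \<and> fst (p n) \<le> x + r n \<and> y \<le> snd (p n) \<and> snd (p n) \<le> y + r n"
      "\<And>n. x \<le> fst (q n) \<and> fst (q n) \<le> x + r n \<and> y \<le> snd (q n) \<and> snd (q n) \<le> y + r n"
      "\<And>n. partial (0, 1) (partial (1, 0) f) (p n) = partial (1, 0) (partial (0, 1) f) (q n)" by metis
  have sq: "(\<lambda>n. c + r n) \<longlonglongrightarrow> c" for c using tendsto_add[OF tendsto_const r(2), of c] by simp
  have lim: "w \<longlonglongrightarrow> z" if "\<And>n. x \<le> fst (w n) \<and> fst (w n) \<le> x + r n \<and> y \<le> snd (w n) \<and> snd (w n) \<le> y + r n" for w :: "nat \<Rightarrow> real \<times> real"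
  proof -
    have "(\<lambda>n. fst (w n)) \<longlonglongrightarrow> x" by (rule tendsto_sandwich[OF _ _ tendsto_const sq]) (use that in auto)
    moreover have "(\<lambda>n. snd (w n)) \<longlonglongrightarrow> y" by (rule tendsto_sandwich[OF _ _ tendsto_const sq]) (use that in auto)
    ultimately show ?thesis using tendsto_Pair unfolding z by fastforce
  qed
  have c: "(\<lambda>n. g (w n)) \<longlonglongrightarrow> g z" if "smooth g" "w \<longlonglongrightarrow> z" for g :: "real \<times> real \<Rightarrow> real" and w
    by (rule isCont_tendsto_compose[OF differentiable_imp_continuous_within[OF smooth_differentiable[OF that(1)]] that(2)])
  have "(\<lambda>n. partial (0, 1) (partial (1, 0) f) (p n)) \<longlonglongrightarrow> partial (0, 1) (partial (1, 0) f) z"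
    by (intro c lim smooth_partial s Basis_plane pq(1))
  moreover have "(\<lambda>n. partial (0, 1) (partial (1, 0) f) (p n)) \<longlonglongrightarrow> partial (1, 0) (partial (0, 1) f) z"
    unfolding pq(3) by (intro c lim smooth_partial s Basis_plane pq(2))
  ultimately show "partial (0, 1) (partial (1, 0) f) z = partial (1, 0) (partial (0, 1) f) z" by (rule LIMSEQ_unique)
qed

section \<open>Energy estimates for plane test functions\<close>

text \<open>The integral of \<open>2 f f'\<close> from outside the support up to \<open>y\<close> is \<open>(f y)\<^sup>2\<close>, and \<open>2 f f' \<le> f\<^sup>2 + f'\<^sup>2\<close>.\<close>

lemma line_bound:
  fixes f f' :: "real \<Rightarrow> real"
  assumes d: "\<And>t. (f has_real_derivative f' t) (at t)" and c: "continuous_on UNIV f'"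
    and R: "\<And>t. \<bar>t\<bar> > R \<Longrightarrow> f t = 0" "\<And>t. \<bar>t\<bar> > R \<Longrightarrow> f' t = 0"
  shows "ennreal ((f y)\<^sup>2) \<le> (\<integral>\<^sup>+t. ennreal ((f t)\<^sup>2 + (f' t)\<^sup>2) \<partial>lborel)"
proof -
  have cf: "continuous_on UNIV f" using d by (meson DERIV_isCont continuous_at_imp_continuous_on)
  define M where "M = - \<bar>y\<bar> - \<bar>R\<bar> - 1"
  have M: "M \<le> y" "\<bar>M\<bar> > R" by (auto simp: M_def)
  have ftc: "(LINT t|lborel. (2 * f t * f' t) * indicator {M..y} t) = (f y)\<^sup>2 - (f M)\<^sup>2"
  proof (rule integral_FTC_Icc_real[OF M(1)])
    show "((\<lambda>t. (f t)\<^sup>2) has_real_derivative 2 * f x * f' x) (at x)" for x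
      using d[of x] by (auto intro!: derivative_eq_intros)
    show "isCont (\<lambda>t. 2 * f t * f' t) x" for x
      using c cf by (intro continuous_intros) (auto simp: continuous_on_eq_continuous_at)
  qed
  have gc: "continuous_on UNIV (\<lambda>t. (f t)\<^sup>2 + (f' t)\<^sup>2)" by (intro continuous_intros c cf)
  have gi: "integrable lborel (\<lambda>t. (f t)\<^sup>2 + (f' t)\<^sup>2)"
  proof -
    have "integrable lborel (\<lambda>t. indicator {-R..R} t *\<^sub>R ((f t)\<^sup>2 + (f' t)\<^sup>2))"
      by (intro borel_integrable_compact continuous_on_subset[OF gc]) auto
    moreover have "indicator {-R..R} t *\<^sub>R ((f t)\<^sup>2 + (f' t)\<^sup>2) = (f t)\<^sup>2 + (f' t)\<^sup>2" for t
      using R[of t] by (cases "t \<in> {-R..R}") auto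
    ultimately show ?thesis by (simp only:)
  qed
  have pt: "(2 * f t * f' t) * indicator {M..y} t \<le> (f t)\<^sup>2 + (f' t)\<^sup>2" for t
    using zero_le_power2[of "f t - f' t"] by (cases "t \<in> {M..y}") (auto simp: power2_diff)
  have "(f y)\<^sup>2 = (LINT t|lborel. (2 * f t * f' t) * indicator {M..y} t)"
    unfolding ftc using R(1)[OF M(2)] by simp
  also have "\<dots> \<le> (LINT t|lborel. (f t)\<^sup>2 + (f' t)\<^sup>2)"
  proof (rule integral_mono[OF _ gi pt])
    have "integrable lborel (\<lambda>t. indicator {M..y} t *\<^sub>R (2 * f t * f' t))"
      by (intro borel_integrable_compact continuous_intros continuous_on_subset[OF c] continuous_on_subset[OF cf]) auto
    then show "integrable lborel (\<lambda>t. (2 * f t * f' t) * indicator {M..y} t)" by (simp add: mult.commute)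
  qed
  finally show ?thesis
    using nn_integral_eq_integral[OF gi] by (simp add: ennreal_leI)
qed

definition line_energy :: "'a::euclidean_space \<Rightarrow> ('a \<Rightarrow> real) \<Rightarrow> 'a \<Rightarrow> ennreal" where
  "line_energy b f z = ennreal ((f z)\<^sup>2 + (partial b f z)\<^sup>2)"

lemma sup_line:
  assumes f: "test_function f" and b: "b \<in> Basis"
  shows "ennreal ((f (p + y *\<^sub>R b))\<^sup>2) \<le> (\<integral>\<^sup>+t. line_energy b f (p + t *\<^sub>R b) \<partial>lborel)"
  unfolding line_energy_def
proof -
  obtain R where R: "\<And>z. norm z > R \<Longrightarrow> f z = 0" using f by (auto simp: test_function_iff)
  have R': "norm z > R \<Longrightarrow> partial b f z = 0" for z using partial_zero_outside[of R f z] R by blast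
  show "ennreal ((f (p + y *\<^sub>R b))\<^sup>2) \<le> (\<integral>\<^sup>+t. ennreal ((f (p + t *\<^sub>R b))\<^sup>2 + (partial b f (p + t *\<^sub>R b))\<^sup>2) \<partial>lborel)"
  proof (rule line_bound[where R = "R + norm p"])
    show "((\<lambda>t. f (p + t *\<^sub>R b)) has_real_derivative partial b f (p + t *\<^sub>R b)) (at t)" for t
      by (rule DERIV_line[OF test_smooth[OF f] b])
    have "continuous_on UNIV (partial b f)"
      by (rule smooth_continuous[OF smooth_partial[OF test_smooth[OF f] b]])
    then show "continuous_on UNIV (\<lambda>t. partial b f (p + t *\<^sub>R b))"
      by (rule continuous_on_compose2) (auto intro!: continuous_intros)
    have "norm (p + t *\<^sub>R b) > R" if "\<bar>t\<bar> > R + norm p" for t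
      using norm_triangle_ineq2[of "t *\<^sub>R b" "- p"] that b by (simp add: add.commute)
    then show "f (p + t *\<^sub>R b) = 0" "partial b f (p + t *\<^sub>R b) = 0" if "\<bar>t\<bar> > R + norm p" for t
      using R R' that by blast+
  qed
qed

definition column_energy :: "(real \<times> real \<Rightarrow> real) \<Rightarrow> real \<Rightarrow> ennreal" where
  "column_energy f x = (\<integral>\<^sup>+t. line_energy (0, 1) f (x, t) \<partial>lborel)"

definition row_energy :: "(real \<times> real \<Rightarrow> real) \<Rightarrow> real \<Rightarrow> ennreal" where
  "row_energy f y = (\<integral>\<^sup>+s. line_energy (1, 0) f (s, y) \<partial>lborel)"

lemma sup_line_y: "test_function f \<Longrightarrow> ennreal ((f (x, y))\<^sup>2) \<le> column_energy f x"
  using sup_line[of f "(0, 1)" "(x, 0)" y] by (simp add: column_energy_def Basis_plane)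

lemma sup_line_x: "test_function f \<Longrightarrow> ennreal ((f (x, y))\<^sup>2) \<le> row_energy f y"
  using sup_line[of f "(1, 0)" "(0, y)" x] by (simp add: row_energy_def Basis_plane)

text \<open>The sum of squared mean square norms of the derivatives with multi-index in \<open>L\<close>. Keeping \<open>L\<close> as a parameter
lets one Cauchy argument serve all norms that occur.\<close>

definition energy :: "'a::euclidean_space list set \<Rightarrow> ('a \<Rightarrow> real) \<Rightarrow> real" where
  "energy L f = (\<Sum>bs\<in>L. sq_norm lebesgue (partials bs f))"

abbreviation "H1_ix \<equiv> {[], [(1, 0)], [(0, 1)]} :: (real \<times> real) list set"
text \<open>The derivatives that arise when lines in both coordinate directions are used in turn, as in
\<open>sup_bound\<close>.\<close>

abbreviation "mixed_ix \<equiv> {[], [(1, 0)], [(0, 1)], [(1, 0), (0, 1)]} :: (real \<times> real) list set"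

lemma energy_nonneg: "energy L f \<ge> 0"
  unfolding energy_def by (intro sum_nonneg integral_nonneg_AE) auto

lemma energy_mono: "finite L \<Longrightarrow> L' \<subseteq> L \<Longrightarrow> energy L' f \<le> energy L f"
  unfolding energy_def by (intro sum_mono2 integral_nonneg_AE) auto

lemma nn_integral_sq_test:
  assumes "test_function f"
  shows "(\<integral>\<^sup>+z. ennreal ((f z)\<^sup>2) \<partial>lborel) = ennreal (sq_norm lebesgue f)"
proof -
  have m: "(\<lambda>z. (f z)\<^sup>2) \<in> borel_measurable borel" using test_borel[OF assms] by measurable
  have "integrable lebesgue (\<lambda>z. (f z)\<^sup>2)" using test_L2[OF assms] by (rule L2_integrable_sq)
  then have i: "integrable lborel (\<lambda>z. (f z)\<^sup>2)" using m by (simp add: integrable_completion)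
  show ?thesis using nn_integral_eq_integral[OF i] m by (simp add: integral_completion)
qed

lemma line_energy_measurable:
  assumes "test_function f" "b \<in> Basis" shows "line_energy b f \<in> borel_measurable borel"
  using test_borel[OF assms(1)] test_borel[OF test_partial[OF assms]] unfolding line_energy_def[abs_def] by measurable

lemma nn_integral_line_energy:
  assumes f: "test_function f" and b: "b \<in> Basis"
  shows "(\<integral>\<^sup>+z. line_energy b f z \<partial>lborel) = ennreal (energy {[], [b]} f)"
proof -
  have m: "f \<in> borel_measurable borel" "partial b f \<in> borel_measurable borel"
    using f test_partial[OF f b] test_borel by blast+
  have "(\<integral>\<^sup>+z. line_energy b f z \<partial>lborel) = (\<integral>\<^sup>+z. ennreal ((f z)\<^sup>2) + ennreal ((partial b f z)\<^sup>2) \<partial>lborel)"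
    by (simp add: line_energy_def)
  also have "\<dots> = (\<integral>\<^sup>+z. ennreal ((f z)\<^sup>2) \<partial>lborel) + (\<integral>\<^sup>+z. ennreal ((partial b f z)\<^sup>2) \<partial>lborel)"
    using m by (intro nn_integral_add) auto
  also have "\<dots> = ennreal (energy {[], [b]} f)"
    unfolding nn_integral_sq_test[OF f] nn_integral_sq_test[OF test_partial[OF f b]]
    by (subst ennreal_plus[symmetric]) (auto simp: energy_def integral_nonneg_AE)
  finally show ?thesis .
qed

lemma
  assumes f: "test_function f"
  shows column_energy_measurable: "column_energy f \<in> borel_measurable borel"
    and nn_integral_column_energy: "(\<integral>\<^sup>+x. column_energy f x \<partial>lborel) = ennreal (energy {[], [(0, 1)]} f)"
proof -
  have m: "line_energy (0, 1) f \<in> borel_measurable (lborel \<Otimes>\<^sub>M lborel)"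
    using line_energy_measurable[OF f Basis_plane(2)] by (simp add: lborel_prod)
  show "column_energy f \<in> borel_measurable borel"
    unfolding column_energy_def[abs_def] using lborel.borel_measurable_nn_integral_fst[OF m] by simp
  show "(\<integral>\<^sup>+x. column_energy f x \<partial>lborel) = ennreal (energy {[], [(0, 1)]} f)"
    unfolding column_energy_def lborel.nn_integral_fst[OF m] nn_integral_line_energy[OF f Basis_plane(2), symmetric]
    by (simp add: lborel_prod)
qed

lemma
  assumes f: "test_function f"
  shows row_energy_measurable: "row_energy f \<in> borel_measurable borel"
    and nn_integral_row_energy: "(\<integral>\<^sup>+y. row_energy f y \<partial>lborel) = ennreal (energy {[], [(1, 0)]} f)"
proof -
  have m: "line_energy (1, 0) f \<in> borel_measurable (lborel \<Otimes>\<^sub>M lborel)"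
    using line_energy_measurable[OF f Basis_plane(1)] by (simp add: lborel_prod)
  have "(\<lambda>(y, s). line_energy (1, 0) f (s, y)) \<in> borel_measurable (lborel \<Otimes>\<^sub>M lborel)"
    using measurable_compose[OF measurable_pair_swap' m] by (simp add: case_prod_beta')
  from lborel.borel_measurable_nn_integral_fst[OF this] show "row_energy f \<in> borel_measurable borel"
    unfolding row_energy_def[abs_def] by simp
  show "(\<integral>\<^sup>+y. row_energy f y \<partial>lborel) = ennreal (energy {[], [(1, 0)]} f)"
    unfolding row_energy_def lborel_pair.nn_integral_snd[OF m] nn_integral_line_energy[OF f Basis_plane(1), symmetric]
    by (simp add: lborel_prod)
qed

text \<open>The bound of \<open>f\<^sup>2\<close> at a point by the integral over the vertical line through it does not depend on the height of
the point, so it may be integrated along any graph.\<close>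

lemma trace_bound:
  assumes f: "test_function f"
  shows "(\<integral>\<^sup>+x. ennreal ((f (x, \<eta> x))\<^sup>2) \<partial>lborel) \<le> ennreal (energy H1_ix f)"
proof -
  have "(\<integral>\<^sup>+x. ennreal ((f (x, \<eta> x))\<^sup>2) \<partial>lborel) \<le> (\<integral>\<^sup>+x. column_energy f x \<partial>lborel)"
    by (intro nn_integral_mono sup_line_y f)
  also have "\<dots> = ennreal (energy {[], [(0, 1)]} f)" by (rule nn_integral_column_energy[OF f])
  also have "\<dots> \<le> ennreal (energy H1_ix f)" by (intro ennreal_leI energy_mono) auto
  finally show ?thesis .
qed

lemma integral_le_of_nn_integral:
  assumes "integrable lborel g" "\<And>x. g x \<ge> 0" "(\<integral>\<^sup>+x. ennreal (g x) \<partial>lborel) \<le> ennreal c" "c \<ge> 0"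
  shows "(LINT x|lborel. g x) \<le> c"
  using assms nn_integral_eq_integral[OF assms(1)] by simp

text \<open>At \<open>(x, y)\<close> the first factor is bounded by an integral over the vertical line, a function of \<open>x\<close> alone,
and the second by an integral over the horizontal line, a function of \<open>y\<close> alone. The double
integral of the product of the bounds splits.\<close>

lemma product_bound_11:
  assumes f: "test_function f" and g: "test_function g"
  shows "(LINT z|lebesgue. (f z * g z)\<^sup>2) \<le> 1 * energy H1_ix f * energy H1_ix g"
proof -
  have t: "test_function (\<lambda>z. f z * g z)" by (rule test_mult_left[OF test_smooth[OF f] g])
  have m: "f \<in> borel_measurable borel" "g \<in> borel_measurable borel" using f g test_borel by blast+
  have "ennreal (LINT z|lebesgue. (f z * g z)\<^sup>2) = (\<integral>\<^sup>+z. ennreal ((f z * g z)\<^sup>2) \<partial>lborel)"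
    using nn_integral_sq_test[OF t] by simp
  also have "\<dots> = (\<integral>\<^sup>+z. ennreal ((f z * g z)\<^sup>2) \<partial>(lborel \<Otimes>\<^sub>M lborel))" by (simp add: lborel_prod)
  also have "\<dots> = (\<integral>\<^sup>+x. (\<integral>\<^sup>+y. ennreal ((f (x, y) * g (x, y))\<^sup>2) \<partial>lborel) \<partial>lborel)"
    by (rule lborel.nn_integral_fst[symmetric]) (use m in \<open>simp add: lborel_prod\<close>)
  also have "\<dots> \<le> (\<integral>\<^sup>+x. (\<integral>\<^sup>+y. column_energy f x * row_energy g y \<partial>lborel) \<partial>lborel)"
    unfolding power_mult_distrib
    by (intro nn_integral_mono) (auto simp: ennreal_mult' intro!: mult_mono sup_line_x sup_line_y f g)
  also have "\<dots> = (\<integral>\<^sup>+x. column_energy f x \<partial>lborel) * (\<integral>\<^sup>+y. row_energy g y \<partial>lborel)"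
    using row_energy_measurable[OF g] column_energy_measurable[OF f] by (simp add: nn_integral_cmult nn_integral_multc)
  also have "\<dots> = ennreal (energy {[], [(0, 1)]} f) * ennreal (energy {[], [(1, 0)]} g)"
    by (simp add: nn_integral_column_energy[OF f] nn_integral_row_energy[OF g])
  also have "\<dots> \<le> ennreal (energy H1_ix f) * ennreal (energy H1_ix g)"
    by (intro mult_mono ennreal_leI energy_mono) auto
  also have "\<dots> = ennreal (energy H1_ix f * energy H1_ix g)"
    by (rule ennreal_mult[symmetric]) (rule energy_nonneg)+
  finally show ?thesis using energy_nonneg[of H1_ix f] energy_nonneg[of H1_ix g] by simp
qed

text \<open>Bound \<open>f\<^sup>2\<close> by the integral over a vertical line of \<open>f\<^sup>2\<close> and \<open>f\<^sub>y\<^sup>2\<close>, and each of these by an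
integral over horizontal lines.\<close>

lemma sup_bound:
  assumes f: "test_function f" shows "(f z)\<^sup>2 \<le> 2 * energy mixed_ix f"
proof -
  obtain x y where z: "z = (x, y)" by (cases z)
  have fy: "test_function (partial (0, 1) f)" by (rule test_partial[OF f Basis_plane(2)])
  have "ennreal ((f z)\<^sup>2) \<le> column_energy f x" unfolding z by (rule sup_line_y[OF f])
  also have "\<dots> \<le> (\<integral>\<^sup>+t. row_energy f t + row_energy (partial (0, 1) f) t \<partial>lborel)"
    unfolding column_energy_def line_energy_def
    by (intro nn_integral_mono) (auto simp: ennreal_plus intro!: add_mono sup_line_x f fy)
  also have "\<dots> = (\<integral>\<^sup>+t. row_energy f t \<partial>lborel) + (\<integral>\<^sup>+t. row_energy (partial (0, 1) f) t \<partial>lborel)"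
    using row_energy_measurable[OF f] row_energy_measurable[OF fy] by (intro nn_integral_add) auto
  also have "\<dots> = ennreal (energy {[], [(1, 0)]} f + energy {[], [(1, 0)]} (partial (0, 1) f))"
    unfolding nn_integral_row_energy[OF f] nn_integral_row_energy[OF fy] by (simp add: ennreal_plus energy_nonneg)
  also have "\<dots> \<le> ennreal (2 * energy mixed_ix f)"
  proof (rule ennreal_leI)
    have "energy {[], [(1, 0)]} (partial (0, 1) f) = energy {[(0, 1)], [(1, 0), (0, 1)]} f"
      by (simp add: energy_def)
    also have "\<dots> \<le> energy mixed_ix f" by (intro energy_mono) auto
    moreover have "energy {[], [(1, 0)]} f \<le> energy mixed_ix f" by (intro energy_mono) auto
    ultimately show "energy {[], [(1, 0)]} f + energy {[], [(1, 0)]} (partial (0, 1) f) \<le> 2 * energy mixed_ix f"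
      by linarith
  qed
  finally show ?thesis using energy_nonneg[of mixed_ix f] by simp
qed

lemma product_bound_20:
  assumes f: "test_function f" and g: "test_function g"
  shows "(LINT z|lebesgue. (f z * g z)\<^sup>2) \<le> 2 * energy mixed_ix f * energy {[]} g"
proof -
  have t: "test_function (\<lambda>z. f z * g z)" by (rule test_mult_left[OF test_smooth[OF f] g])
  have "(LINT z|lebesgue. (f z * g z)\<^sup>2) \<le> (LINT z|lebesgue. 2 * energy mixed_ix f * (g z)\<^sup>2)"
    by (intro integral_mono L2_integrable_sq integrable_mult_right test_L2 t g)
       (auto simp: power_mult_distrib intro!: mult_right_mono sup_bound f)
  then show ?thesis by (simp add: energy_def)
qed

lemma partials_diff:
  assumes "smooth f" "smooth g" "set bs \<subseteq> Basis"
  shows "partials bs (\<lambda>z. f z - g z) = (\<lambda>z. partials bs f z - partials bs g z)"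
  using partials_add[OF assms(1) smooth_mult[OF smooth_const[of "-1"] assms(2)] assms(3)]
    partials_scale[OF assms(2,3), of "-1"] by simp

lemma energy_triangle:
  assumes f: "test_function f" and g: "test_function g" and L: "finite L" "\<And>bs. bs \<in> L \<Longrightarrow> set bs \<subseteq> Basis"
  shows "energy L f \<le> 2 * energy L (\<lambda>z. f z - g z) + 2 * energy L g"
proof -
  have "sq_norm lebesgue (partials bs f) \<le> 2 * (LINT z|lebesgue. (partials bs (\<lambda>z. f z - g z) z)\<^sup>2) + 2 * sq_norm lebesgue (partials bs g)"
    if "bs \<in> L" for bs
  proof -
    have l: "partials bs f \<in> L2_space lebesgue" "partials bs g \<in> L2_space lebesgue"
      using test_L2 test_partials f g L(2)[OF that] by blast+
    show ?thesis
      using L2_add(2)[OF L2_diff(1)[OF l] l(2)]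
      unfolding partials_diff[OF test_smooth[OF f] test_smooth[OF g] L(2)[OF that]] by simp
  qed
  then show ?thesis unfolding energy_def sum_distrib_left sum.distrib[symmetric] by (rule sum_mono)
qed

lemma energy_Cauchy:
  assumes t: "\<And>k. test_function (s k)" and L: "finite L" "\<And>bs. bs \<in> L \<Longrightarrow> set bs \<subseteq> Basis"
    and C: "\<And>bs. bs \<in> L \<Longrightarrow> L2Cauchy lebesgue (\<lambda>k. partials bs (s k))" and e: "e > 0"
  shows "\<exists>N. \<forall>m\<ge>N. \<forall>n\<ge>N. energy L (\<lambda>z. s m z - s n z) < e"
proof -
  define c where "c = e / (card L + 1)"
  have c: "c > 0" using e by (simp add: c_def)
  have "\<exists>N. \<forall>m\<ge>N. \<forall>n\<ge>N. sq_dist lebesgue (partials bs (s m)) (partials bs (s n)) < c" if "bs \<in> L" for bs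
    using C[OF that] c unfolding L2Cauchy_def by blast
  then obtain N where N: "\<And>bs m n. bs \<in> L \<Longrightarrow> m \<ge> N bs \<Longrightarrow> n \<ge> N bs \<Longrightarrow>
      (sq_dist lebesgue (partials bs (s m)) (partials bs (s n))) < c" by metis
  define N0 where "N0 = Max (insert 0 (N ` L))"
  have N0: "N bs \<le> N0" if "bs \<in> L" for bs using L that by (auto simp: N0_def)
  show ?thesis
  proof (intro exI[of _ N0] allI impI)
    fix m n assume mn: "m \<ge> N0" "n \<ge> N0"
    have "energy L (\<lambda>z. s m z - s n z) \<le> (\<Sum>bs\<in>L. c)"
      unfolding energy_def
    proof (rule sum_mono)
      fix bs assume bs: "bs \<in> L"
      show "(LINT z|lebesgue. (partials bs (\<lambda>z. s m z - s n z) z)\<^sup>2) \<le> c"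
        unfolding partials_diff[OF test_smooth[OF t] test_smooth[OF t] L(2)[OF bs]]
        using N[OF bs] N0[OF bs] mn by (meson less_imp_le order_trans)
    qed
    also have "\<dots> < (card L + 1) * c" using c by simp
    also have "\<dots> = e" by (simp add: c_def)
    finally show "energy L (\<lambda>z. s m z - s n z) < e" .
  qed
qed

text \<open>The splitting \<open>a\<^sub>m b\<^sub>m - a\<^sub>n b\<^sub>n = a\<^sub>m (b\<^sub>m - b\<^sub>n) + (a\<^sub>m - a\<^sub>n) b\<^sub>n\<close> reduces convergence of products
to any bound of the mean square of a product by the energies of the factors.\<close>

lemma product_Cauchy:
  assumes t: "\<And>k. test_function (a k)" "\<And>k. test_function (b k)"
    and L: "finite L" "\<And>bs. bs \<in> L \<Longrightarrow> set bs \<subseteq> Basis" and L': "finite L'" "\<And>bs. bs \<in> L' \<Longrightarrow> set bs \<subseteq> Basis"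
    and C: "\<And>bs. bs \<in> L \<Longrightarrow> L2Cauchy lebesgue (\<lambda>k. partials bs (a k))"
           "\<And>bs. bs \<in> L' \<Longrightarrow> L2Cauchy lebesgue (\<lambda>k. partials bs (b k))"
    and B: "\<And>f g. test_function f \<Longrightarrow> test_function g \<Longrightarrow>
        (LINT z|lebesgue. (f z * g z)\<^sup>2) \<le> c * energy L f * energy L' g" and "c > 0"
  shows "L2Cauchy lebesgue (\<lambda>k z. a k z * b k z)"
  unfolding L2Cauchy_def
proof (intro conjI allI impI)
  show ab: "(\<lambda>z. a k z * b k z) \<in> L2_space lebesgue" for k
    by (intro test_L2 test_mult_left test_smooth t)
  fix e :: real assume e: "e > 0"
  obtain N1 where N1: "\<And>m n. m \<ge> N1 \<Longrightarrow> n \<ge> N1 \<Longrightarrow> energy L (\<lambda>z. a m z - a n z) < 1"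
    using energy_Cauchy[of a L, OF t(1) L C(1), of 1] by auto
  obtain N2 where N2: "\<And>m n. m \<ge> N2 \<Longrightarrow> n \<ge> N2 \<Longrightarrow> energy L' (\<lambda>z. b m z - b n z) < 1"
    using energy_Cauchy[of b L', OF t(2) L' C(2), of 1] by auto
  \<comment> \<open>A common bound of the energies of all late terms, by \<open>energy_triangle\<close>.\<close>
  define K where "K = 3 + 2 * energy L (a N1) + 2 * energy L' (b N2)"
  have K: "K > 0" using energy_nonneg[of L "a N1"] energy_nonneg[of L' "b N2"] by (simp add: K_def)
  have Ka: "energy L (a m) \<le> K" if "m \<ge> N1" for m
    using energy_triangle[OF t(1)[of m] t(1)[of N1] L] N1[OF that order_refl] energy_nonneg[of L' "b N2"]
    by (simp add: K_def)
  have Kb: "energy L' (b m) \<le> K" if "m \<ge> N2" for m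
    using energy_triangle[OF t(2)[of m] t(2)[of N2] L'] N2[OF that order_refl] energy_nonneg[of L "a N1"]
    by (simp add: K_def)
  define d where "d = e / (4 * c * K)"
  have d: "d > 0" using e K \<open>c > 0\<close> by (simp add: d_def)
  obtain N3 where N3: "\<And>m n. m \<ge> N3 \<Longrightarrow> n \<ge> N3 \<Longrightarrow> energy L (\<lambda>z. a m z - a n z) < d"
    using energy_Cauchy[of a L, OF t(1) L C(1) d] by auto
  obtain N4 where N4: "\<And>m n. m \<ge> N4 \<Longrightarrow> n \<ge> N4 \<Longrightarrow> energy L' (\<lambda>z. b m z - b n z) < d"
    using energy_Cauchy[of b L', OF t(2) L' C(2) d] by auto
  show "\<exists>N. \<forall>m\<ge>N. \<forall>n\<ge>N. (LINT z|lebesgue. (a m z * b m z - a n z * b n z)\<^sup>2) < e"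
  proof (intro exI[of _ "N1 + N2 + N3 + N4"] allI impI)
    fix m n assume mn: "N1 + N2 + N3 + N4 \<le> m" "N1 + N2 + N3 + N4 \<le> n"
    have td: "test_function (\<lambda>z. b m z - b n z)" "test_function (\<lambda>z. a m z - a n z)"
      using t by (auto intro: test_diff)
    have tp: "(\<lambda>z. a m z * (b m z - b n z)) \<in> L2_space lebesgue" "(\<lambda>z. (a m z - a n z) * b n z) \<in> L2_space lebesgue"
      by (intro test_L2 test_mult_left test_smooth t td)+
    have "(LINT z|lebesgue. (a m z * b m z - a n z * b n z)\<^sup>2)
        = (LINT z|lebesgue. (a m z * (b m z - b n z) + (a m z - a n z) * b n z)\<^sup>2)"
      by (simp add: algebra_simps)
    also have "\<dots> \<le> 2 * (LINT z|lebesgue. (a m z * (b m z - b n z))\<^sup>2) + 2 * (LINT z|lebesgue. ((a m z - a n z) * b n z)\<^sup>2)"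
      by (rule L2_add(2)[OF tp])
    also have "\<dots> \<le> 2 * (c * energy L (a m) * energy L' (\<lambda>z. b m z - b n z)) + 2 * (c * energy L (\<lambda>z. a m z - a n z) * energy L' (b n))"
      using B[OF t(1) td(1), of m] B[OF td(2) t(2), of n] by linarith
    also have "\<dots> < 2 * (c * K * d) + 2 * (c * d * K)"
    proof -
      have "energy L (a m) * energy L' (\<lambda>z. b m z - b n z) \<le> K * energy L' (\<lambda>z. b m z - b n z)"
        using Ka[of m] mn by (intro mult_right_mono energy_nonneg) simp
      also have "\<dots> < K * d" using N4[of m n] mn K by simp
      finally have 1: "c * (energy L (a m) * energy L' (\<lambda>z. b m z - b n z)) < c * (K * d)" using \<open>c > 0\<close> by simp
      have "energy L (\<lambda>z. a m z - a n z) * energy L' (b n) \<le> energy L (\<lambda>z. a m z - a n z) * K"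
        using Kb[of n] mn by (intro mult_left_mono energy_nonneg) simp
      also have "\<dots> < d * K" using N3[of m n] mn K by simp
      finally have 2: "c * (energy L (\<lambda>z. a m z - a n z) * energy L' (b n)) < c * (d * K)" using \<open>c > 0\<close> by simp
      show ?thesis using 1 2 unfolding mult.assoc by linarith
    qed
    also have "\<dots> = e" using K \<open>c > 0\<close> by (simp add: d_def field_simps)
    finally show "(LINT z|lebesgue. (a m z * b m z - a n z * b n z)\<^sup>2) < e" .
  qed
qed

section \<open>Differentiation of indefinite integrals on the line\<close>

text \<open>Unoriented, so that the difference quotients from the left and from the right are treated together.\<close>

definition integral_between :: "(real \<Rightarrow> real) \<Rightarrow> real \<Rightarrow> real \<Rightarrow> real" where
  "integral_between w x y = (LINT t|lborel. indicator {min x y..max x y} t * w t)"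

lemma integral_between_integrable:
  assumes "integrable lborel w" shows "integrable lborel (\<lambda>t. indicator {a..b::real} t * w t :: real)"
  using integrable_mult_indicator[of "{a..b}" lborel w] assms by simp

lemma integral_between_const: "integrable lborel (\<lambda>t. indicator {a..b::real} t * c :: real)" "integral_between (\<lambda>_. c) x y = c * \<bar>y - x\<bar>"
proof -
  have "integrable lborel (indicat_real {a..b})"
    by (simp add: integrable_indicator_iff emeasure_lborel_Icc_eq)
  then show "integrable lborel (\<lambda>t. indicator {a..b} t * c)" by simp
qed (auto simp: integral_between_def min_def max_def)

text \<open>The weak type estimate for the one-dimensional maximal function. The Vitali covering lemma selects disjoint
intervals on each of which the mean of \<open>d\<close> exceeds \<open>l / 2\<close>, and whose fivefold enlargements cover the set.\<close>

lemma maximal_cover: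
  fixes d :: "real \<Rightarrow> real"
  assumes d: "integrable lborel d" "\<And>t. d t \<ge> 0" and l: "l > 0"
  obtains T where "T \<in> sets lborel" "{x. \<exists>y. integral_between d x y > l * \<bar>y - x\<bar>} \<subseteq> T"
    "emeasure lborel T \<le> ennreal (10 / l * (LINT t|lborel. d t))"
proof -
  define E where "E = {x. \<exists>y. integral_between d x y > l * \<bar>y - x\<bar>}"
  define D where "D = (LINT t|lborel. d t)"
  have dm[measurable]: "d \<in> borel_measurable borel" using borel_measurable_integrable[OF d(1)] by simp
  have seg0: "integral_between d x x = 0" for x
  proof -
    have "AE t in lborel. indicator {x..x} t * d t = 0"
      using AE_lborel_singleton[of x] by eventually_elim simp
    then show ?thesis unfolding integral_between_def by (simp add: integral_eq_zero_AE)
  qed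
  have "\<exists>y. integral_between d x y > l * \<bar>y - x\<bar>" if "x \<in> E" for x using that by (simp add: E_def)
  then obtain Y where Y: "\<And>x. x \<in> E \<Longrightarrow> integral_between d x (Y x) > l * \<bar>Y x - x\<bar>" by metis
  define r where "r = (\<lambda>x. \<bar>Y x - x\<bar>)"
  have rpos: "r x > 0" if "x \<in> E" for x using Y[OF that] seg0[of x] by (auto simp: r_def)
  have segD: "integral_between d x y \<le> D" for x y
    unfolding integral_between_def D_def by (intro integral_mono integral_between_integrable d) (auto simp: indicator_def d)
  have rB: "r x \<le> D / l" if "x \<in> E" for x
    using Y[OF that] segD[of x "Y x"] l by (simp add: r_def field_simps)
  obtain C where C: "countable C" "C \<subseteq> E"
     "pairwise (\<lambda>i j. disjnt (cball i (r i)) (cball j (r j))) C"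
     "E \<subseteq> (\<Union>i\<in>C. cball i (5 * r i))"
    by (rule Vitali_covering_lemma_cballs[where S = E and K = E and a = "\<lambda>x. x" and r = r and B = "D / l"]) (use rpos rB in \<open>force+\<close>)
  define T where "T = (\<Union>i\<in>C. cball i (5 * r i))"
  have Tm: "T \<in> sets lborel" unfolding T_def using C(1) by (intro sets.countable_UN'') auto
  have "emeasure lborel T = (\<integral>\<^sup>+x. indicator T x \<partial>lborel)" using Tm by simp
  also have "\<dots> \<le> (\<integral>\<^sup>+x. (\<integral>\<^sup>+i. indicator (cball i (5 * r i)) x \<partial>count_space C) \<partial>lborel)"
  proof (rule nn_integral_mono)
    fix x :: real
    show "indicator T x \<le> (\<integral>\<^sup>+i. indicator (cball i (5 * r i)) x \<partial>count_space C)"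
    proof (cases "x \<in> T")
      case True
      then obtain j where j: "j \<in> C" "x \<in> cball j (5 * r j)" by (auto simp: T_def)
      have "(1::ennreal) = indicator (cball j (5 * r j)) x" using j by simp
      also have "\<dots> \<le> (\<integral>\<^sup>+i. indicator (cball i (5 * r i)) x \<partial>count_space C)"
        by (rule nn_integral_ge_point[OF j(1)])
      finally show ?thesis using True by simp
    qed simp
  qed
  also have "\<dots> = (\<integral>\<^sup>+i. (\<integral>\<^sup>+x. indicator (cball i (5 * r i)) x \<partial>lborel) \<partial>count_space C)"
    by (rule nn_integral_count_space_nn_integral[OF C(1)]) (rule borel_measurable_indicator, simp)
  also have "\<dots> \<le> (\<integral>\<^sup>+i. ennreal (10 / l) * (\<integral>\<^sup>+x. ennreal (indicator (cball i (r i)) x * d x) \<partial>lborel) \<partial>count_space C)"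
  proof (rule nn_integral_mono)
    fix i assume "i \<in> space (count_space C)"
    then have i: "i \<in> E" using C(2) by auto
    have "integral_between d i (Y i) \<le> (LINT x|lborel. indicator (cball i (r i)) x * d x)"
      unfolding integral_between_def
    proof (rule integral_mono)
      show "integrable lborel (\<lambda>x. indicator (cball i (r i)) x * d x)"
        using integral_between_integrable[OF d(1)] by (simp add: cball_eq_atLeastAtMost)
      show "indicator {min i (Y i)..max i (Y i)} t * d t \<le> indicator (cball i (r i)) t * d t" for t
        using d(2)[of t] by (auto simp: indicator_def r_def dist_real_def)
    qed (rule integral_between_integrable[OF d(1)])
    then have "10 * r i \<le> 10 / l * (LINT x|lborel. indicator (cball i (r i)) x * d x)"
      using Y[OF i] l by (simp add: r_def field_simps)
    moreover have "(\<integral>\<^sup>+x. ennreal (indicator (cball i (r i)) x * d x) \<partial>lborel) = ennreal (LINT x|lborel. indicator (cball i (r i)) x * d x)"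
      by (rule nn_integral_eq_integral)
         (use integral_between_integrable[OF d(1)] d(2) in \<open>auto simp: cball_eq_atLeastAtMost\<close>)
    moreover have "(\<integral>\<^sup>+x. indicator (cball i (5 * r i)) x \<partial>lborel) = ennreal (10 * r i)"
      using rpos[OF i] by (simp add: cball_eq_atLeastAtMost)
    ultimately show "(\<integral>\<^sup>+x. indicator (cball i (5 * r i)) x \<partial>lborel) \<le> ennreal (10 / l) * (\<integral>\<^sup>+x. ennreal (indicator (cball i (r i)) x * d x) \<partial>lborel)"
      using l by (simp add: ennreal_mult'[symmetric] ennreal_leI)
  qed
  also have "\<dots> = ennreal (10 / l) * (\<integral>\<^sup>+x. (\<integral>\<^sup>+i. ennreal (indicator (cball i (r i)) x * d x) \<partial>count_space C) \<partial>lborel)"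
  proof (subst nn_integral_count_space_nn_integral[OF C(1)])
    show "(\<lambda>x. ennreal (indicator (cball i (r i)) x * d x)) \<in> borel_measurable lborel" for i
      by (intro measurable_compose[OF _ measurable_ennreal] borel_measurable_times borel_measurable_indicator) simp_all
  qed (simp add: nn_integral_cmult)
  also have "\<dots> \<le> ennreal (10 / l) * (\<integral>\<^sup>+x. ennreal (d x) \<partial>lborel)"
  proof (intro mult_left_mono nn_integral_mono)
    fix x :: real
    show "(\<integral>\<^sup>+i. ennreal (indicator (cball i (r i)) x * d x) \<partial>count_space C) \<le> ennreal (d x)"
    proof (cases "\<exists>j\<in>C. x \<in> cball j (r j)")
      case True
      then obtain j where j: "j \<in> C" "x \<in> cball j (r j)" by blast
      have "(\<integral>\<^sup>+i. ennreal (indicator (cball i (r i)) x * d x) \<partial>count_space C)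
          = (\<integral>\<^sup>+i. ennreal (d x) * indicator {j} i \<partial>count_space C)"
      proof (rule nn_integral_cong)
        fix i assume "i \<in> space (count_space C)"
        then have i: "i \<in> C" by simp
        show "ennreal (indicator (cball i (r i)) x * d x) = ennreal (d x) * indicator {j} i"
        proof (cases "i = j")
          case True then show ?thesis using j by simp
        next
          case False
          then have "disjnt (cball i (r i)) (cball j (r j))" using C(3) i j(1) by (auto simp: pairwise_def)
          then have "x \<notin> cball i (r i)" using j(2) by (auto simp: disjnt_def)
          then show ?thesis using False by simp
        qed
      qed
      also have "\<dots> = ennreal (d x)"
        using j(1) by (simp add: nn_integral_cmult one_ennreal_def[symmetric] emeasure_count_space)
      finally show ?thesis by simp
    next
      case False
      have "(\<integral>\<^sup>+i. ennreal (indicator (cball i (r i)) x * d x) \<partial>count_space C) = (\<integral>\<^sup>+i. 0 \<partial>count_space C)"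
        by (rule nn_integral_cong) (use False in auto)
      then show ?thesis by simp
    qed
  qed auto
  also have "\<dots> = ennreal (10 / l * D)"
    using nn_integral_eq_integral[OF d(1)] d(2) l by (simp add: D_def ennreal_mult'[symmetric])
  finally have "emeasure lborel T \<le> ennreal (10 / l * D)" .
  then show ?thesis using that[of T] Tm C(4) unfolding E_def T_def D_def by blast
qed

text \<open>A mollification is close to \<open>w\<close> in the mean square; both vanish outside a fixed interval, so by
the Cauchy-Schwarz inequality it is close in the mean as well.\<close>

lemma L1_test_approx:
  fixes w :: "real \<Rightarrow> real"
  assumes w: "w \<in> L2_space lborel" and z: "\<And>t. t \<notin> {a..b} \<Longrightarrow> w t = 0" and e: "e > 0"
  obtains g where "test_function g" "integrable lborel (\<lambda>t. \<bar>w t - g t\<bar>)" "(LINT t|lborel. \<bar>w t - g t\<bar>) < e"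
proof -
  define K where "K = \<bar>b - a\<bar> + 2"
  have K: "K > 0" by (simp add: K_def)
  \<comment> \<open>\<open>K\<close> bounds the length of an interval that contains the supports of \<open>w\<close> and of its mollification.\<close>
  define e' where "e' = (e / 2)\<^sup>2 / K"
  have e': "e' > 0" using e K by (simp add: e'_def)
  have wm: "w \<in> borel_measurable borel" using L2_measurable[OF w] by simp
  have wl: "w \<in> L2_space lebesgue" using w L2_completion[OF wm] by simp
  obtain d where d: "d > 0" "\<And>h. norm h < d \<Longrightarrow> (LINT z|lborel. (w (z - h) - w z)\<^sup>2) < e'"
    using L2_translation_continuous[OF w] e' unfolding translation_continuous_def by meson
  have m1: "min d 1 > 0" using d by simp
  obtain f :: "real \<Rightarrow> real" where f: "mollifier (min d 1) f" using mollifier_exists[OF m1] .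
  have ft: "test_function f" "\<And>z. norm z \<ge> 1 \<Longrightarrow> f z = 0" using f by (auto simp: mollifier_def)
  define g where "g = conv w f"
  have gL: "g \<in> L2_space lborel" "sq_dist lborel g w \<le> e'"
    unfolding g_def using mollify_lborel[OF w f, of e'] d(2) by (simp_all add: less_imp_le)
  have g0: "g z = 0" if "z \<notin> {a - 1..b + 1}" for z
  proof -
    have "(\<lambda>t. w t * f (z - t)) = (\<lambda>t. 0)"
    proof
      fix t show "w t * f (z - t) = 0"
      proof (cases "t \<in> {a..b}")
        case True
        then have "norm (z - t) \<ge> 1" using that by (auto simp: real_norm_def)
        then show ?thesis using ft(2) by simp
      qed (simp add: z)
    qed
    then show ?thesis by (simp add: g_def conv_def)
  qed
  have gt: "test_function g"
    unfolding test_function_iff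
  proof (intro conjI exI[of _ "\<bar>a\<bar> + \<bar>b\<bar> + 1"] allI impI)
    show "smooth g" unfolding g_def by (rule smooth_conv[OF L2_locally_integrable[OF wl] ft(1)])
    show "g z = 0" if "\<bar>a\<bar> + \<bar>b\<bar> + 1 < norm z" for z by (rule g0) (use that in auto)
  qed
  define J where "J = {a - 1..b + 1}"
  have JL: "indicat_real J \<in> L2_space lborel"
  proof -
    have "(\<lambda>t. (indicat_real J t)\<^sup>2) = indicat_real J" by (auto simp: indicator_def)
    moreover have "integrable lborel (indicat_real J)" using integral_between_const(1)[of "a - 1" "b + 1" 1] by (simp add: J_def)
    ultimately show ?thesis by (simp add: L2_space_def J_def)
  qed
  have dL: "(\<lambda>t. \<bar>w t - g t\<bar>) \<in> L2_space lborel"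
    using L2_diff(1)[OF w gL(1)] by (auto simp: L2_space_def)
  have eq: "indicat_real J t * \<bar>w t - g t\<bar> = \<bar>w t - g t\<bar>" for t
  proof (cases "t \<in> J")
    case False
    then have "t \<notin> {a..b}" "t \<notin> {a - 1..b + 1}" by (auto simp: J_def)
    then show ?thesis using z g0 by simp
  qed simp
  have i: "integrable lborel (\<lambda>t. \<bar>w t - g t\<bar>)"
    using L2_mult_integrable[OF JL dL] by (simp only: eq)
  have "(LINT t|lborel. \<bar>w t - g t\<bar>)\<^sup>2 \<le> sq_norm lborel (indicat_real J) * (LINT t|lborel. \<bar>w t - g t\<bar>\<^sup>2)"
    using L2_Cauchy_Schwarz[OF JL dL] by (simp only: eq)
  also have "\<dots> \<le> K * e'"
  proof (rule mult_mono)
    have "(\<lambda>t. (indicat_real J t)\<^sup>2) = indicat_real J" by (auto simp: indicator_def)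
    then show "sq_norm lborel (indicat_real J) \<le> K" by (auto simp: J_def K_def)
    show "(LINT t|lborel. \<bar>w t - g t\<bar>\<^sup>2) \<le> e'" using gL(2) by (simp add: power2_commute)
  qed (use K in \<open>auto intro: integral_nonneg_AE\<close>)
  also have "\<dots> = (e / 2)\<^sup>2" using K by (simp add: e'_def)
  finally have "(LINT t|lborel. \<bar>w t - g t\<bar>) \<le> e / 2"
    by (rule power2_le_imp_le) (use e in simp)
  then show ?thesis using that[OF gt i] e by simp
qed

text \<open>Compare \<open>w\<close> with a test function \<open>g\<close> close to it in the mean. The difference quotients of the integral of \<open>g\<close>
converge by continuity, and the remainder is large only on a set controlled by \<open>maximal_cover\<close>
and by Markov's inequality.\<close>

lemma Lebesgue_differentiation:
  fixes w :: "real \<Rightarrow> real"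
  assumes w: "w \<in> L2_space lborel" and z: "\<And>t. t \<notin> {a..b} \<Longrightarrow> w t = 0"
    and F: "\<And>x y. x \<le> y \<Longrightarrow> F y - F x = (LINT t|lborel. indicator {x..y} t * w t)"
  shows "AE x in lborel. (F has_real_derivative w x) (at x)"
proof -
  have wm[measurable]: "w \<in> borel_measurable borel" using L2_measurable[OF w] by simp
  have wi: "integrable lborel w"
  proof -
    obtain g where g: "test_function g" "integrable lborel (\<lambda>t. \<bar>w t - g t\<bar>)"
      using L1_test_approx[OF w z, of a b 1] by auto
    have gm: "g \<in> borel_measurable borel" using test_borel[OF g(1)] .
    have "integrable lborel (\<lambda>t. w t - g t)"
      by (rule integrable_norm_cancel) (use g(2) gm in simp_all)
    from Bochner_Integration.integrable_add[OF this test_integrable[OF g(1)]] show ?thesis by simp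
  qed
  have Fseg: "\<bar>F y - F x - w x * (y - x)\<bar> = \<bar>integral_between w x y - w x * \<bar>y - x\<bar>\<bar>" for x y
  proof (cases "x \<le> y")
    case True then show ?thesis using F[OF True] by (simp add: integral_between_def min_def max_def)
  next
    case False
    then have "F x - F y = integral_between w x y" using F[of y x] by (simp add: integral_between_def min_def max_def)
    then show ?thesis using False by (simp add: abs_if algebra_simps)
  qed
  have nul: "\<exists>N\<in>null_sets lborel. {x. \<not> (\<forall>\<^sub>F y in at x. \<bar>F y - F x - w x * (y - x)\<bar> \<le> 3 * l * \<bar>y - x\<bar>)} \<subseteq> N"
    if l: "l > 0" for l
  proof -
    define Bad where "Bad = {x. \<not> (\<forall>\<^sub>F y in at x. \<bar>F y - F x - w x * (y - x)\<bar> \<le> 3 * l * \<bar>y - x\<bar>)}"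
    have "\<exists>T\<in>sets lborel. Bad \<subseteq> T \<and> emeasure lborel T \<le> ennreal (11 / l * e)" if e: "e > 0" for e
    proof -
      obtain g where g: "test_function g" "integrable lborel (\<lambda>t. \<bar>w t - g t\<bar>)" "(LINT t|lborel. \<bar>w t - g t\<bar>) < e"
        using L1_test_approx[OF w z e] by blast
      have gm[measurable]: "g \<in> borel_measurable borel" using test_borel[OF g(1)] .
      have gi: "integrable lborel g" by (rule test_integrable[OF g(1)])
      obtain T1 where T1: "T1 \<in> sets lborel" "{x. \<exists>y. integral_between (\<lambda>t. \<bar>w t - g t\<bar>) x y > l * \<bar>y - x\<bar>} \<subseteq> T1"
        "emeasure lborel T1 \<le> ennreal (10 / l * (LINT t|lborel. \<bar>w t - g t\<bar>))"
        using maximal_cover[OF g(2) abs_ge_zero l] by blast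
      define T2 where "T2 = {x. \<bar>w x - g x\<bar> \<ge> l}"
      have T2m: "T2 \<in> sets lborel" unfolding T2_def by measurable
      have "emeasure lborel T2 \<le> ennreal (1 / l * (LINT t|lborel. \<bar>w t - g t\<bar>))"
      proof -
        have "emeasure lborel T2 \<le> ennreal (1 / l) * (\<integral>\<^sup>+t. ennreal \<bar>w t - g t\<bar> * indicator UNIV t \<partial>lborel)"
          using nn_integral_Markov_inequality[of "\<lambda>t. ennreal \<bar>w t - g t\<bar>" UNIV lborel "ennreal (1 / l)"]
          unfolding T2_def using l by (simp add: ennreal_mult'[symmetric] one_ennreal_def[symmetric] ennreal_1[symmetric] ennreal_le_iff field_simps del: ennreal_1)
        also have "\<dots> = ennreal (1 / l * (LINT t|lborel. \<bar>w t - g t\<bar>))"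
          using nn_integral_eq_integral[OF g(2)] l by (simp add: ennreal_mult'[symmetric])
        finally show ?thesis .
      qed
      then have "emeasure lborel (T1 \<union> T2) \<le> ennreal (10 / l * (LINT t|lborel. \<bar>w t - g t\<bar>)) + ennreal (1 / l * (LINT t|lborel. \<bar>w t - g t\<bar>))"
        using emeasure_subadditive[OF T1(1) T2m] T1(3) by (meson add_mono order_trans)
      also have "\<dots> = ennreal (11 / l * (LINT t|lborel. \<bar>w t - g t\<bar>))"
        using l by (subst ennreal_plus[symmetric]) (auto intro!: integral_nonneg_AE mult_nonneg_nonneg simp: add_divide_distrib[symmetric] distrib_right[symmetric])
      also have "\<dots> \<le> ennreal (11 / l * e)"
        using g(3) l by (intro ennreal_leI mult_left_mono) auto
      finally have em: "emeasure lborel (T1 \<union> T2) \<le> ennreal (11 / l * e)" .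
      have "x \<notin> Bad" if x: "x \<notin> T1" "x \<notin> T2" for x
      proof -
        have 1: "integral_between (\<lambda>t. \<bar>w t - g t\<bar>) x y \<le> l * \<bar>y - x\<bar>" for y
        proof (rule ccontr)
          assume "\<not> ?thesis"
          then have "x \<in> {x. \<exists>y. integral_between (\<lambda>t. \<bar>w t - g t\<bar>) x y > l * \<bar>y - x\<bar>}" by (auto simp: not_le)
          then show False using T1(2) x(1) by blast
        qed
        have 2: "\<bar>w x - g x\<bar> < l" using x(2) by (simp add: T2_def not_le)
        have "isCont g x" using smooth_continuous[OF test_smooth[OF g(1)], of UNIV] by (simp add: continuous_on_eq_continuous_at)
        then obtain \<delta> where \<delta>: "\<delta> > 0" "\<And>t. \<bar>t - x\<bar> < \<delta> \<Longrightarrow> \<bar>g t - g x\<bar> < l"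
          using l unfolding continuous_at_eps_delta by (auto simp: dist_real_def)
        have "\<bar>F y - F x - w x * (y - x)\<bar> \<le> 3 * l * \<bar>y - x\<bar>" if y: "\<bar>y - x\<bar> < \<delta>" for y
        proof -
          let ?I = "indicat_real {min x y..max x y}"
          have i: "integrable lborel (\<lambda>t. ?I t * w t)" "integrable lborel (\<lambda>t. ?I t * g t)"
            "integrable lborel (\<lambda>t. ?I t * \<bar>w t - g t\<bar>)"
            by (intro integral_between_integrable wi gi g(2))+
          have c: "integrable lborel (\<lambda>t. ?I t * c)" "(LINT t|lborel. ?I t * c) = c * \<bar>y - x\<bar>" for c
            using integral_between_const[of "min x y" "max x y" c] integral_between_const(2)[of c x y] by (auto simp: integral_between_def)
          have eq: "integral_between w x y - w x * \<bar>y - x\<bar> = (LINT t|lborel. ?I t * w t - ?I t * w x)"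
            unfolding Bochner_Integration.integral_diff[OF i(1) c(1)] c(2) integral_between_def by (rule refl)
          have "\<bar>LINT t|lborel. ?I t * w t - ?I t * w x\<bar> \<le> (LINT t|lborel. \<bar>?I t * w t - ?I t * w x\<bar>)" by (rule integral_abs_bound)
          also have "\<dots> \<le> (LINT t|lborel. ?I t * \<bar>w t - g t\<bar> + ?I t * (2 * l))"
          proof (rule integral_mono)
            show "integrable lborel (\<lambda>t. \<bar>?I t * w t - ?I t * w x\<bar>)"
              by (rule integrable_abs[OF Bochner_Integration.integrable_diff[OF i(1) c(1)]])
            show "integrable lborel (\<lambda>t. ?I t * \<bar>w t - g t\<bar> + ?I t * (2 * l))"
              by (rule Bochner_Integration.integrable_add[OF i(3) c(1)])
            fix t
            show "\<bar>?I t * w t - ?I t * w x\<bar> \<le> ?I t * \<bar>w t - g t\<bar> + ?I t * (2 * l)"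
            proof (cases "t \<in> {min x y..max x y}")
              case True
              then have "\<bar>t - x\<bar> < \<delta>" using y by (auto simp: min_def max_def split: if_splits)
              then have "\<bar>g t - g x\<bar> < l" using \<delta>(2) by blast
              then show ?thesis using True 2 by simp
            qed simp
          qed
          also have "\<dots> = integral_between (\<lambda>t. \<bar>w t - g t\<bar>) x y + 2 * l * \<bar>y - x\<bar>"
            unfolding Bochner_Integration.integral_add[OF i(3) c(1)] c(2) integral_between_def by (rule refl)
          also have "\<dots> \<le> 3 * l * \<bar>y - x\<bar>" using 1[of y] by (simp add: algebra_simps)
          finally show ?thesis unfolding Fseg eq .
        qed
        then have "\<forall>\<^sub>F y in at x. \<bar>F y - F x - w x * (y - x)\<bar> \<le> 3 * l * \<bar>y - x\<bar>"
          unfolding eventually_at using \<delta>(1) by (auto simp: dist_real_def)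
        then show ?thesis by (simp add: Bad_def)
      qed
      then have "Bad \<subseteq> T1 \<union> T2" by blast
      with em show ?thesis using T1(1) T2m by (intro bexI[of _ "T1 \<union> T2"]) auto
    qed
    then have "\<forall>n::nat. \<exists>T\<in>sets lborel. Bad \<subseteq> T \<and> emeasure lborel T \<le> ennreal (11 / l * inverse (Suc n))"
      by simp
    then obtain T where T: "\<And>n::nat. T n \<in> sets lborel" "\<And>n. Bad \<subseteq> T n"
      "\<And>n. emeasure lborel (T n) \<le> ennreal (11 / l * inverse (Suc n))" by metis
    define N where "N = (\<Inter>n. T n)"
    have Nm: "N \<in> sets lborel" unfolding N_def using T(1) by (intro sets.countable_INT') auto
    have le: "emeasure lborel N \<le> ennreal (11 / l * inverse (Suc n))" for n
      using emeasure_mono[of N "T n" lborel] T(1,3)[of n] by (auto simp: N_def intro: order_trans)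
    have "(\<lambda>n. ennreal (11 / l * inverse (Suc n))) \<longlonglongrightarrow> ennreal (11 / l * 0)"
      by (intro tendsto_ennrealI tendsto_mult tendsto_const LIMSEQ_inverse_real_of_nat)
    then have "emeasure lborel N \<le> ennreal (11 / l * 0)"
      by (rule LIMSEQ_le_const) (use le in blast)
    then have "N \<in> null_sets lborel" using Nm by (auto simp: null_sets_def)
    moreover have "Bad \<subseteq> N" using T(2) by (auto simp: N_def)
    ultimately show ?thesis unfolding Bad_def by blast
  qed
  have "AE x in lborel. \<forall>\<^sub>F y in at x. \<bar>F y - F x - w x * (y - x)\<bar> \<le> 3 * inverse (Suc n) * \<bar>y - x\<bar>" for n :: nat
  proof -
    obtain N where "N \<in> null_sets lborel" "{x. \<not> (\<forall>\<^sub>F y in at x. \<bar>F y - F x - w x * (y - x)\<bar> \<le> 3 * inverse (Suc n) * \<bar>y - x\<bar>)} \<subseteq> N"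
      using nul[of "inverse (Suc n)"] by auto
    then show ?thesis by (intro AE_I'[of N]) auto
  qed
  then have "AE x in lborel. \<forall>n::nat. \<forall>\<^sub>F y in at x. \<bar>F y - F x - w x * (y - x)\<bar> \<le> 3 * inverse (Suc n) * \<bar>y - x\<bar>"
    unfolding AE_all_countable by blast
  then show ?thesis
  proof eventually_elim
    case (elim x)
    show ?case
      unfolding has_field_derivative_iff
    proof (rule LIM_I)
      fix r :: real assume "r > 0"
      then have "r / 3 > 0" by simp
      then obtain n :: nat where n: "inverse (real (Suc n)) < r / 3" using reals_Archimedean by blast
      obtain s where s: "s > 0" "\<And>y. y \<noteq> x \<Longrightarrow> \<bar>y - x\<bar> < s \<Longrightarrow> \<bar>F y - F x - w x * (y - x)\<bar> \<le> 3 * inverse (Suc n) * \<bar>y - x\<bar>"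
        using elim[rule_format, of n] unfolding eventually_at by (auto simp: dist_real_def)
      show "\<exists>s>0. \<forall>y. y \<noteq> x \<and> norm (y - x) < s \<longrightarrow> norm ((F y - F x) / (y - x) - w x) < r"
      proof (intro exI[of _ s] conjI allI impI s(1))
        fix y assume y: "y \<noteq> x \<and> norm (y - x) < s"
        have "\<bar>(F y - F x) / (y - x) - w x\<bar> = \<bar>F y - F x - w x * (y - x)\<bar> / \<bar>y - x\<bar>"
          using y by (simp add: field_simps flip: abs_divide)
        also have "\<dots> \<le> 3 * inverse (Suc n)" using s(2)[of y] y by (simp add: divide_le_eq)
        also have "\<dots> < r" using n by simp
        finally show "norm ((F y - F x) / (y - x) - w x) < r" by simp
      qed
    qed
  qed
qed

section \<open>Traces on a graph\<close>

lemma L2tends_diff: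
  assumes "L2tends M s l" "L2tends M s' l'"
  shows "L2tends M (\<lambda>k x. s k x - s' k x) (\<lambda>x. l x - l' x)"
  using L2tends_add[OF assms(1) L2tends_scale[OF assms(2), of "-1"]] by simp

lemma L2_restrict:
  assumes "u \<in> L2_space lebesgue" "S \<in> sets lebesgue"
  shows "u \<in> L2_space (lebesgue_on S)"
    and "(LINT x|lebesgue_on S. (u x)\<^sup>2) \<le> sq_norm lebesgue u"
proof -
  have i: "integrable lebesgue (\<lambda>x. (u x)\<^sup>2)" using assms(1) by (rule L2_integrable_sq)
  have i': "integrable lebesgue (\<lambda>x. indicator S x *\<^sub>R (u x)\<^sup>2)"
    using integrable_mult_indicator[OF assms(2) i] .
  then have "integrable (lebesgue_on S) (\<lambda>x. (u x)\<^sup>2)"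
    by (subst integrable_restrict_space) (use assms(2) in auto)
  moreover have "u \<in> borel_measurable (lebesgue_on S)"
    by (rule measurable_restrict_space1[OF L2_measurable[OF assms(1)]])
  ultimately show "u \<in> L2_space (lebesgue_on S)" by (simp add: L2_space_def)
  have "(LINT x|lebesgue_on S. (u x)\<^sup>2) = (LINT x|lebesgue. indicator S x *\<^sub>R (u x)\<^sup>2)"
    by (rule integral_restrict_space) (use assms(2) in auto)
  also have "\<dots> \<le> sq_norm lebesgue u"
    by (intro integral_mono i i') (auto simp: indicator_def)
  finally show "(LINT x|lebesgue_on S. (u x)\<^sup>2) \<le> sq_norm lebesgue u" .
qed

lemma L2tends_restrict:
  assumes "L2tends lebesgue s l" "S \<in> sets lebesgue"
  shows "L2tends (lebesgue_on S) s l"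
proof -
  note D = L2tends_D[OF assms(1)]
  have "(\<lambda>k. LINT x|lebesgue_on S. (s k x - l x)\<^sup>2) \<longlonglongrightarrow> 0"
    by (rule tendsto_0_nonneg_le[OF D(3) _ L2_restrict(2)[OF L2_diff(1)[OF D(1,2)] assms(2)]])
       (auto intro: integral_nonneg_AE)
  then show ?thesis using L2_restrict(1)[OF _ assms(2)] D by (simp add: L2tends_def)
qed

lemma L2tends_lborel_lebesgue:
  assumes "L2tends lborel s l" shows "L2tends lebesgue s l"
proof -
  note D = L2tends_D[OF assms]
  have m: "s k \<in> borel_measurable borel" "l \<in> borel_measurable borel" for k
    using L2_measurable[OF D(1)] L2_measurable[OF D(2)] by simp_all
  have "sq_dist lebesgue (s k) l = sq_dist lborel (s k) l" for k
    by (rule integral_completion) (use m in measurable)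
  then show ?thesis using D by (simp add: L2tends_def L2_completion[OF m(1)] L2_completion[OF m(2)])
qed

lemma L2tends_bounded_mult:
  assumes "L2tends M s l" "m \<in> borel_measurable M" "\<And>x. x \<in> space M \<Longrightarrow> \<bar>m x\<bar> \<le> B"
  shows "L2tends M (\<lambda>k x. m x * s k x) (\<lambda>x. m x * l x)"
proof -
  note D = L2tends_D[OF assms(1)]
  have b: "(m x * u x)\<^sup>2 \<le> B\<^sup>2 * (u x)\<^sup>2" if "x \<in> space M" for u x
    unfolding power_mult_distrib using assms(3)[OF that] by (intro mult_right_mono) (auto simp: abs_le_square_iff[symmetric])
  have L: "(\<lambda>x. m x * u x) \<in> L2_space M" "(LINT x|M. (m x * u x)\<^sup>2) \<le> B\<^sup>2 * sq_norm M u" if u: "u \<in> L2_space M" for u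
  proof -
    have [measurable]: "u \<in> borel_measurable M" using u by (rule L2_measurable)
    have i: "integrable M (\<lambda>x. B\<^sup>2 * (u x)\<^sup>2)" using u by (simp add: L2_integrable_sq)
    have "integrable M (\<lambda>x. (m x * u x)\<^sup>2)"
      by (rule Bochner_Integration.integrable_bound[OF i]) (use assms(2) b in \<open>auto intro!: AE_I2\<close>)
    then show "(\<lambda>x. m x * u x) \<in> L2_space M" using assms(2) by (simp add: L2_space_def)
    then have "(LINT x|M. (m x * u x)\<^sup>2) \<le> (LINT x|M. B\<^sup>2 * (u x)\<^sup>2)"
      by (intro integral_mono i L2_integrable_sq b)
    then show "(LINT x|M. (m x * u x)\<^sup>2) \<le> B\<^sup>2 * sq_norm M u" by simp
  qed
  have "(\<lambda>k. B\<^sup>2 * sq_dist M (s k) l) \<longlonglongrightarrow> 0"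
    using tendsto_mult[OF tendsto_const D(3)] by simp
  then have "(\<lambda>k. LINT x|M. (m x * (s k x - l x))\<^sup>2) \<longlonglongrightarrow> 0"
    by (rule tendsto_0_nonneg_le[OF _ _ L(2)[OF L2_diff(1)[OF D(1,2)]]]) (auto intro: integral_nonneg_AE)
  then show ?thesis using D L(1) by (simp add: L2tends_def right_diff_distrib)
qed

locale graph =
  fixes I :: "real set" and \<eta> :: "real \<Rightarrow> real"
  assumes open_I: "open I" and cont: "continuous_on I \<eta>"
begin

text \<open>Setting the restriction to \<open>0\<close> off \<open>I\<close> gives one square integrable function on the line in place of a family indexed by
the compact subintervals.\<close>

definition on_graph :: "(real \<times> real \<Rightarrow> real) \<Rightarrow> real \<Rightarrow> real" where
  "on_graph f x = indicator I x * f (x, \<eta> x)"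

lemma on_graph_measurable: assumes "test_function f" shows "on_graph f \<in> borel_measurable borel"
proof -
  have "continuous_on I (\<lambda>x. f (x, \<eta> x))"
    by (rule continuous_on_compose2[OF smooth_continuous[OF test_smooth[OF assms], of UNIV]])
       (auto intro!: continuous_intros cont)
  from borel_measurable_continuous_on_indicator[OF _ this] show ?thesis
    unfolding on_graph_def[abs_def] using open_I by simp
qed

lemma on_graph_L2:
  assumes f: "test_function f"
  shows "on_graph f \<in> L2_space lborel" "sq_norm lborel (on_graph f) \<le> energy H1_ix f"
proof -
  have "(\<integral>\<^sup>+x. ennreal ((on_graph f x)\<^sup>2) \<partial>lborel) \<le> (\<integral>\<^sup>+x. ennreal ((f (x, \<eta> x))\<^sup>2) \<partial>lborel)"
    by (intro nn_integral_mono ennreal_leI) (auto simp: on_graph_def indicator_def)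
  also have "\<dots> \<le> ennreal (energy H1_ix f)" by (rule trace_bound[OF f])
  finally have le: "(\<integral>\<^sup>+x. ennreal ((on_graph f x)\<^sup>2) \<partial>lborel) \<le> ennreal (energy H1_ix f)" .
  have i: "integrable lborel (\<lambda>x. (on_graph f x)\<^sup>2)"
    by (rule integrableI_bounded) (use le on_graph_measurable[OF f] in \<open>auto intro: order_le_less_trans\<close>)
  then show "on_graph f \<in> L2_space lborel" using on_graph_measurable[OF f] by (simp add: L2_space_def)
  show "sq_norm lborel (on_graph f) \<le> energy H1_ix f"
    by (rule integral_le_of_nn_integral[OF i _ le energy_nonneg]) simp
qed

lemma on_graph_diff: "on_graph (\<lambda>z. f z - g z) x = on_graph f x - on_graph g x"
  by (simp add: on_graph_def right_diff_distrib)

lemma H1_ix: "finite H1_ix" "bs \<in> H1_ix \<Longrightarrow> set bs \<subseteq> Basis"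
  by (auto simp: Basis_plane)

lemma H1_L2tends:
  assumes u: "u \<in> sobolev_H 1" and t: "\<And>k. test_function (\<psi> k)" and H: "tends_in_H1 \<psi> u"
    and bs: "bs \<in> H1_ix"
  shows "L2tends lebesgue (\<lambda>k. partials bs (\<psi> k)) (if bs = [] then u else wderiv bs u)"
proof (cases "bs = []")
  case True
  have "u \<in> L2_space lebesgue" using u by (simp add: sobolev_H_def)
  then show ?thesis using True H t test_L2 by (auto simp: L2tends_def tends_in_H1_def L2_norm_tendsto_iff)
next
  case False
  then obtain b where b: "bs = [b]" "b \<in> Basis" using bs Basis_plane by auto
  have "wderiv bs u \<in> L2_space lebesgue" using sobolev_wderiv(2)[OF u, of bs] b by simp
  moreover have "(\<lambda>k. sq_dist lebesgue (partials [b] (\<psi> k)) (wderiv [b] u)) \<longlonglongrightarrow> 0"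
    using H b(2) unfolding tends_in_H1_def L2_norm_tendsto_iff by blast
  moreover have "partials bs (\<psi> k) \<in> L2_space lebesgue" for k
    by (rule test_L2[OF test_partials[OF t]]) (use b in auto)
  ultimately show ?thesis using False b(1) by (simp add: L2tends_def)
qed

lemma graph_L2tends:
  assumes g: "L2tends lborel (\<lambda>k. on_graph (\<psi> k)) g" and K: "{a..b} \<subseteq> I"
  shows "L2tends (lebesgue_on {a..b}) (\<lambda>k x. \<psi> k (x, \<eta> x)) g"
proof -
  have L: "L2tends (lebesgue_on {a..b}) (\<lambda>k. on_graph (\<psi> k)) g"
    by (rule L2tends_restrict[OF L2tends_lborel_lebesgue[OF g]]) simp
  have eq: "on_graph (\<psi> k) x = \<psi> k (x, \<eta> x)" if "x \<in> space (lebesgue_on {a..b})" for k x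
    using that K by (auto simp: on_graph_def)
  show ?thesis
  proof (rule L2tends_cong_AE[OF L])
    show "(\<lambda>x. \<psi> k (x, \<eta> x)) \<in> borel_measurable (lebesgue_on {a..b})" for k
      using L2_measurable[OF L2tends_D(1)[OF L, of k]] by (subst measurable_cong[OF eq[symmetric]])
    show "AE x in lebesgue_on {a..b}. on_graph (\<psi> k) x = \<psi> k (x, \<eta> x)" for k
      by (rule AE_I2) (rule eq)
    show "g \<in> borel_measurable (lebesgue_on {a..b})" by (rule L2_measurable[OF L2tends_D(2)[OF L]])
  qed simp
qed

lemma trace_limit_exists:
  assumes u: "u \<in> sobolev_H 1" and t: "\<And>k. test_function (\<psi> k)" and H: "tends_in_H1 \<psi> u"
  obtains g where "L2tends lborel (\<lambda>k. on_graph (\<psi> k)) g"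
proof -
  have "L2Cauchy lborel (\<lambda>k. on_graph (\<psi> k))"
    unfolding L2Cauchy_def
  proof (intro conjI allI impI)
    show "on_graph (\<psi> k) \<in> L2_space lborel" for k by (rule on_graph_L2(1)[OF t])
    fix e :: real assume e: "e > 0"
    have C: "L2Cauchy lebesgue (\<lambda>k. partials bs (\<psi> k))" if "bs \<in> H1_ix" for bs
      by (rule L2tends_imp_Cauchy[OF H1_L2tends[OF u t H that]])
    obtain N where N: "\<And>m n. m \<ge> N \<Longrightarrow> n \<ge> N \<Longrightarrow> energy H1_ix (\<lambda>z. \<psi> m z - \<psi> n z) < e"
      using energy_Cauchy[of \<psi> H1_ix, OF t H1_ix C e] by blast
    show "\<exists>N. \<forall>m\<ge>N. \<forall>n\<ge>N. sq_dist lborel (on_graph (\<psi> m)) (on_graph (\<psi> n)) < e"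
    proof (intro exI[of _ N] allI impI)
      fix m n assume "m \<ge> N" "n \<ge> N"
      then show "sq_dist lborel (on_graph (\<psi> m)) (on_graph (\<psi> n)) < e"
        using on_graph_L2(2)[OF test_diff[OF t[of m] t[of n]]] N unfolding on_graph_diff by fastforce
    qed
  qed
  then show ?thesis using L2_complete that by blast
qed

text \<open>Since \<open>graph_trace\<close> is an arbitrary choice, its meaning rests on the existence of some trace.\<close>

lemma graph_trace_works:
  assumes u: "u \<in> sobolev_H 1" and t: "\<And>k. test_function (\<psi> k)" and H: "tends_in_H1 \<psi> u"
  shows "has_graph_trace I \<eta> u (graph_trace I \<eta> u)"
proof -
  obtain g where g: "L2tends lborel (\<lambda>k. on_graph (\<psi> k)) g" using trace_limit_exists[OF assms] .
  have "has_graph_trace I \<eta> u g"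
    unfolding has_graph_trace_def
  proof (intro conjI u exI[of _ \<psi>] allI impI t H)
    fix a b assume K: "{a..b} \<subseteq> I"
    note D = L2tends_D[OF graph_L2tends[OF g K]]
    show "g \<in> L2_space (lebesgue_on {a..b})" by (rule D(2))
    show "(\<lambda>k. L2_norm (lebesgue_on {a..b}) (\<lambda>x. \<psi> k (x, \<eta> x) - g x)) \<longlonglongrightarrow> 0"
      unfolding L2_norm_tendsto_iff by (rule D(3))
  qed
  then show ?thesis unfolding graph_trace_def by (rule someI[of "has_graph_trace I \<eta> u"])
qed

text \<open>The chosen trace comes with its own approximating sequence. The difference of two sequences with the
same \<open>H\<^sup>1\<close> limit tends to \<open>0\<close> in energy, so by \<open>trace_bound\<close> also on the graph.\<close>

lemma graph_trace_L2tends: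
  assumes u: "u \<in> sobolev_H 1" and t: "\<And>k. test_function (\<psi> k)" and H: "tends_in_H1 \<psi> u"
    and K: "{a..b} \<subseteq> I"
  shows "L2tends (lebesgue_on {a..b}) (\<lambda>k x. \<psi> k (x, \<eta> x)) (graph_trace I \<eta> u)"
proof -
  let ?M = "lebesgue_on {a..b}" and ?T = "graph_trace I \<eta> u"
  obtain g where g: "L2tends lborel (\<lambda>k. on_graph (\<psi> k)) g" using trace_limit_exists[OF u t H] .
  have Lg: "L2tends ?M (\<lambda>k x. \<psi> k (x, \<eta> x)) g" by (rule graph_L2tends[OF g K])
  obtain \<theta> where \<theta>: "\<And>k. test_function (\<theta> k)" "tends_in_H1 \<theta> u"
    "?T \<in> L2_space ?M" "(\<lambda>k. L2_norm ?M (\<lambda>x. \<theta> k (x, \<eta> x) - ?T x)) \<longlonglongrightarrow> 0"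
    using graph_trace_works[OF u t H] K unfolding has_graph_trace_def by blast
  obtain g' where g': "L2tends lborel (\<lambda>k. on_graph (\<theta> k)) g'" using trace_limit_exists[OF u \<theta>(1,2)] .
  have L\<theta>: "L2tends ?M (\<lambda>k x. \<theta> k (x, \<eta> x)) ?T"
    using L2tends_D(1)[OF graph_L2tends[OF g' K]] \<theta>(3,4) by (simp add: L2tends_def L2_norm_tendsto_iff)
  have E: "(\<lambda>k. energy H1_ix (\<lambda>z. \<psi> k z - \<theta> k z)) \<longlonglongrightarrow> 0"
  proof -
    have "(\<lambda>k. LINT z|lebesgue. (partials bs (\<lambda>z. \<psi> k z - \<theta> k z) z)\<^sup>2) \<longlonglongrightarrow> 0" if bs: "bs \<in> H1_ix" for bs
      using L2tends_D(3)[OF L2tends_diff[OF H1_L2tends[OF u t H bs] H1_L2tends[OF u \<theta>(1,2) bs]]]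
      unfolding partials_diff[OF test_smooth[OF t] test_smooth[OF \<theta>(1)] H1_ix(2)[OF bs]] by simp
    from tendsto_sum[of H1_ix "\<lambda>bs k. LINT z|lebesgue. (partials bs (\<lambda>z. \<psi> k z - \<theta> k z) z)\<^sup>2" "\<lambda>_. 0", OF this]
    show ?thesis unfolding energy_def by simp
  qed
  have Z: "L2tends ?M (\<lambda>k x. \<psi> k (x, \<eta> x) - \<theta> k (x, \<eta> x)) (\<lambda>x. 0)"
  proof (rule graph_L2tends[OF _ K])
    have td: "test_function (\<lambda>z. \<psi> k z - \<theta> k z)" for k by (rule test_diff[OF t \<theta>(1)])
    have "(\<lambda>k. LINT x|lborel. (on_graph (\<lambda>z. \<psi> k z - \<theta> k z) x - 0)\<^sup>2) \<longlonglongrightarrow> 0"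
      by (rule tendsto_0_nonneg_le[OF E]) (auto intro: integral_nonneg_AE on_graph_L2(2) td)
    then show "L2tends lborel (\<lambda>k. on_graph (\<lambda>z. \<psi> k z - \<theta> k z)) (\<lambda>x. 0)"
      using on_graph_L2(1)[OF td] by (auto simp: L2tends_def L2_space_def)
  qed
  have "AE x in ?M. g x - ?T x = 0"
    by (rule L2tends_unique[OF L2tends_diff[OF Lg L\<theta>] Z])
  then have ae: "AE x in ?M. g x = ?T x" by eventually_elim simp
  show ?thesis
    by (rule L2tends_cong_AE[OF Lg L2_measurable[OF L2tends_D(1)[OF Lg]] L2_measurable[OF \<theta>(3)] _ ae]) simp
qed

end

text \<open>The fundamental theorem of calculus passes to the limit: the increments converge because mean square
convergence on a bounded interval implies convergence of integrals, and one point of convergence of \<open>f\<close>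
fixes the additive constant.\<close>

lemma absolutely_continuous_limit:
  fixes f :: "nat \<Rightarrow> real \<Rightarrow> real"
  assumes ab: "a < b"
    and ftc: "\<And>k x y. a \<le> x \<Longrightarrow> x \<le> y \<Longrightarrow> y \<le> b \<Longrightarrow>
      f k y - f k x = (LINT t|lebesgue_on {a..b}. d k t * indicator {x..y} t)"
    and f: "L2tends (lebesgue_on {a..b}) f f0" and d: "L2tends (lebesgue_on {a..b}) d d0"
  obtains F where "continuous_on UNIV F" "AE x in lebesgue_on {a..b}. f0 x = F x"
    "AE x in lebesgue_on {a..b}. (F has_real_derivative d0 x) (at x)"
proof -
  let ?M = "lebesgue_on {a..b}"
  have d0L: "d0 \<in> L2_space ?M" using d by (simp add: L2tends_def)
  have "(\<lambda>t. indicator {a..b} t *\<^sub>R d0 t) \<in> borel_measurable lebesgue"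
    using L2_measurable[OF d0L] by (subst borel_measurable_restrict_space_iff[symmetric]) auto
  then obtain W0 where W0: "W0 \<in> borel_measurable lborel" "AE t in lborel. indicator {a..b} t *\<^sub>R d0 t = W0 t"
    using completion_ex_borel_measurable_real by blast
  define W where "W = (\<lambda>t. indicator {a..b} t * W0 t)"
  have Wm[measurable]: "W \<in> borel_measurable borel" using W0(1) unfolding W_def by simp
  have Wz: "W t = 0" if "t \<notin> {a..b}" for t using that by (simp add: W_def)
  have "AE t in lborel. t \<in> {a..b} \<longrightarrow> d0 t = W t"
    using W0(2)
  proof eventually_elim
    case (elim t) then show ?case by (cases "t \<in> {a..b}") (auto simp: W_def)
  qed
  then have "AE t in lebesgue. t \<in> {a..b} \<longrightarrow> d0 t = W t" by (rule AE_completion)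
  then have dW: "AE t in ?M. d0 t = W t" by (simp add: AE_restrict_space_iff)
  have WmM: "W \<in> borel_measurable ?M"
    by (rule measurable_restrict_space1) (simp add: measurable_completion)
  have "W \<in> L2_space ?M" by (rule L2_cong_AE[OF d0L dW WmM])
  then have "integrable ?M (\<lambda>t. (W t)\<^sup>2)" by (rule L2_integrable_sq)
  then have "integrable lebesgue (\<lambda>t. indicator {a..b} t *\<^sub>R (W t)\<^sup>2)"
    by (subst (asm) integrable_restrict_space) auto
  moreover have "indicator {a..b} t *\<^sub>R (W t)\<^sup>2 = (W t)\<^sup>2" for t by (simp add: W_def indicator_def)
  ultimately have "integrable lebesgue (\<lambda>t. (W t)\<^sup>2)" by (simp only:)
  then have WL: "W \<in> L2_space lborel" by (simp add: L2_space_def integrable_completion)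
  have IL: "indicat_real {x..y} \<in> L2_space lborel" "sq_norm lborel (indicat_real {x..y}) = (if x \<le> y then y - x else 0)" for x y :: real
  proof -
    have sq: "(\<lambda>t. (indicat_real {x..y} t)\<^sup>2) = indicat_real {x..y}" by (auto simp: indicator_def)
    then show "indicat_real {x..y} \<in> L2_space lborel"
      using integral_between_const(1)[of x y 1] by (simp add: L2_space_def)
    show "sq_norm lborel (indicat_real {x..y}) = (if x \<le> y then y - x else 0)" unfolding sq by auto
  qed
  have Wi: "integrable lborel W"
  proof -
    have "(\<lambda>t. indicator {a..b} t * W t) = W" by (auto simp: W_def indicator_def)
    then show ?thesis using L2_mult_integrable[OF IL(1) WL, of a b] by simp
  qed
  define G where "G = (\<lambda>x. LINT t|lborel. indicator {..x} t * W t)"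
  have Gi: "integrable lborel (\<lambda>t. indicator {..x} t * W t)" for x
    using integrable_mult_indicator[of "{..x}" lborel W] Wi by simp
  have G: "G y - G x = (LINT t|lborel. indicator {x..y} t * W t)" if "x \<le> y" for x y
  proof -
    have "G y - G x = (LINT t|lborel. indicator {..y} t * W t - indicator {..x} t * W t)"
      using Gi by (simp add: G_def)
    also have "\<dots> = (LINT t|lborel. indicator {x..y} t * W t)"
    proof (rule integral_cong_AE)
      show "AE t in lborel. indicator {..y} t * W t - indicator {..x} t * W t = indicator {x..y} t * W t"
        using AE_lborel_singleton[of x] by eventually_elim (use that in \<open>auto simp: indicator_def\<close>)
    qed auto
    finally show ?thesis .
  qed
  have Gd: "AE x in lborel. (G has_real_derivative W x) (at x)"
    by (rule Lebesgue_differentiation[OF WL Wz G])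
  define Q where "Q = sq_norm lborel W"
  have Q: "Q \<ge> 0" unfolding Q_def by (intro integral_nonneg_AE) auto
  have Gb: "(G y - G x)\<^sup>2 \<le> \<bar>y - x\<bar> * Q" for x y
  proof -
    have *: "(G y - G x)\<^sup>2 \<le> (y - x) * Q" if "x \<le> y" for x y
      using L2_Cauchy_Schwarz[OF IL(1)[of x y] WL] IL(2)[of x y] that unfolding G[OF that] Q_def by simp
    show ?thesis using *[of x y] *[of y x] by (cases "x \<le> y") (auto simp: power2_commute)
  qed
  have Gc: "continuous_on UNIV G"
    unfolding continuous_on_eq_continuous_at[OF open_UNIV]
  proof
    fix x
    have "(\<lambda>y. \<bar>y - x\<bar> * Q) \<midarrow>x\<rightarrow> \<bar>x - x\<bar> * Q" by (intro tendsto_intros)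
    then have "(\<lambda>y. sqrt (\<bar>y - x\<bar> * Q)) \<midarrow>x\<rightarrow> sqrt 0" by (intro tendsto_real_sqrt) simp
    then have "(\<lambda>y. sqrt (\<bar>y - x\<bar> * Q)) \<midarrow>x\<rightarrow> 0" by simp
    then have "(\<lambda>y. G y - G x) \<midarrow>x\<rightarrow> 0"
      by (rule Lim_null_comparison[rotated])
         (use Gb in \<open>auto intro!: always_eventually real_le_rsqrt\<close>)
    then show "isCont G x" unfolding isCont_def using LIM_zero_iff by blast
  qed
  obtain r where r: "strict_mono r" "AE x in ?M. (\<lambda>n. f (r n) x) \<longlonglongrightarrow> f0 x"
    using L2tends_AE_subseq[OF f] .
  have lim: "(\<lambda>n. f (r n) y - f (r n) x) \<longlonglongrightarrow> G y - G x" if xy: "a \<le> x" "x \<le> y" "y \<le> b" for x y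
  proof -
    have "indicat_real {x..y} \<in> L2_space ?M"
      by (rule L2_restrict(1)) (use IL(1)[of x y] L2_completion[of "indicat_real {x..y}"] in auto)
    from L2tends_integral_mult[OF L2tends_subseq[OF d r(1)] this]
    have "(\<lambda>n. f (r n) y - f (r n) x) \<longlonglongrightarrow> (LINT t|?M. d0 t * indicator {x..y} t)"
      using ftc[OF xy] by simp
    also have "(LINT t|?M. d0 t * indicator {x..y} t) = (LINT t|?M. indicator {x..y} t * W t)"
    proof (rule integral_cong_AE)
      show "AE t in ?M. d0 t * indicator {x..y} t = indicator {x..y} t * W t"
        using dW by eventually_elim simp
      have i: "indicat_real {x..y} \<in> borel_measurable ?M"
        by (rule measurable_restrict_space1) (simp add: measurable_completion)
      show "(\<lambda>t. d0 t * indicator {x..y} t) \<in> borel_measurable ?M" "(\<lambda>t. indicator {x..y} t * W t) \<in> borel_measurable ?M"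
        by (intro borel_measurable_times i WmM L2_measurable[OF d0L])+
    qed
    also have "\<dots> = (LINT t|lebesgue. indicator {a..b} t *\<^sub>R (indicator {x..y} t * W t))"
      by (rule integral_restrict_space) simp
    also have "\<dots> = (LINT t|lebesgue. indicator {x..y} t * W t)"
      by (rule Bochner_Integration.integral_cong) (auto simp: W_def indicator_def)
    also have "\<dots> = (LINT t|lborel. indicator {x..y} t * W t)"
      by (rule integral_completion) measurable
    finally show ?thesis by (simp add: G[OF xy(2)])
  qed
  have "\<exists>c\<in>{a..b}. (\<lambda>n. f (r n) c) \<longlonglongrightarrow> f0 c"
  proof (rule ccontr)
    assume "\<not> ?thesis"
    then have "AE x in lebesgue. x \<notin> {a..b}"
      using r(2) by (auto simp: AE_restrict_space_iff elim!: eventually_mono)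
    then have "{a..b} \<in> null_sets lebesgue" by (subst AE_iff_null_sets) auto
    then show False using ab by (simp add: null_sets_def)
  qed
  then obtain c where c: "c \<in> {a..b}" "(\<lambda>n. f (r n) c) \<longlonglongrightarrow> f0 c" by blast
  define F where "F = (\<lambda>x. f0 c - G c + G x)"
  show ?thesis
  proof (rule that[of F])
    show "continuous_on UNIV F" unfolding F_def by (intro continuous_intros Gc)
    show "AE x in ?M. f0 x = F x"
      using r(2) AE_space
    proof eventually_elim
      case (elim x)
      then have x: "x \<in> {a..b}" by simp
      have "(\<lambda>n. f (r n) x - f (r n) c) \<longlonglongrightarrow> G x - G c"
      proof (cases "c \<le> x")
        case True then show ?thesis using lim[of c x] x c by simp
      next
        case False
        then have "(\<lambda>n. - (f (r n) c - f (r n) x)) \<longlonglongrightarrow> - (G c - G x)"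
          using lim[of x c] x c by (intro tendsto_minus) simp
        then show ?thesis by simp
      qed
      from tendsto_add[OF c(2) this] have "(\<lambda>n. f (r n) x) \<longlonglongrightarrow> f0 c + (G x - G c)" by simp
      moreover have "f0 c + (G x - G c) = F x" by (simp add: F_def)
      ultimately have "(\<lambda>n. f (r n) x) \<longlonglongrightarrow> F x" by (simp only:)
      then show ?case using elim(1) LIMSEQ_unique by blast
    qed
    have "AE x in lebesgue. (G has_real_derivative W x) (at x)" using Gd by (rule AE_completion)
    then have "AE x in ?M. (G has_real_derivative W x) (at x)"
      by (simp add: AE_restrict_space_iff) (auto elim: eventually_mono)
    with dW show "AE x in ?M. (F has_real_derivative d0 x) (at x)"
    proof eventually_elim
      case (elim x)
      then show ?case unfolding F_def using DERIV_add[OF DERIV_const elim(2)] by simp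
    qed
  qed
qed

section \<open>The normal derivative of the squared gradient\<close>

lemma C11_deriv_continuous:
  assumes "open I" "C11_on I \<eta>" "x \<in> I"
  shows "(\<eta> has_real_derivative deriv \<eta> x) (at x)" "isCont (deriv \<eta>) x"
proof -
  have "\<eta> differentiable (at x)" using assms by (auto simp: C11_on_def)
  then show "(\<eta> has_real_derivative deriv \<eta> x) (at x)"
    by (simp add: DERIV_deriv_iff_real_differentiable)
  obtain e L where e: "e > 0" "L-lipschitz_on (cball x e \<inter> I) (deriv \<eta>)"
    using assms by (auto simp: C11_on_def)
  have c: "continuous_on (ball x e \<inter> I) (deriv \<eta>)"
    by (rule continuous_on_subset[OF lipschitz_on_continuous_on[OF e(2)]]) auto
  have "open (ball x e \<inter> I)" "x \<in> ball x e \<inter> I" using e(1) assms by auto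
  then show "isCont (deriv \<eta>) x" using c continuous_on_eq_continuous_at by blast
qed

text \<open>The set where a continuous function does not vanish is open, so it is not negligible unless it is empty.\<close>

lemma continuous_AE_zero:
  fixes h :: "real \<Rightarrow> real"
  assumes "continuous_on {a<..<b} h" "AE x in lebesgue. x \<in> {a<..<b} \<longrightarrow> h x = 0" "x \<in> {a<..<b}"
  shows "h x = 0"
proof (rule ccontr)
  assume "h x \<noteq> 0"
  define U where "U = {a<..<b} \<inter> h -` (- {0})"
  have "open U" unfolding U_def by (rule continuous_open_preimage[OF assms(1)]) auto
  moreover have "x \<in> U" using assms(3) \<open>h x \<noteq> 0\<close> by (simp add: U_def)
  ultimately have "\<not> negligible U" using open_not_negligible by blast
  moreover have "AE x in lebesgue. x \<notin> U" using assms(2) by eventually_elim (auto simp: U_def)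
  then have "U \<in> null_sets lebesgue" using \<open>open U\<close> by (subst AE_iff_null_sets) auto
  then have "negligible U" by (simp add: negligible_iff_null_sets)
  ultimately show False by blast
qed

text \<open>The calculation at the heart of the theorem, at one point \<open>x\<close>. Here \<open>p\<close>, \<open>q\<close>, \<open>s\<close> are the second
derivatives of the potential, and \<open>F\<close>, \<open>G\<close> its first derivatives along the graph. The
slope \<open>G / F\<close> is differentiable at \<open>x\<close> if \<open>F x \<noteq> 0\<close>; if \<open>F x = 0\<close>, both sides vanish.\<close>

lemma curvature_identity:
  fixes F G :: "real \<Rightarrow> real"
  assumes ab: "x \<in> {a<..<b}"
    and FG: "\<And>y. y \<in> {a<..<b} \<Longrightarrow> G y = deriv \<eta> y * F y"
    and F: "(F has_real_derivative p + deriv \<eta> x * q) (at x)"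
    and G: "(G has_real_derivative q + deriv \<eta> x * s) (at x)"
  shows "unit_normal \<eta> x \<bullet> (2 * (F x * p + G x * q), 2 * (F x * q + G x * s))
    = 2 * curvature \<eta> x * ((F x)\<^sup>2 + (G x)\<^sup>2)"
proof (cases "F x = 0")
  case True
  then show ?thesis using FG[OF ab] by (simp add: unit_normal_def)
next
  case False
  \<comment> \<open>The quotient rule for \<open>G / F\<close>; the point \<open>x\<close> turns out to be one where the slope is differentiable.\<close>
  define m where "m = ((q + deriv \<eta> x * s) * F x - G x * (p + deriv \<eta> x * q)) / (F x * F x)"
  define N where "N = sqrt (1 + (deriv \<eta> x)\<^sup>2)"
  have N: "N > 0" "N\<^sup>2 = 1 + (deriv \<eta> x)\<^sup>2" by (simp_all add: N_def add_pos_nonneg)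
  have Fc: "isCont F x" using F DERIV_isCont by blast
  have "eventually (\<lambda>y. F y \<noteq> 0) (at x)"
    using Fc False unfolding isCont_def by (rule tendsto_imp_eventually_ne)
  moreover have "eventually (\<lambda>y. y \<in> {a<..<b}) (at x)"
    using ab by (intro eventually_at_in_open') auto
  ultimately have "eventually (\<lambda>y. G y / F y = deriv \<eta> y) (at x)"
    by eventually_elim (simp add: FG)
  then have "eventually (\<lambda>y. G y / F y = deriv \<eta> y) (nhds x)"
    unfolding eventually_at_filter[symmetric] eventually_nhds_conv_at using False FG[OF ab] by simp
  moreover have "((\<lambda>y. G y / F y) has_real_derivative m) (at x)"
    unfolding m_def by (rule DERIV_divide[OF G F False])
  ultimately have d: "(deriv \<eta> has_real_derivative m) (at x)"
    by (subst (asm) DERIV_cong_ev[OF refl _ refl]) auto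
  have "((\<lambda>x. deriv \<eta> x / sqrt (1 + (deriv \<eta> x)\<^sup>2)) has_real_derivative m / N ^ 3) (at x)"
  proof -
    have pos: "1 + (deriv \<eta> x)\<^sup>2 > 0" by (simp add: add_pos_nonneg)
    have "((\<lambda>x. 1 + (deriv \<eta> x)\<^sup>2) has_real_derivative 2 * deriv \<eta> x * m) (at x)"
      using d by (auto intro!: derivative_eq_intros)
    then have "((\<lambda>x. sqrt (1 + (deriv \<eta> x)\<^sup>2)) has_real_derivative (inverse N / 2) * (2 * deriv \<eta> x * m)) (at x)"
      unfolding N_def by (rule DERIV_chain2[where f = sqrt and g = "\<lambda>x. 1 + (deriv \<eta> x)\<^sup>2" and x = x, OF DERIV_real_sqrt[OF pos]])
    then have "((\<lambda>x. deriv \<eta> x / sqrt (1 + (deriv \<eta> x)\<^sup>2)) has_real_derivative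
      (m * N - deriv \<eta> x * ((inverse N / 2) * (2 * deriv \<eta> x * m))) / (N * N)) (at x)"
      using N(1) unfolding N_def by (intro DERIV_divide[OF d]) auto
    moreover have "(m * N - deriv \<eta> x * ((inverse N / 2) * (2 * deriv \<eta> x * m))) / (N * N) = m / N ^ 3"
    proof -
      have "m * N - deriv \<eta> x * ((inverse N / 2) * (2 * deriv \<eta> x * m)) = m * (N\<^sup>2 - (deriv \<eta> x)\<^sup>2) / N"
        using N(1) by (simp add: field_simps power2_eq_square)
      also have "\<dots> = m / N" by (simp add: N(2))
      finally show ?thesis using N(1) by (simp add: power3_eq_cube)
    qed
    ultimately show ?thesis by simp
  qed
  then have \<kappa>: "curvature \<eta> x = m / N ^ 3" unfolding curvature_def by (rule DERIV_imp_deriv)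
  have mF: "m * F x = q + deriv \<eta> x * s - deriv \<eta> x * (p + deriv \<eta> x * q)"
    using False by (simp add: m_def FG[OF ab] field_simps)
  have "unit_normal \<eta> x \<bullet> (2 * (F x * p + G x * q), 2 * (F x * q + G x * s))
     = (2 * F x / N) * (q + deriv \<eta> x * s - deriv \<eta> x * (p + deriv \<eta> x * q))"
    using N(1) by (simp add: unit_normal_def N_def[symmetric] FG[OF ab] field_simps)
  also have "\<dots> = 2 * m * (F x)\<^sup>2 / N" unfolding mF[symmetric] by (simp add: power2_eq_square)
  also have "\<dots> = 2 * curvature \<eta> x * ((F x)\<^sup>2 + (G x)\<^sup>2)"
  proof -
    have "(F x)\<^sup>2 + (G x)\<^sup>2 = (F x)\<^sup>2 * N\<^sup>2" by (simp add: FG[OF ab] N(2) power_mult_distrib algebra_simps)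
    then show ?thesis using N(1) by (simp add: \<kappa> power2_eq_square power3_eq_cube)
  qed
  finally show ?thesis .
qed

lemma grad_sq_eq: "grad_sq u z = (wderiv [(1, 0)] u z)\<^sup>2 + (wderiv [(0, 1)] u z)\<^sup>2"
  by (simp add: grad_sq_def norm_Pair)

lemma mixed_ix: "finite mixed_ix" "bs \<in> mixed_ix \<Longrightarrow> set bs \<subseteq> Basis" "bs \<in> mixed_ix \<Longrightarrow> length bs \<le> 2"
  by (auto simp: Basis_plane)

lemma partial_sum_sq:
  assumes "smooth f" "smooth g"
  shows "partial b (\<lambda>z. f z * f z + g z * g z) = (\<lambda>z. 2 * (f z * partial b f z + g z * partial b g z))"
  using assms by (simp add: fun_eq_iff partial_add partial_mult smooth_mult smooth_differentiable algebra_simps)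

lemma partial_sum_prod:
  assumes "smooth f" "smooth g" "smooth h" "smooth k"
  shows "partial b (\<lambda>z. 2 * (f z * g z + h z * k z))
     = (\<lambda>z. 2 * ((f z * partial b g z + partial b f z * g z) + (h z * partial b k z + partial b h z * k z)))"
  using assms by (simp add: fun_eq_iff partial_cmult partial_add partial_mult smooth_mult smooth_add smooth_differentiable)

text \<open>The potential together with a sequence of test functions that converges to it in \<open>H\<^sup>3\<close>.\<close>

locale H3_approximation = graph +
  fixes \<phi> :: "real \<times> real \<Rightarrow> real" and \<psi> :: "nat \<Rightarrow> real \<times> real \<Rightarrow> real"
  assumes C11: "C11_on I \<eta>" and test: "\<And>n. test_function (\<psi> n)"
    and approx: "\<And>bs. set bs \<subseteq> Basis \<Longrightarrow> length bs \<le> 3 \<Longrightarrow>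
      L2tends lebesgue (\<lambda>n. partials bs (\<psi> n)) (wderiv bs \<phi>)"
begin

lemma test_p: "set bs \<subseteq> Basis \<Longrightarrow> test_function (partials bs (\<psi> n))"
  by (rule test_partials[OF test])

lemma smooth_p: "set bs \<subseteq> Basis \<Longrightarrow> smooth (partials bs (\<psi> n))"
  by (rule test_smooth[OF test_p])

lemma Cauchy_p:
  assumes "set as \<subseteq> Basis" "length as + length bs \<le> 3" "set bs \<subseteq> Basis"
  shows "L2Cauchy lebesgue (\<lambda>n. partials bs (partials as (\<psi> n)))"
  using L2tends_imp_Cauchy[OF approx[of "bs @ as"]] assms by (simp add: partials_append)

text \<open>Derivatives of order at most two still have one derivative under control, which suffices to multiply
two of them.\<close>

lemma product_11:
  assumes "set as \<subseteq> Basis" "length as \<le> 2" "set cs \<subseteq> Basis" "length cs \<le> 2"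
  shows "L2tends lebesgue (\<lambda>n z. partials as (\<psi> n) z * partials cs (\<psi> n) z) (\<lambda>z. wderiv as \<phi> z * wderiv cs \<phi> z)"
proof (rule L2tends_mult)
  show "L2Cauchy lebesgue (\<lambda>n z. partials as (\<psi> n) z * partials cs (\<psi> n) z)"
    by (rule product_Cauchy[of _ _ H1_ix H1_ix 1])
       (use assms H1_ix in \<open>auto intro!: test_p Cauchy_p product_bound_11[unfolded mult_1] simp del: partials.simps partials_Cons simp: Basis_plane\<close>)
qed (use assms in \<open>auto intro!: approx\<close>)

text \<open>A first derivative of \<open>\<psi>\<^sub>n\<close> has two more derivatives under control, so it converges uniformly and may
multiply a third derivative.\<close>

lemma product_20:
  assumes "set as \<subseteq> Basis" "length as \<le> 1" "set cs \<subseteq> Basis" "length cs \<le> 3"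
  shows "L2tends lebesgue (\<lambda>n z. partials as (\<psi> n) z * partials cs (\<psi> n) z) (\<lambda>z. wderiv as \<phi> z * wderiv cs \<phi> z)"
proof (rule L2tends_mult)
  show "L2Cauchy lebesgue (\<lambda>n z. partials as (\<psi> n) z * partials cs (\<psi> n) z)"
    by (rule product_Cauchy[of _ _ mixed_ix "{[]}" 2])
       (use assms mixed_ix in \<open>auto intro!: test_p Cauchy_p product_bound_20 simp del: partials.simps partials_Cons simp: Basis_plane\<close>)
qed (use assms in \<open>auto intro!: approx\<close>)

lemma trace_p:
  assumes "set bs \<subseteq> Basis" "length bs \<le> 2" "{a..b} \<subseteq> I"
  shows "L2tends (lebesgue_on {a..b}) (\<lambda>n x. partials bs (\<psi> n) (x, \<eta> x)) (graph_trace I \<eta> (wderiv bs \<phi>))"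
proof -
  have v: "L2tends lebesgue (\<lambda>n. partial b (partials bs (\<psi> n))) (wderiv (b # bs) \<phi>)" if "b \<in> Basis" for b
    using approx[of "b # bs"] that assms by simp
  have u: "L2tends lebesgue (\<lambda>n. partials bs (\<psi> n)) (wderiv bs \<phi>)" using approx assms by simp
  note H = limit_H1[OF test_p[OF assms(1)] u v]
  show ?thesis by (rule graph_trace_L2tends[OF H(1) test_p[OF assms(1)] H(2) assms(3)])
qed

abbreviation "px n \<equiv> partials [(1, 0)] (\<psi> n)"
abbreviation "py n \<equiv> partials [(0, 1)] (\<psi> n)"

definition grad_sq_approx :: "nat \<Rightarrow> real \<times> real \<Rightarrow> real" where
  "grad_sq_approx n z = px n z * px n z + py n z * py n z"

definition grad_sq_approx_deriv :: "real \<times> real \<Rightarrow> nat \<Rightarrow> real \<times> real \<Rightarrow> real" where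
  "grad_sq_approx_deriv b n z = 2 * (px n z * partials [b, (1, 0)] (\<psi> n) z + py n z * partials [b, (0, 1)] (\<psi> n) z)"

lemma smooth_xy: "smooth (px n)" "smooth (py n)"
  by (rule smooth_p, simp add: Basis_plane)+

lemma smooth_bxy: "b \<in> Basis \<Longrightarrow> smooth (partials [b, (1, 0)] (\<psi> n))" "b \<in> Basis \<Longrightarrow> smooth (partials [b, (0, 1)] (\<psi> n))"
  by (rule smooth_p, simp add: Basis_plane)+

lemma test_grad_sq_approx: "test_function (grad_sq_approx n)"
  unfolding grad_sq_approx_def[abs_def] by (intro test_add test_mult_left smooth_xy test_p) (auto simp: Basis_plane)

lemma partial_grad_sq_approx: "partial b (grad_sq_approx n) = grad_sq_approx_deriv b n"
  unfolding grad_sq_approx_def[abs_def] partial_sum_sq[OF smooth_xy] by (simp add: grad_sq_approx_deriv_def fun_eq_iff)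

lemma grad_sq_approx_tends: "L2tends lebesgue grad_sq_approx (grad_sq \<phi>)"
proof -
  have "L2tends lebesgue (\<lambda>n z. px n z * px n z + py n z * py n z)
     (\<lambda>z. wderiv [(1, 0)] \<phi> z * wderiv [(1, 0)] \<phi> z + wderiv [(0, 1)] \<phi> z * wderiv [(0, 1)] \<phi> z)"
    by (intro L2tends_add product_11) (auto simp: Basis_plane)
  then show ?thesis unfolding grad_sq_approx_def[abs_def] grad_sq_eq[abs_def] power2_eq_square .
qed

definition grad_sq_weak_deriv :: "real \<times> real \<Rightarrow> real \<times> real \<Rightarrow> real" where
  "grad_sq_weak_deriv b z = 2 * (wderiv [(1, 0)] \<phi> z * wderiv [b, (1, 0)] \<phi> z + wderiv [(0, 1)] \<phi> z * wderiv [b, (0, 1)] \<phi> z)"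

lemma grad_sq_approx_deriv_tends: "b \<in> Basis \<Longrightarrow> L2tends lebesgue (grad_sq_approx_deriv b) (grad_sq_weak_deriv b)"
  unfolding grad_sq_approx_deriv_def[abs_def] grad_sq_weak_deriv_def[abs_def]
  by (intro L2tends_scale L2tends_add product_11) (auto simp: Basis_plane)

lemma grad_sq_approx_second_deriv_tends:
  assumes "b \<in> Basis" "c \<in> Basis"
  shows "L2tends lebesgue (\<lambda>n. partial c (grad_sq_approx_deriv b n)) (\<lambda>z. 2 * (
     (wderiv [(1, 0)] \<phi> z * wderiv [c, b, (1, 0)] \<phi> z + wderiv [c, (1, 0)] \<phi> z * wderiv [b, (1, 0)] \<phi> z) +
     (wderiv [(0, 1)] \<phi> z * wderiv [c, b, (0, 1)] \<phi> z + wderiv [c, (0, 1)] \<phi> z * wderiv [b, (0, 1)] \<phi> z)))"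
proof -
  have "partial c (grad_sq_approx_deriv b n) = (\<lambda>z. 2 * (
     (px n z * partials [c, b, (1, 0)] (\<psi> n) z + partials [c, (1, 0)] (\<psi> n) z * partials [b, (1, 0)] (\<psi> n) z) +
     (py n z * partials [c, b, (0, 1)] (\<psi> n) z + partials [c, (0, 1)] (\<psi> n) z * partials [b, (0, 1)] (\<psi> n) z)))" for n
    unfolding grad_sq_approx_deriv_def[abs_def] partial_sum_prod[OF smooth_xy(1) smooth_bxy(1)[OF assms(1)] smooth_xy(2) smooth_bxy(2)[OF assms(1)]]
    by simp
  then show ?thesis
    using assms by (simp only:) (intro L2tends_scale L2tends_add product_11 product_20; simp add: Basis_plane)
qed

lemma grad_sq_H1: "grad_sq \<phi> \<in> sobolev_H 1" "tends_in_H1 grad_sq_approx (grad_sq \<phi>)"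
  and wderiv_grad_sq: "b \<in> Basis \<Longrightarrow> AE z in lebesgue. wderiv [b] (grad_sq \<phi>) z = grad_sq_weak_deriv b z"
  using limit_H1[OF test_grad_sq_approx grad_sq_approx_tends, of grad_sq_weak_deriv] grad_sq_approx_deriv_tends by (simp_all add: partial_grad_sq_approx)

lemma trace_grad_sq:
  "{a..b} \<subseteq> I \<Longrightarrow> L2tends (lebesgue_on {a..b}) (\<lambda>n x. grad_sq_approx n (x, \<eta> x)) (graph_trace I \<eta> (grad_sq \<phi>))"
  by (rule graph_trace_L2tends[OF grad_sq_H1(1) test_grad_sq_approx grad_sq_H1(2)])

text \<open>The derivative \<open>wderiv [b] (grad_sq \<phi>)\<close> is an arbitrary representative of \<open>grad_sq_weak_deriv b\<close>; mean square
limits do not distinguish the two.\<close>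

lemma trace_wderiv_grad_sq:
  assumes b: "b \<in> Basis" and K: "{\<alpha>..\<beta>} \<subseteq> I"
  shows "L2tends (lebesgue_on {\<alpha>..\<beta>}) (\<lambda>n x. grad_sq_approx_deriv b n (x, \<eta> x)) (graph_trace I \<eta> (wderiv [b] (grad_sq \<phi>)))"
proof -
  have t: "test_function (grad_sq_approx_deriv b n)" for n using test_partial[OF test_grad_sq_approx b, of n] by (simp add: partial_grad_sq_approx)
  have w: "has_weak_deriv [b] (grad_sq \<phi>) (grad_sq_weak_deriv b)"
    by (rule limit_weak_deriv[OF test_grad_sq_approx grad_sq_approx_tends _ b]) (simp add: partial_grad_sq_approx grad_sq_approx_deriv_tends[OF b])
  have ae: "AE z in lebesgue. grad_sq_weak_deriv b z = wderiv [b] (grad_sq \<phi>) z"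
    using wderiv_grad_sq[OF b] by eventually_elim simp
  have u: "L2tends lebesgue (grad_sq_approx_deriv b) (wderiv [b] (grad_sq \<phi>))"
    by (rule L2tends_cong_AE[OF grad_sq_approx_deriv_tends[OF b] L2_measurable[OF test_L2[OF t]] wderiv_measurable[OF w] _ ae]) simp
  note H = limit_H1[OF t u grad_sq_approx_second_deriv_tends[OF b]]
  show ?thesis by (rule graph_trace_L2tends[OF H(1) t H(2) K])
qed

lemma derivative_along_graph:
  assumes f: "smooth f" and x: "x \<in> I"
  shows "((\<lambda>x. f (x, \<eta> x)) has_real_derivative partial (1, 0) f (x, \<eta> x) + deriv \<eta> x * partial (0, 1) f (x, \<eta> x)) (at x)"
proof -
  have D: "(f has_derivative (\<lambda>h. \<Sum>b\<in>Basis. (h \<bullet> b) * partial b f (x, \<eta> x))) (at (x, \<eta> x))"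
    by (rule has_derivative_partial[OF smooth_differentiable[OF f]])
  have "(\<eta> has_derivative (\<lambda>h. h * deriv \<eta> x)) (at x)"
    using C11_deriv_continuous(1)[OF open_I C11 x] by (simp add: has_field_derivative_def mult_commute_abs)
  then have "((\<lambda>x. (x, \<eta> x)) has_derivative (\<lambda>h. (h, h * deriv \<eta> x))) (at x)"
    by (intro has_derivative_Pair has_derivative_ident)
  from has_derivative_compose[OF this D]
  have "((\<lambda>x. f (x, \<eta> x)) has_derivative (\<lambda>h. \<Sum>b\<in>Basis. ((h, h * deriv \<eta> x) \<bullet> b) * partial b f (x, \<eta> x))) (at x)" .
  moreover have "(\<lambda>h. \<Sum>b\<in>Basis. ((h, h * deriv \<eta> x) \<bullet> b) * partial b f (x, \<eta> x))
      = (*) (partial (1, 0) f (x, \<eta> x) + deriv \<eta> x * partial (0, 1) f (x, \<eta> x))"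
    by (auto simp: fun_eq_iff Basis_plane_eq algebra_simps)
  ultimately show ?thesis by (simp only: has_field_derivative_def)
qed

lemma ftc_along_graph:
  assumes f: "smooth f" and K: "{a..b} \<subseteq> I" and xy: "a \<le> x" "x \<le> y" "y \<le> b"
  shows "f (y, \<eta> y) - f (x, \<eta> x) = (LINT t|lebesgue_on {a..b}.
    (partial (1, 0) f (t, \<eta> t) + deriv \<eta> t * partial (0, 1) f (t, \<eta> t)) * indicator {x..y} t)"
proof -
  define d where "d = (\<lambda>t. partial (1, 0) f (t, \<eta> t) + deriv \<eta> t * partial (0, 1) f (t, \<eta> t))"
  have I: "t \<in> I" if "x \<le> t" "t \<le> y" for t using K that xy by auto
  have dc: "isCont d t" if t: "t \<in> I" for t
  proof -
    have "isCont \<eta> t" using C11_deriv_continuous(1)[OF open_I C11 t] DERIV_isCont by blast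
    then have p: "isCont (\<lambda>t. (t, \<eta> t)) t" by (intro continuous_intros)
    have "isCont (partial b f) z" if "b \<in> Basis" for b z
      using smooth_differentiable[OF smooth_partial[OF f that]] differentiable_imp_continuous_within by blast
    then have "isCont (\<lambda>t. partial b f (t, \<eta> t)) t" if "b \<in> Basis" for b
      using isCont_o2[OF p] that by blast
    then show ?thesis unfolding d_def
      by (intro continuous_intros C11_deriv_continuous(2)[OF open_I C11 t]) (auto simp: Basis_plane)
  qed
  have "f (y, \<eta> y) - f (x, \<eta> x) = (LINT t|lborel. d t * indicator {x..y} t)"
    by (rule integral_FTC_Icc_real[symmetric, OF xy(2)])
       (use derivative_along_graph[OF f I] dc I in \<open>auto simp: d_def\<close>)
  also have "\<dots> = (LINT t|lebesgue. d t * indicator {x..y} t)"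
  proof (rule integral_completion[symmetric])
    have "continuous_on {x..y} d" using dc I by (intro continuous_at_imp_continuous_on) auto
    from borel_measurable_continuous_on_indicator[OF _ this]
    show "(\<lambda>t. d t * indicator {x..y} t) \<in> borel_measurable lborel" by (simp add: mult.commute)
  qed
  also have "\<dots> = (LINT t|lebesgue. indicator {a..b} t *\<^sub>R (d t * indicator {x..y} t))"
    by (rule Bochner_Integration.integral_cong) (use xy in \<open>auto simp: indicator_def\<close>)
  also have "\<dots> = (LINT t|lebesgue_on {a..b}. d t * indicator {x..y} t)"
    by (rule integral_restrict_space[symmetric]) simp
  finally show ?thesis unfolding d_def .
qed

text \<open>The slope is bounded on a compact subinterval, so the derivatives along the graph of \<open>\<partial>\<^sub>c \<psi>\<^sub>n\<close> converge in
the mean square.\<close>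

lemma trace_absolutely_continuous:
  assumes c: "c \<in> Basis" and K: "{a..b} \<subseteq> I" and ab: "a < b"
  obtains F where "continuous_on UNIV F" "AE x in lebesgue_on {a..b}. graph_trace I \<eta> (wderiv [c] \<phi>) x = F x"
    "AE x in lebesgue_on {a..b}. (F has_real_derivative graph_trace I \<eta> (wderiv [(1, 0), c] \<phi>) x
        + deriv \<eta> x * graph_trace I \<eta> (wderiv [(0, 1), c] \<phi>) x) (at x)"
proof -
  let ?M = "lebesgue_on {a..b}"
  have dc: "continuous_on {a..b} (deriv \<eta>)"
    using C11_deriv_continuous(2)[OF open_I C11] K by (intro continuous_at_imp_continuous_on) auto
  have "bounded (deriv \<eta> ` {a..b})"
    by (rule compact_imp_bounded[OF compact_continuous_image[OF dc]]) simp
  then obtain B where "\<forall>y\<in>deriv \<eta> ` {a..b}. norm y \<le> B" unfolding bounded_iff by blast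
  then have B: "\<bar>deriv \<eta> x\<bar> \<le> B" if "x \<in> {a..b}" for x using that by simp
  have dm: "deriv \<eta> \<in> borel_measurable ?M"
    by (rule continuous_imp_measurable_on_sets_lebesgue[OF dc]) simp
  have 1: "L2tends ?M (\<lambda>n x. partials [(1, 0), c] (\<psi> n) (x, \<eta> x)) (graph_trace I \<eta> (wderiv [(1, 0), c] \<phi>))"
    by (rule trace_p) (use c K in \<open>auto simp: Basis_plane\<close>)
  have 2: "L2tends ?M (\<lambda>n x. partials [(0, 1), c] (\<psi> n) (x, \<eta> x)) (graph_trace I \<eta> (wderiv [(0, 1), c] \<phi>))"
    by (rule trace_p) (use c K in \<open>auto simp: Basis_plane\<close>)
  have d: "L2tends ?M (\<lambda>n x. partials [(1, 0), c] (\<psi> n) (x, \<eta> x) + deriv \<eta> x * partials [(0, 1), c] (\<psi> n) (x, \<eta> x))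
     (\<lambda>x. graph_trace I \<eta> (wderiv [(1, 0), c] \<phi>) x + deriv \<eta> x * graph_trace I \<eta> (wderiv [(0, 1), c] \<phi>) x)"
    by (rule L2tends_add[OF 1 L2tends_bounded_mult[OF 2 dm]]) (use B in auto)
  have f: "L2tends ?M (\<lambda>n x. partials [c] (\<psi> n) (x, \<eta> x)) (graph_trace I \<eta> (wderiv [c] \<phi>))"
    by (rule trace_p) (use c K in auto)
  have s: "smooth (partials [c] (\<psi> n))" for n by (rule smooth_p) (use c in auto)
  show ?thesis
    by (rule absolutely_continuous_limit[OF ab _ f d], use ftc_along_graph[OF s K] in simp, rule that)
qed

text \<open>All restrictions to the graph converge almost everywhere along a common subsequence, which turns
the identities between derivatives of \<open>\<psi>\<^sub>n\<close> into identities between the chosen traces.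
The boundary condition, known almost everywhere, holds at every point of the open interval for
the continuous representatives \<open>F\<close> and \<open>G\<close>, and so may be differentiated.\<close>

lemma identity_on_interval:
  assumes K: "{a..b} \<subseteq> I" and ab: "a < b" and N: "AE x in lebesgue_on I. normal_deriv I \<eta> \<phi> x = 0"
  shows "AE x in lebesgue. x \<in> {a<..<b} \<longrightarrow>
    normal_deriv I \<eta> (grad_sq \<phi>) x = 2 * curvature \<eta> x * graph_trace I \<eta> (grad_sq \<phi>) x"
proof -
  let ?M = "lebesgue_on {a..b}"
  let ?t = "\<lambda>bs. graph_trace I \<eta> (wderiv bs \<phi>)"
  let ?G = "graph_trace I \<eta> (grad_sq \<phi>)"
  have K': "{a<..<b} \<subseteq> I" by (rule order_trans[OF _ K]) auto
  let ?D = "\<lambda>b. graph_trace I \<eta> (wderiv [b] (grad_sq \<phi>))"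
  obtain F where F: "continuous_on UNIV F" "AE x in ?M. ?t [(1, 0)] x = F x"
    "AE x in ?M. (F has_real_derivative ?t [(1, 0), (1, 0)] x + deriv \<eta> x * ?t [(0, 1), (1, 0)] x) (at x)"
    by (rule trace_absolutely_continuous[OF Basis_plane(1) K ab])
  obtain G where G: "continuous_on UNIV G" "AE x in ?M. ?t [(0, 1)] x = G x"
    "AE x in ?M. (G has_real_derivative ?t [(1, 0), (0, 1)] x + deriv \<eta> x * ?t [(0, 1), (0, 1)] x) (at x)"
    by (rule trace_absolutely_continuous[OF Basis_plane(2) K ab])
  define A where "A = {(\<lambda>n x. px n (x, \<eta> x), ?t [(1, 0)]), (\<lambda>n x. py n (x, \<eta> x), ?t [(0, 1)]),
     (\<lambda>n x. partials [(1, 0), (1, 0)] (\<psi> n) (x, \<eta> x), ?t [(1, 0), (1, 0)]),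
     (\<lambda>n x. partials [(0, 1), (1, 0)] (\<psi> n) (x, \<eta> x), ?t [(0, 1), (1, 0)]),
     (\<lambda>n x. partials [(1, 0), (0, 1)] (\<psi> n) (x, \<eta> x), ?t [(1, 0), (0, 1)]),
     (\<lambda>n x. partials [(0, 1), (0, 1)] (\<psi> n) (x, \<eta> x), ?t [(0, 1), (0, 1)]),
     (\<lambda>n x. grad_sq_approx n (x, \<eta> x), ?G), (\<lambda>n x. grad_sq_approx_deriv (1, 0) n (x, \<eta> x), ?D (1, 0)), (\<lambda>n x. grad_sq_approx_deriv (0, 1) n (x, \<eta> x), ?D (0, 1))}"
  have tr: "L2tends ?M (\<lambda>n x. partials bs (\<psi> n) (x, \<eta> x)) (?t bs)" if "set bs \<subseteq> Basis" "length bs \<le> 2" for bs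
    by (rule trace_p[OF that K])
  have A: "finite A" "\<And>s l. (s, l) \<in> A \<Longrightarrow> L2tends ?M s l"
  proof -
    show "finite A" by (simp add: A_def)
    fix s l assume "(s, l) \<in> A"
    then show "L2tends ?M s l"
      unfolding A_def insert_iff empty_iff prod.inject
      by (elim disjE conjE FalseE; simp only:;
          intro tr trace_grad_sq[OF K] trace_wderiv_grad_sq[OF _ K]; simp add: Basis_plane)
  qed
  obtain r where r: "AE x in ?M. \<forall>(s, l)\<in>A. (\<lambda>n. s (r n) x) \<longlonglongrightarrow> l x"
    using L2tends_finite_subseq[of A ?M, OF A(1)] A(2) by blast
  have T: "AE x in ?M. ?G x = (?t [(1, 0)] x)\<^sup>2 + (?t [(0, 1)] x)\<^sup>2 \<and>
      ?D (1, 0) x = 2 * (?t [(1, 0)] x * ?t [(1, 0), (1, 0)] x + ?t [(0, 1)] x * ?t [(1, 0), (0, 1)] x) \<and>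
      ?D (0, 1) x = 2 * (?t [(1, 0)] x * ?t [(0, 1), (1, 0)] x + ?t [(0, 1)] x * ?t [(0, 1), (0, 1)] x) \<and>
      ?t [(0, 1), (1, 0)] x = ?t [(1, 0), (0, 1)] x"
    using r
  proof eventually_elim
    case (elim x)
    have x: "(\<lambda>n. px (r n) (x, \<eta> x)) \<longlonglongrightarrow> ?t [(1, 0)] x" and y: "(\<lambda>n. py (r n) (x, \<eta> x)) \<longlonglongrightarrow> ?t [(0, 1)] x"
      and xx: "(\<lambda>n. partials [(1, 0), (1, 0)] (\<psi> (r n)) (x, \<eta> x)) \<longlonglongrightarrow> ?t [(1, 0), (1, 0)] x"
      and yx: "(\<lambda>n. partials [(0, 1), (1, 0)] (\<psi> (r n)) (x, \<eta> x)) \<longlonglongrightarrow> ?t [(0, 1), (1, 0)] x"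
      and xy: "(\<lambda>n. partials [(1, 0), (0, 1)] (\<psi> (r n)) (x, \<eta> x)) \<longlonglongrightarrow> ?t [(1, 0), (0, 1)] x"
      and yy: "(\<lambda>n. partials [(0, 1), (0, 1)] (\<psi> (r n)) (x, \<eta> x)) \<longlonglongrightarrow> ?t [(0, 1), (0, 1)] x"
      and g: "(\<lambda>n. grad_sq_approx (r n) (x, \<eta> x)) \<longlonglongrightarrow> ?G x"
      and gx: "(\<lambda>n. grad_sq_approx_deriv (1, 0) (r n) (x, \<eta> x)) \<longlonglongrightarrow> ?D (1, 0) x"
      and gy: "(\<lambda>n. grad_sq_approx_deriv (0, 1) (r n) (x, \<eta> x)) \<longlonglongrightarrow> ?D (0, 1) x"
      using elim unfolding A_def by (simp_all only: ball_simps prod.case insert_iff)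
    have "(\<lambda>n. grad_sq_approx (r n) (x, \<eta> x)) \<longlonglongrightarrow> ?t [(1, 0)] x * ?t [(1, 0)] x + ?t [(0, 1)] x * ?t [(0, 1)] x"
      unfolding grad_sq_approx_def by (intro tendsto_intros x y)
    then have 1: "?G x = (?t [(1, 0)] x)\<^sup>2 + (?t [(0, 1)] x)\<^sup>2"
      unfolding power2_eq_square by (rule LIMSEQ_unique[OF g])
    have "(\<lambda>n. grad_sq_approx_deriv (1, 0) (r n) (x, \<eta> x)) \<longlonglongrightarrow> 2 * (?t [(1, 0)] x * ?t [(1, 0), (1, 0)] x + ?t [(0, 1)] x * ?t [(1, 0), (0, 1)] x)"
      unfolding grad_sq_approx_deriv_def by (intro tendsto_mult tendsto_add tendsto_const x y xx xy)
    then have 2: "?D (1, 0) x = 2 * (?t [(1, 0)] x * ?t [(1, 0), (1, 0)] x + ?t [(0, 1)] x * ?t [(1, 0), (0, 1)] x)"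
      by (rule LIMSEQ_unique[OF gx])
    have "(\<lambda>n. grad_sq_approx_deriv (0, 1) (r n) (x, \<eta> x)) \<longlonglongrightarrow> 2 * (?t [(1, 0)] x * ?t [(0, 1), (1, 0)] x + ?t [(0, 1)] x * ?t [(0, 1), (0, 1)] x)"
      unfolding grad_sq_approx_deriv_def by (intro tendsto_mult tendsto_add tendsto_const x y yx yy)
    then have 3: "?D (0, 1) x = 2 * (?t [(1, 0)] x * ?t [(0, 1), (1, 0)] x + ?t [(0, 1)] x * ?t [(0, 1), (0, 1)] x)"
      by (rule LIMSEQ_unique[OF gy])
    have "partials [(0, 1), (1, 0)] (\<psi> (r n)) = partials [(1, 0), (0, 1)] (\<psi> (r n))" for n
      using partial_commute[OF test_smooth[OF test]] by simp
    then have 4: "?t [(0, 1), (1, 0)] x = ?t [(1, 0), (0, 1)] x"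
      using yx xy by (simp only:) (rule LIMSEQ_unique)
    show ?case using 1 2 3 4 by blast
  qed
  have toleb: "AE x in lebesgue. x \<in> {a..b} \<longrightarrow> P x" if "AE x in ?M. P x" for P
    using that by (simp add: AE_restrict_space_iff)
  have NI: "AE x in lebesgue. x \<in> I \<longrightarrow> normal_deriv I \<eta> \<phi> x = 0"
    using N open_I by (simp add: AE_restrict_space_iff)
  have FG: "G y = deriv \<eta> y * F y" if y: "y \<in> {a<..<b}" for y
  proof -
    have "G y - deriv \<eta> y * F y = 0"
    proof (rule continuous_AE_zero[OF _ _ y])
      show "continuous_on {a<..<b} (\<lambda>y. G y - deriv \<eta> y * F y)"
      proof (intro continuous_intros continuous_on_subset[OF F(1)] continuous_on_subset[OF G(1)])
        show "continuous_on {a<..<b} (deriv \<eta>)"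
          using C11_deriv_continuous(2)[OF open_I C11] K'
          by (intro continuous_at_imp_continuous_on ballI) blast
      qed auto
      show "AE x in lebesgue. x \<in> {a<..<b} \<longrightarrow> G x - deriv \<eta> x * F x = 0"
        using toleb[OF F(2)] toleb[OF G(2)] NI
      proof eventually_elim
        case (elim x)
        show ?case
        proof
          assume x: "x \<in> {a<..<b}"
          then have "normal_deriv I \<eta> \<phi> x = 0" using elim(3) K' by blast
          moreover have "sqrt (1 + (deriv \<eta> x)\<^sup>2) \<noteq> 0" by (simp add: add_nonneg_eq_0_iff)
          ultimately have "?t [(0, 1)] x - deriv \<eta> x * ?t [(1, 0)] x = 0"
            by (simp add: normal_deriv_def unit_normal_def field_simps)
          then show "G x - deriv \<eta> x * F x = 0" using elim x by simp
        qed
      qed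
    qed
    then show ?thesis by simp
  qed
  show ?thesis
    using toleb[OF F(2)] toleb[OF F(3)] toleb[OF G(2)] toleb[OF G(3)] toleb[OF T]
  proof eventually_elim
    case (elim x)
    show ?case
    proof
      assume x: "x \<in> {a<..<b}"
      then have xab: "x \<in> {a..b}" by auto
      note e = elim[rule_format, OF xab]
      have yx: "?t [(0, 1), (1, 0)] x = ?t [(1, 0), (0, 1)] x" using e(5) by blast
      have "unit_normal \<eta> x \<bullet> (2 * (F x * ?t [(1, 0), (1, 0)] x + G x * ?t [(1, 0), (0, 1)] x),
          2 * (F x * ?t [(1, 0), (0, 1)] x + G x * ?t [(0, 1), (0, 1)] x))
        = 2 * curvature \<eta> x * ((F x)\<^sup>2 + (G x)\<^sup>2)"
        by (rule curvature_identity[OF x FG e(2)[unfolded yx] e(4)])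
      then show "normal_deriv I \<eta> (grad_sq \<phi>) x = 2 * curvature \<eta> x * ?G x"
        unfolding normal_deriv_def using e(1,3,5) by simp
    qed
  qed
qed

end

theorem mainTheorem3:
  fixes I :: "real set" and \<eta> :: "real \<Rightarrow> real" and \<phi> :: "real \<times> real \<Rightarrow> real"
  assumes "open I" and "is_interval I"
    and "C11_on I \<eta>"
    and "\<phi> \<in> sobolev_H 3"
    and "AE x in lebesgue_on I. normal_deriv I \<eta> \<phi> x = 0"
  shows "AE x in lebesgue_on I.
    normal_deriv I \<eta> (grad_sq \<phi>) x = 2 * curvature \<eta> x * graph_trace I \<eta> (grad_sq \<phi>) x"
proof -
  obtain \<psi> where \<psi>: "\<And>n. test_function (\<psi> n)"
    "\<And>bs. set bs \<subseteq> Basis \<Longrightarrow> length bs \<le> 3 \<Longrightarrow> L2tends lebesgue (\<lambda>n. partials bs (\<psi> n)) (wderiv bs \<phi>)"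
    using sobolev_dense[OF assms(4)] by blast
  have "continuous_on I \<eta>"
    using C11_deriv_continuous(1)[OF assms(1,3)] DERIV_isCont by (intro continuous_at_imp_continuous_on) blast
  then interpret H3_approximation I \<eta> \<phi> \<psi>
    using assms \<psi> by unfold_locales auto
  let ?P = "\<lambda>x. normal_deriv I \<eta> (grad_sq \<phi>) x = 2 * curvature \<eta> x * graph_trace I \<eta> (grad_sq \<phi>) x"
  \<comment> \<open>Countably many intervals with rational endpoints exhaust \<open>I\<close>.\<close>
  have "AE x in lebesgue. \<forall>p\<in>{p \<in> \<rat> \<times> \<rat>. fst p < snd p \<and> {fst p..snd p} \<subseteq> I}. x \<in> {fst p<..<snd p} \<longrightarrow> ?P x"
  proof (subst AE_ball_countable)
    show "countable {p \<in> \<rat> \<times> \<rat>. fst p < snd p \<and> {fst p..snd p} \<subseteq> I}"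
      by (rule countable_subset[of _ "\<rat> \<times> \<rat>"]) (auto simp: countable_rat)
    show "\<forall>p\<in>{p \<in> \<rat> \<times> \<rat>. fst p < snd p \<and> {fst p..snd p} \<subseteq> I}. AE x in lebesgue. x \<in> {fst p<..<snd p} \<longrightarrow> ?P x"
      using identity_on_interval[OF _ _ assms(5)] by blast
  qed
  then have "AE x in lebesgue. x \<in> I \<longrightarrow> ?P x"
  proof eventually_elim
    case (elim x)
    show ?case
    proof
      assume "x \<in> I"
      then obtain e where e: "e > 0" "cball x e \<subseteq> I" using assms(1) open_contains_cball by blast
      obtain q where q: "q \<in> \<rat>" "x - e < q" "q < x" using Rats_dense_in_real[of "x - e" x] e by auto
      obtain r where r: "r \<in> \<rat>" "x < r" "r < x + e" using Rats_dense_in_real[of x "x + e"] e by auto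
      have "{q..r} \<subseteq> I" using e(2) q r by (auto simp: subset_eq dist_real_def)
      then show "?P x" using elim[rule_format, of "(q, r)"] q r by auto
    qed
  qed
  then show ?thesis using assms(1) by (simp add: AE_restrict_space_iff)
qed

end
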